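(* Let $G$ be a graph on the vertex set $[n]$. Then the complex variety $X_G\subset\mathbb{C}^{4n}$ has dimension $2n+3$ if and only if $G$ contains a spanning subgraph $G'$ (on the same vertex set $[n]$) which is a Laman graph.
   Context: A graph $G=(V,E)$ is a Laman graph if $|E|=2|V|-3$ and every subgraph $G'=(V',E')$ with $|V'|\ge 2$ satisfies $|E'|\le 2|V'|-3$. For graphs on the same vertex set, $G_1\subset G_2$ means edge inclusion. All lines in $\mathbb{C}^3$ are assumed non-horizontal. A line $\ell(t)=(a,b,0)+t(c,d,1)$ is identified with $(a,b,c,d)\in\mathbb{C}^4$; a point $x\in\mathbb{C}^{4n}=(\mathbb{C}^4)^n$ is identified with a sequence $L(x)=(\ell_1,\dots,\ell_n)$ of lines. The intersection graph $G_L=([n],E)$ has $\{i,j\}\in E$ iff $i\ne j$ and $\ell_i,\ell_j$ intersect, are parallel, or coincide (equivalently $(a_i-a_j)(d_i-d_j)-(b_i-b_j)(c_i-c_j)=0$). $\hat X_G=\{x\in\mathbb{C}^{4n}: G\subset G_{L(x)}\text{ and the lines of }L(x)\text{ are pairwise distinct}\}$, and $X_G$ is its Zariski closure. *)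

theory Defs
  imports "HOL-Analysis.Analysis"
begin

section \<open>The Zariski topology on complex affine space and dimension\<close>

text \<open>Affine space with coordinates indexed by a set \<open>I\<close> is \<open>extensional I\<close>, the functions on
  \<open>I\<close> (with the default value outside \<open>I\<close>). As the complex field is infinite, polynomials in the
  variables \<open>I\<close> may be identified with the functions that they define.\<close>

inductive_set poly_functions :: "'i set \<Rightarrow> (('i \<Rightarrow> complex) \<Rightarrow> complex) set" for I where
  const: "(\<lambda>x. c) \<in> poly_functions I"
| coord: "i \<in> I \<Longrightarrow> (\<lambda>x. x i) \<in> poly_functions I"
| add: "f \<in> poly_functions I \<Longrightarrow> g \<in> poly_functions I \<Longrightarrow> (\<lambda>x. f x + g x) \<in> poly_functions I"
| mult: "f \<in> poly_functions I \<Longrightarrow> g \<in> poly_functions I \<Longrightarrow> (\<lambda>x. f x * g x) \<in> poly_functions I"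

definition zero_locus ::
  "'i set \<Rightarrow> (('i \<Rightarrow> complex) \<Rightarrow> complex) set \<Rightarrow> ('i \<Rightarrow> complex) set" where
  "zero_locus I F = {x \<in> extensional I. \<forall>f\<in>F. f x = 0}"

definition zariski :: "'i set \<Rightarrow> ('i \<Rightarrow> complex) topology" where
  "zariski I = topology (\<lambda>U. \<exists>F\<subseteq>poly_functions I. U = extensional I - zero_locus I F)"

lemma istopology_zariski:
  "istopology (\<lambda>U. \<exists>F\<subseteq>poly_functions I. U = extensional I - zero_locus I F)"
  unfolding istopology_def
proof (intro conjI allI impI)
  fix U V
  assume "\<exists>F\<subseteq>poly_functions I. U = extensional I - zero_locus I F"
    and "\<exists>F\<subseteq>poly_functions I. V = extensional I - zero_locus I F"
  then obtain F G where F: "F \<subseteq> poly_functions I" "U = extensional I - zero_locus I F"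
    and G: "G \<subseteq> poly_functions I" "V = extensional I - zero_locus I G" by blast
  let ?H = "{\<lambda>x. f x * g x | f g. f \<in> F \<and> g \<in> G}"
  have "?H \<subseteq> poly_functions I"
    using F(1) G(1) by (auto intro!: poly_functions.mult)
  moreover have "U \<inter> V = extensional I - zero_locus I ?H"
    unfolding F(2) G(2) zero_locus_def by fastforce
  ultimately show "\<exists>F\<subseteq>poly_functions I. U \<inter> V = extensional I - zero_locus I F" by blast
next
  fix K
  assume "\<forall>U\<in>K. \<exists>F\<subseteq>poly_functions I. U = extensional I - zero_locus I F"
  then obtain \<F> where \<F>: "\<And>U. U \<in> K \<Longrightarrow> \<F> U \<subseteq> poly_functions I"
      "\<And>U. U \<in> K \<Longrightarrow> U = extensional I - zero_locus I (\<F> U)" by metis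
  have "\<Union>K = (\<Union>U\<in>K. extensional I - zero_locus I (\<F> U))"
    using \<F>(2) by auto
  also have "\<dots> = extensional I - zero_locus I (\<Union>U\<in>K. \<F> U)"
    unfolding zero_locus_def by auto
  finally show "\<exists>F\<subseteq>poly_functions I. \<Union>K = extensional I - zero_locus I F"
    using \<F>(1) by (intro exI[of _ "\<Union>U\<in>K. \<F> U"]) auto
qed

lemma openin_zariski:
  "openin (zariski I) U \<longleftrightarrow> (\<exists>F\<subseteq>poly_functions I. U = extensional I - zero_locus I F)"
  by (simp add: zariski_def istopology_zariski)

lemma topspace_zariski: "topspace (zariski I) = extensional I"
proof
  have "zero_locus I {\<lambda>x. 1} = {}" by (simp add: zero_locus_def)
  moreover have "{\<lambda>x. 1} \<subseteq> poly_functions I" by (simp add: poly_functions.const)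
  ultimately have "openin (zariski I) (extensional I)"
    unfolding openin_zariski by (metis Diff_empty)
  then show "extensional I \<subseteq> topspace (zariski I)" by (rule openin_subset)
  show "topspace (zariski I) \<subseteq> extensional I"
    using openin_topspace[of "zariski I"] unfolding openin_zariski by auto
qed

lemma closedin_zariski:
  "closedin (zariski I) Z \<longleftrightarrow> (\<exists>F\<subseteq>poly_functions I. Z = zero_locus I F)"
proof -
  have "zero_locus I F \<subseteq> extensional I" for F by (auto simp: zero_locus_def)
  then show ?thesis
    unfolding closedin_def topspace_zariski openin_zariski by (metis double_diff order_refl)
qed

definition irreducible_in :: "'a topology \<Rightarrow> 'a set \<Rightarrow> bool" where
  "irreducible_in T S \<longleftrightarrow> S \<noteq> {} \<and> S \<subseteq> topspace T \<and>
     (\<forall>A B. closedin T A \<and> closedin T B \<and> S \<subseteq> A \<union> B \<longrightarrow> S \<subseteq> A \<or> S \<subseteq> B)"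

text \<open>The Krull dimension of a topological space; for Zariski closed sets this is the dimension of
  the variety. (The empty space, conventionally of negative dimension, gets the value 0 here.)\<close>

definition krull_dim :: "'a topology \<Rightarrow> enat" where
  "krull_dim T = Sup {enat k | k. \<exists>Z :: nat \<Rightarrow> 'a set.
     (\<forall>i\<le>k. closedin T (Z i) \<and> irreducible_in T (Z i)) \<and> (\<forall>i<k. Z i \<subset> Z (Suc i))}"

section \<open>Laman graphs\<close>

text \<open>A graph is given by its vertex set and its set of edges, which are two-element sets.\<close>

definition simple_graph :: "'v set \<Rightarrow> 'v set set \<Rightarrow> bool" where
  "simple_graph V E \<longleftrightarrow> finite V \<and> E \<subseteq> {{u, v} | u v. u \<in> V \<and> v \<in> V \<and> u \<noteq> v}"

text \<open>The counts are compared in the integers because subtraction of natural numbers truncates.\<close>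

definition laman :: "'v set \<Rightarrow> 'v set set \<Rightarrow> bool" where
  "laman V E \<longleftrightarrow> simple_graph V E \<and> int (card E) = 2 * int (card V) - 3 \<and>
     (\<forall>V' E'. simple_graph V' E' \<and> V' \<subseteq> V \<and> E' \<subseteq> E \<and> card V' \<ge> 2 \<longrightarrow>
        int (card E') \<le> 2 * int (card V') - 3)"

section \<open>Configurations of lines\<close>

type_synonym line_params = "complex \<times> complex \<times> complex \<times> complex"

fun line :: "line_params \<Rightarrow> (complex \<times> complex \<times> complex) set" where
  "line (a, b, c, d) = {(a + t * c, b + t * d, t) | t. True}"

text \<open>The direction vectors \<open>(c, d, 1)\<close> and \<open>(c', d', 1)\<close> are proportional only if they are equal.\<close>

fun parallel :: "line_params \<Rightarrow> line_params \<Rightarrow> bool" where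
  "parallel (a, b, c, d) (a', b', c', d') \<longleftrightarrow> (c, d) = (c', d')"

definition incident :: "line_params \<Rightarrow> line_params \<Rightarrow> bool" where
  "incident l m \<longleftrightarrow> line l \<inter> line m \<noteq> {} \<or> parallel l m \<or> line l = line m"

lemma incident_iff:
  "incident (a, b, c, d) (a', b', c', d') \<longleftrightarrow> (a - a') * (d - d') - (b - b') * (c - c') = 0"
proof
  assume "incident (a, b, c, d) (a', b', c', d')"
  then consider "c = c'" "d = d'"
    | t where "a + t * c = a' + t * c'" "b + t * d = b' + t * d'"
    unfolding incident_def by fastforce
  then show "(a - a') * (d - d') - (b - b') * (c - c') = 0"
    by cases (simp, algebra)
next
  assume eq: "(a - a') * (d - d') - (b - b') * (c - c') = 0"
  show "incident (a, b, c, d) (a', b', c', d')"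
  proof (cases "c = c' \<and> d = d'")
    case True
    then show ?thesis by (simp add: incident_def)
  next
    case False
    then obtain t where "a + t * c = a' + t * c'" "b + t * d = b' + t * d'"
    proof (cases "c = c'")
      case True
      with False have "d - d' \<noteq> 0" by simp
      with True eq show ?thesis
        by (intro that[of "- (b - b') / (d - d')"]) (simp_all add: field_simps)
    next
      case False
      then have "c - c' \<noteq> 0" by simp
      with eq show ?thesis
        by (intro that[of "- (a - a') / (c - c')"]) (simp_all add: field_simps)
    qed
    then show ?thesis unfolding incident_def by fastforce
  qed
qed

lemma line_eq_iff: "line l = line m \<longleftrightarrow> l = m"
proof
  obtain a b c d a' b' c' d' where lm: "l = (a, b, c, d)" "m = (a', b', c', d')"
    by (metis prod_cases4)
  assume eq: "line l = line m"
  have *: "a + t * c = a' + t * c' \<and> b + t * d = b' + t * d'" for t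
  proof -
    have "(a + t * c, b + t * d, t) \<in> line l" unfolding lm by auto
    then have "(a + t * c, b + t * d, t) \<in> line m" using eq by simp
    then show ?thesis unfolding lm by auto
  qed
  from *[of 0] *[of 1] show "l = m" unfolding lm by simp
qed simp

text \<open>Points of the space of sequences of \<open>n\<close> lines: the coordinates \<open>(i, 1), \<dots>, (i, 4)\<close> are the
  parameters \<open>a, b, c, d\<close> of the \<open>i\<close>-th line.\<close>

definition coords :: "nat \<Rightarrow> (nat \<times> nat) set" where
  "coords n = {1..n} \<times> {1..4}"

definition nth_line :: "(nat \<times> nat \<Rightarrow> complex) \<Rightarrow> nat \<Rightarrow> line_params" where
  "nth_line x i = (x (i, 1), x (i, 2), x (i, 3), x (i, 4))"

definition intersection_graph :: "nat \<Rightarrow> (nat \<times> nat \<Rightarrow> complex) \<Rightarrow> nat set set" where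
  "intersection_graph n x =
     {{i, j} | i j. i \<in> {1..n} \<and> j \<in> {1..n} \<and> i \<noteq> j \<and> incident (nth_line x i) (nth_line x j)}"

definition X_hat :: "nat \<Rightarrow> nat set set \<Rightarrow> (nat \<times> nat \<Rightarrow> complex) set" where
  "X_hat n E = {x \<in> extensional (coords n).
     E \<subseteq> intersection_graph n x \<and> inj_on (\<lambda>i. line (nth_line x i)) {1..n}}"

definition X_var :: "nat \<Rightarrow> nat set set \<Rightarrow> (nat \<times> nat \<Rightarrow> complex) set" where
  "X_var n E = zariski (coords n) closure_of X_hat n E"

end

theory Submission
  imports Defs "HOL-Computational_Algebra.Polynomial"
begin

text \<open>With \<open>q(a, b, c, d) = a d - b c\<close>, two lines are incident iff \<open>q\<close> vanishes on the difference of
  their parameters. We show that \<open>X_var n E\<close> has dimension \<open>4 n - r\<close>, where \<open>r\<close> is the size of some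
  edge set \<open>F \<subseteq> E\<close> satisfying Laman's counts on all vertex subsets; such an \<open>F\<close> is spanning Laman
  iff \<open>r = 2 n - 3\<close>.

  Upper bound, for every sparse \<open>F\<close>: a sparse graph has a vertex \<open>w\<close> of degree at most 3. The lines
  meeting one or two given distinct lines form families of dimension 3 and 2. The lines meeting three
  given distinct lines form a family of dimension 1, unless the three lines are pairwise incident; then
  the dimension may be 2, but the remaining lines realise the sparse graph \<open>F - w\<close> with an additional
  edge between two neighbours of \<open>w\<close> (Henneberg's move), which compensates for it. Dimension is
  measured by the growth of the spaces of polynomials of bounded degree restricted to a set.

  Lower bound, for some sparse \<open>F\<close>: incidence is linear in \<open>(a, b)\<close> for fixed \<open>(c, d)\<close>. A maximal set
  \<open>F\<close> of generically independent equations is sparse by the easy direction of Laman's theorem, and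
  the solutions are parametrised by \<open>(c, d)\<close> and \<open>2 n - r\<close> free coordinates; releasing the parameters
  one at a time gives a chain of irreducible closed sets.\<close>

section \<open>Polynomial functions and elimination\<close>

text \<open>Because the upper bound is available for every sparse set and the lower bound yields at
  least one, comparing the two replaces the hard direction of Laman's theorem, that sparse rows are
  generically independent. If \<open>E\<close> contains a Laman graph, this graph bounds the
  dimension by 2 n + 3, while the set given by the lower bound has at most 2 n - 3 edges.
  Conversely, dimension 2 n + 3 forces the latter set to have 2 n - 3 edges.

  The upper bound has to control every component, not only a generic one: for n at least 2, distinct
  concurrent lines already form a family of dimension 3 + 2 n inside \<open>X_hat n E\<close>,
  whatever \<open>E\<close> is. The arguments therefore stratify by the vanishing of polynomials,
  and the strata are neither closed nor irreducible. Distinctness of the lines is what makes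
  counting possible: meeting two coinciding lines is only one condition.\<close>

lemma poly_functions_sum:
  "finite A \<Longrightarrow> (\<And>a. a \<in> A \<Longrightarrow> f a \<in> poly_functions I) \<Longrightarrow> (\<lambda>x. \<Sum>a\<in>A. f a x) \<in> poly_functions I"
  by (induction A rule: finite_induct) (auto intro: poly_functions.intros)

lemma poly_functions_prod:
  "finite A \<Longrightarrow> (\<And>a. a \<in> A \<Longrightarrow> f a \<in> poly_functions I) \<Longrightarrow> (\<lambda>x. \<Prod>a\<in>A. f a x) \<in> poly_functions I"
  by (induction A rule: finite_induct) (auto intro: poly_functions.intros)

lemma poly_functions_power:
  "f \<in> poly_functions I \<Longrightarrow> (\<lambda>x. f x ^ k) \<in> poly_functions I"
  by (induction k) (auto intro: poly_functions.intros)

lemma poly_functions_diff: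
  assumes "f \<in> poly_functions I" "g \<in> poly_functions I"
  shows "(\<lambda>x. f x - g x) \<in> poly_functions I"
proof -
  have "(\<lambda>x. f x + (-1) * g x) \<in> poly_functions I"
    using assms by (intro poly_functions.intros)
  then show ?thesis by simp
qed

lemmas poly_functions_intros = poly_functions.intros poly_functions_sum poly_functions_prod
  poly_functions_power poly_functions_diff

lemma poly_functions_comp:
  assumes "f \<in> poly_functions I" "\<And>i. i \<in> I \<Longrightarrow> (\<lambda>y. \<phi> y i) \<in> poly_functions J"
  shows "(\<lambda>y. f (\<phi> y)) \<in> poly_functions J"
  using assms by (induction f rule: poly_functions.induct) (auto intro: poly_functions.intros)

lemma poly_functions_mono:
  assumes "f \<in> poly_functions I" "I \<subseteq> J"
  shows "f \<in> poly_functions J"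
  using assms by (induction f rule: poly_functions.induct) (auto intro: poly_functions.intros)

lemma poly_functions_cong:
  assumes "f \<in> poly_functions I" "\<And>i. i \<in> I \<Longrightarrow> x i = y i"
  shows "f x = f y"
  using assms by (induction f rule: poly_functions.induct) auto

lemma poly_functions_line:
  assumes "f \<in> poly_functions I"
  shows "\<exists>p. \<forall>t. f (\<lambda>i. x i + t * (y i - x i)) = poly p t"
  using assms
proof (induction f rule: poly_functions.induct)
  case (const c)
  show ?case by (rule exI[of _ "[:c:]"]) simp
next
  case (coord i)
  show ?case by (rule exI[of _ "[:x i, y i - x i:]"]) simp
next
  case (add f g)
  then obtain p q where "\<forall>t. f (\<lambda>i. x i + t * (y i - x i)) = poly p t"
    "\<forall>t. g (\<lambda>i. x i + t * (y i - x i)) = poly q t" by blast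
  then show ?case by (intro exI[of _ "p + q"]) simp
next
  case (mult f g)
  then obtain p q where "\<forall>t. f (\<lambda>i. x i + t * (y i - x i)) = poly p t"
    "\<forall>t. g (\<lambda>i. x i + t * (y i - x i)) = poly q t" by blast
  then show ?case by (intro exI[of _ "p * q"]) simp
qed

text \<open>Restriction to the complex line through \<open>x\<close> and \<open>y\<close> gives two
  nonzero polynomials in one variable, and their product is nonzero. This is the source of generic
  points below: polynomial conditions that can be met separately can be met together.\<close>

lemma poly_functions_no_zero_divisors:
  assumes f: "f \<in> poly_functions I" and g: "g \<in> poly_functions I"
    and "f x \<noteq> 0" "g y \<noteq> 0"
  shows "\<exists>z. f z \<noteq> 0 \<and> g z \<noteq> 0"
proof (rule ccontr)
  assume neg: "\<nexists>z. f z \<noteq> 0 \<and> g z \<noteq> 0"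
  let ?l = "\<lambda>t i. x i + t * (y i - x i)"
  obtain p q where p: "\<And>t. f (?l t) = poly p t" and q: "\<And>t. g (?l t) = poly q t"
    using poly_functions_line[OF f, of x y] poly_functions_line[OF g, of x y] by auto
  have "poly (p * q) t = 0" for t
    using neg by (metis mult_eq_0_iff p q poly_mult)
  then have "p * q = 0" using poly_all_0_iff_0 by blast
  moreover have "poly p 0 \<noteq> 0" using p[of 0] assms(3) by simp
  moreover have "poly q 1 \<noteq> 0" using q[of 1] assms(4) by simp
  ultimately show False by auto
qed

text \<open>Gaussian elimination without division: \<open>F\<close> indexes a maximal independent set of rows, \<open>B\<close> the
  free columns, \<open>w b\<close> the kernel vector of the free column \<open>b\<close>, and \<open>D\<close> is the common denominator,
  away from which the statements hold pointwise.\<close>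

lemma fraction_free_elimination:
  fixes r :: "'e \<Rightarrow> 'k \<Rightarrow> ('i \<Rightarrow> complex) \<Rightarrow> complex"
  assumes "finite E" "finite K" "\<forall>e\<in>E. \<forall>k\<in>K. r e k \<in> poly_functions J"
  shows "\<exists>F B D w. F \<subseteq> E \<and> B \<subseteq> K \<and> card B + card F = card K \<and> D \<in> poly_functions J \<and>
    (\<exists>x. D x \<noteq> 0) \<and> (\<forall>b\<in>B. \<forall>k\<in>K. w b k \<in> poly_functions J) \<and>
    (\<forall>b\<in>B. \<forall>c\<in>B. \<forall>x. w b c x = (if b = c then D x else 0)) \<and>
    (\<forall>e\<in>E. \<forall>b\<in>B. \<forall>x. (\<Sum>k\<in>K. r e k x * w b k x) = 0) \<and>
    (\<forall>x. D x \<noteq> 0 \<longrightarrow> (\<forall>l. (\<forall>k\<in>K. (\<Sum>e\<in>F. l e * r e k x) = 0) \<longrightarrow> (\<forall>e\<in>F. l e = 0)))"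
  using assms(1,3)
proof (induction E rule: finite_induct)
  case empty
  show ?case
    by (rule exI[of _ "{}"], rule exI[of _ K], rule exI[of _ "\<lambda>x. 1"],
        rule exI[of _ "\<lambda>b k x. if b = k then 1 else 0"])
      (auto intro: poly_functions.const)
next
  case (insert e0 E)
  have "\<forall>e\<in>E. \<forall>k\<in>K. r e k \<in> poly_functions J" using insert.prems by auto
  from insert.IH[OF this] obtain F B D w where F: "F \<subseteq> E" and B: "B \<subseteq> K" and card: "card B + card F = card K"
    and D: "D \<in> poly_functions J" "\<exists>x. D x \<noteq> 0"
    and w: "\<forall>b\<in>B. \<forall>k\<in>K. w b k \<in> poly_functions J"
    and wB: "\<forall>b\<in>B. \<forall>c\<in>B. \<forall>x. w b c x = (if b = c then D x else 0)"
    and ker: "\<forall>e\<in>E. \<forall>b\<in>B. \<forall>x. (\<Sum>k\<in>K. r e k x * w b k x) = 0"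
    and ind: "\<forall>x. D x \<noteq> 0 \<longrightarrow> (\<forall>l. (\<forall>k\<in>K. (\<Sum>e\<in>F. l e * r e k x) = 0) \<longrightarrow> (\<forall>e\<in>F. l e = 0))"
    by (elim exE conjE) (rule that; (assumption | rule exI, assumption))
  have finF: "finite F" using F insert.hyps(1) finite_subset by blast
  have finB: "finite B" using B assms(2) finite_subset by blast
  define \<beta> where "\<beta> b x = (\<Sum>k\<in>K. r e0 k x * w b k x)" for b x
  have \<beta>: "\<beta> b \<in> poly_functions J" if "b \<in> B" for b
  proof -
    have "(\<lambda>x. \<Sum>k\<in>K. r e0 k x * w b k x) \<in> poly_functions J"
      using that w insert.prems assms(2) by (intro poly_functions_sum poly_functions.mult) auto
    then show ?thesis unfolding \<beta>_def[abs_def] .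
  qed
  show ?case
  proof (cases "\<forall>b\<in>B. \<forall>x. \<beta> b x = 0")
    case True
    then show ?thesis
      using F B card D w wB ker ind unfolding \<beta>_def
      by (intro exI[of _ F] exI[of _ B] exI[of _ D] exI[of _ w]) auto
  next
    case False
    then obtain j y where j: "j \<in> B" "\<beta> j y \<noteq> 0" by auto
    \<comment> \<open>The pivot step: \<open>\<beta> b\<close> is the value of the new row on the
      kernel vector \<open>w b\<close>. Subtracting a multiple of \<open>w j\<close> makes this
      value zero; scaling by \<open>\<beta> j\<close> avoids the division, so the denominator
      acquires the factor \<open>\<beta> j\<close>.\<close>
    define w' where "w' b k x = \<beta> j x * w b k x - \<beta> b x * w j k x" for b k x
    define D' where "D' x = \<beta> j x * D x" for x
    have e0: "e0 \<notin> F" using F insert.hyps by auto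
    have 1: "insert e0 F \<subseteq> insert e0 E" using F by auto
    have 2: "B - {j} \<subseteq> K" using B by auto
    have 3: "card (B - {j}) + card (insert e0 F) = card K"
      using card e0 finF finB j(1) card_Suc_Diff1[OF finB j(1)] by simp
    have 4: "D' \<in> poly_functions J"
      unfolding D'_def[abs_def] using \<beta>[OF j(1)] D(1) by (rule poly_functions.mult)
    have 5: "\<exists>x. D' x \<noteq> 0"
      using poly_functions_no_zero_divisors[OF \<beta>[OF j(1)] D(1) j(2)] D(2) unfolding D'_def by auto
    have 6: "\<forall>b\<in>B - {j}. \<forall>k\<in>K. w' b k \<in> poly_functions J"
      unfolding w'_def[abs_def] using \<beta> j(1) w
      by (auto intro!: poly_functions_diff poly_functions.mult)
    have 7: "\<forall>b\<in>B - {j}. \<forall>c\<in>B - {j}. \<forall>x. w' b c x = (if b = c then D' x else 0)"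
      using wB j(1) unfolding w'_def D'_def by auto
    have 8: "\<forall>e\<in>insert e0 E. \<forall>b\<in>B - {j}. \<forall>x. (\<Sum>k\<in>K. r e k x * w' b k x) = 0"
    proof (intro ballI allI)
      fix e b x assume e: "e \<in> insert e0 E" and b: "b \<in> B - {j}"
      have "(\<Sum>k\<in>K. r e k x * w' b k x)
        = \<beta> j x * (\<Sum>k\<in>K. r e k x * w b k x) - \<beta> b x * (\<Sum>k\<in>K. r e k x * w j k x)"
        unfolding w'_def by (simp add: sum_distrib_left sum_subtractf[symmetric] algebra_simps)
      also have "\<dots> = 0"
      proof (cases "e = e0")
        case True
        show ?thesis unfolding True \<beta>_def[symmetric] by simp
      next
        case False
        then show ?thesis using e b j(1) ker by auto
      qed
      finally show "(\<Sum>k\<in>K. r e k x * w' b k x) = 0" .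
    qed
    have 9: "\<forall>x. D' x \<noteq> 0 \<longrightarrow> (\<forall>l. (\<forall>k\<in>K. (\<Sum>e\<in>insert e0 F. l e * r e k x) = 0) \<longrightarrow> (\<forall>e\<in>insert e0 F. l e = 0))"
    proof (intro allI impI)
      fix x l assume D': "D' x \<noteq> 0" and z: "\<forall>k\<in>K. (\<Sum>e\<in>insert e0 F. l e * r e k x) = 0"
      \<comment> \<open>Pairing the supposed relation with \<open>w j\<close> annihilates all old
        rows and isolates the coefficient of the new one.\<close>
      have "0 = (\<Sum>k\<in>K. (\<Sum>e\<in>insert e0 F. l e * r e k x) * w j k x)" using z by simp
      also have "\<dots> = (\<Sum>k\<in>K. \<Sum>e\<in>insert e0 F. l e * (r e k x * w j k x))"
        by (simp only: sum_distrib_right mult.assoc)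
      also have "\<dots> = (\<Sum>e\<in>insert e0 F. \<Sum>k\<in>K. l e * (r e k x * w j k x))"
        by (rule sum.swap)
      also have "\<dots> = (\<Sum>e\<in>insert e0 F. l e * (\<Sum>k\<in>K. r e k x * w j k x))"
        by (simp only: sum_distrib_left)
      also have "\<dots> = l e0 * \<beta> j x + (\<Sum>e\<in>F. l e * (\<Sum>k\<in>K. r e k x * w j k x))"
        using e0 finF by (simp add: \<beta>_def)
      also have "(\<Sum>e\<in>F. l e * (\<Sum>k\<in>K. r e k x * w j k x)) = 0"
        using ker j(1) F by (intro sum.neutral) auto
      finally have l0: "l e0 = 0" using D' unfolding D'_def by simp
      then have "\<forall>k\<in>K. (\<Sum>e\<in>F. l e * r e k x) = 0" using z e0 finF by simp
      then show "\<forall>e\<in>insert e0 F. l e = 0" using l0 ind D' unfolding D'_def by auto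
    qed
    show ?thesis
      by (intro exI[of _ "insert e0 F"] exI[of _ "B - {j}"] exI[of _ D'] exI[of _ w'] conjI 1 2 3 4 5 6 7 8 9)
  qed
qed

text \<open>Elimination with constant entries: fewer equations than unknowns leave a free column,
  and its kernel vector has the nonzero entry \<open>D x\<close> there.\<close>

lemma underdetermined_system:
  fixes r :: "'e \<Rightarrow> 'k \<Rightarrow> complex"
  assumes "finite E" "finite K" "card E < card K"
  shows "\<exists>l. (\<exists>k\<in>K. l k \<noteq> 0) \<and> (\<forall>e\<in>E. (\<Sum>k\<in>K. r e k * l k) = 0)"
proof -
  have "\<forall>e\<in>E. \<forall>k\<in>K. (\<lambda>x :: nat \<Rightarrow> complex. r e k) \<in> poly_functions {}"
    by (auto intro: poly_functions.const)
  from fraction_free_elimination[OF assms(1,2) this]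
  obtain F B D w where *: "F \<subseteq> E" "B \<subseteq> K" "card B + card F = card K" "\<exists>x :: nat \<Rightarrow> complex. D x \<noteq> 0"
    "\<forall>b\<in>B. \<forall>c\<in>B. \<forall>x. w b c x = (if b = c then D x else 0)"
    "\<forall>e\<in>E. \<forall>b\<in>B. \<forall>x. (\<Sum>k\<in>K. r e k * w b k x) = 0"
    by (elim exE conjE) (rule that; (assumption | rule exI, assumption))
  have "card F \<le> card E" using *(1) assms(1) by (rule card_mono[rotated])
  with *(3) assms(3) have "B \<noteq> {}" by auto
  then obtain b x where "b \<in> B" "D x \<noteq> 0" using *(4) by auto
  then show ?thesis using * by (intro exI[of _ "\<lambda>k. w b k x"] conjI bexI[of _ b]) auto
qed

section \<open>Growth of polynomial functions on a set\<close>

text \<open>A function carries no formal degree, so the relation says that some expression of degree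
  at most \<open>D\<close> in the generators defines it. The generators may be arbitrary, also
  algebraically dependent, functions.\<close>

inductive poly_le :: "('s \<Rightarrow> complex) set \<Rightarrow> nat \<Rightarrow> ('s \<Rightarrow> complex) \<Rightarrow> bool" for G where
  "poly_le G D (\<lambda>x. c)"
| "g \<in> G \<Longrightarrow> poly_le G (Suc D) g"
| "poly_le G D f \<Longrightarrow> poly_le G D g \<Longrightarrow> poly_le G D (\<lambda>x. f x + g x)"
| "poly_le G D f \<Longrightarrow> poly_le G D' g \<Longrightarrow> poly_le G (D + D') (\<lambda>x. f x * g x)"

definition polys :: "('s \<Rightarrow> complex) set \<Rightarrow> nat \<Rightarrow> ('s \<Rightarrow> complex) set" where
  "polys G D = {f. poly_le G D f}"

lemma polys_const: "(\<lambda>x. c) \<in> polys G D"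
  unfolding polys_def by (rule CollectI, rule poly_le.intros(1))

lemma polys_gen: "g \<in> G \<Longrightarrow> g \<in> polys G (Suc D)"
  unfolding polys_def by (rule CollectI, rule poly_le.intros(2))

lemma polys_add: "f \<in> polys G D \<Longrightarrow> g \<in> polys G D \<Longrightarrow> (\<lambda>x. f x + g x) \<in> polys G D"
  unfolding polys_def mem_Collect_eq by (rule poly_le.intros(3))

lemma polys_mult:
  "f \<in> polys G D \<Longrightarrow> g \<in> polys G D' \<Longrightarrow> (\<lambda>x. f x * g x) \<in> polys G (D + D')"
  unfolding polys_def mem_Collect_eq by (rule poly_le.intros(4))

lemma polys_induct [consumes 1, case_names const gen add mult]:
  assumes "f \<in> polys G D"
    and const: "\<And>c D. P (\<lambda>x. c) D"
    and gen: "\<And>g D. g \<in> G \<Longrightarrow> P g (Suc D)"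
    and add: "\<And>f D g. f \<in> polys G D \<Longrightarrow> P f D \<Longrightarrow> g \<in> polys G D \<Longrightarrow> P g D \<Longrightarrow> P (\<lambda>x. f x + g x) D"
    and mult: "\<And>f D g D'. f \<in> polys G D \<Longrightarrow> P f D \<Longrightarrow> g \<in> polys G D' \<Longrightarrow> P g D' \<Longrightarrow>
      P (\<lambda>x. f x * g x) (D + D')"
  shows "P f D"
proof -
  have "poly_le G D f" using assms(1) by (simp add: polys_def)
  then show ?thesis
  proof (induction D f rule: poly_le.induct)
    case (1 D c)
    show ?case by (rule const)
  next
    case (2 g D)
    then show ?case by (rule gen)
  next
    case (3 D f g)
    then show ?case by (intro add) (simp_all only: polys_def mem_Collect_eq)
  next
    case (4 D f D' g)
    then show ?case by (intro mult) (simp_all only: polys_def mem_Collect_eq)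
  qed
qed

lemma polys_Suc: "f \<in> polys G D \<Longrightarrow> f \<in> polys G (Suc D)"
proof (induction f D rule: polys_induct)
  case (mult f D g D')
  then show ?case using polys_mult[of f G "Suc D" g D'] by simp
qed (simp_all add: polys_const polys_gen polys_add)

lemma polys_mono: "f \<in> polys G D \<Longrightarrow> D \<le> D' \<Longrightarrow> f \<in> polys G D'"
  by (induction D') (auto simp: le_Suc_eq polys_Suc)

lemma polys_gen_mono: "f \<in> polys G D \<Longrightarrow> G \<subseteq> G' \<Longrightarrow> f \<in> polys G' D"
  by (induction f D rule: polys_induct) (simp_all add: polys_const polys_gen polys_add polys_mult subset_eq)

lemma polys_power: "f \<in> polys G D \<Longrightarrow> (\<lambda>x. f x ^ k) \<in> polys G (k * D)"
proof (induction k)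
  case 0
  show ?case using polys_const[of 1 G 0] by simp
next
  case (Suc k)
  then show ?case using polys_mult[of f G D "\<lambda>x. f x ^ k" "k * D"] by simp
qed

lemma polys_prod:
  "finite A \<Longrightarrow> (\<And>a. a \<in> A \<Longrightarrow> f a \<in> polys G D) \<Longrightarrow> (\<lambda>x. \<Prod>a\<in>A. f a x) \<in> polys G (card A * D)"
proof (induction A rule: finite_induct)
  case empty
  show ?case using polys_const[of 1 G 0] by simp
next
  case (insert a A)
  then show ?case using polys_mult[of "f a" G D "\<lambda>x. \<Prod>a\<in>A. f a x" "card A * D"] by simp
qed

definition polyring :: "('s \<Rightarrow> complex) set \<Rightarrow> ('s \<Rightarrow> complex) set" where
  "polyring G = (\<Union>D. polys G D)"

lemma polyringI: "f \<in> polys G D \<Longrightarrow> f \<in> polyring G"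
  unfolding polyring_def by blast

lemma polyringE:
  assumes "f \<in> polyring G"
  obtains D where "f \<in> polys G D"
  using assms unfolding polyring_def by blast

lemma polyring_const: "(\<lambda>x. c) \<in> polyring G"
  by (rule polyringI[OF polys_const])

lemma polyring_gen: "g \<in> G \<Longrightarrow> g \<in> polyring G"
  by (rule polyringI[OF polys_gen])

lemma polyring_add:
  assumes "f \<in> polyring G" "g \<in> polyring G"
  shows "(\<lambda>x. f x + g x) \<in> polyring G"
proof -
  obtain D D' where "f \<in> polys G D" "g \<in> polys G D'"
    using assms by (elim polyringE)
  then have "f \<in> polys G (max D D')" "g \<in> polys G (max D D')" by (simp_all add: polys_mono)
  then show ?thesis by (intro polyringI[OF polys_add])
qed

lemma polyring_mult:
  assumes "f \<in> polyring G" "g \<in> polyring G"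
  shows "(\<lambda>x. f x * g x) \<in> polyring G"
  using assms by (elim polyringE) (rule polyringI[OF polys_mult])

lemma polyring_diff:
  assumes "f \<in> polyring G" "g \<in> polyring G"
  shows "(\<lambda>x. f x - g x) \<in> polyring G"
  using polyring_add[OF assms(1) polyring_mult[OF polyring_const[of "-1"] assms(2)]] by simp

lemma polyring_uminus:
  assumes "g \<in> polyring G"
  shows "(\<lambda>x. - g x) \<in> polyring G"
  using polyring_mult[OF polyring_const[of "-1"] assms] by simp

lemma polyring_power: "f \<in> polyring G \<Longrightarrow> (\<lambda>x. f x ^ k) \<in> polyring G"
  by (elim polyringE) (rule polyringI[OF polys_power])

lemma polyring_mono: "f \<in> polyring G \<Longrightarrow> G \<subseteq> G' \<Longrightarrow> f \<in> polyring G'"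
  by (elim polyringE) (rule polyringI[OF polys_gen_mono])

lemmas polyring_intros = polyring_const polyring_add polyring_mult polyring_diff polyring_uminus
  polyring_power

lemma polyring_common_degree:
  "finite A \<Longrightarrow> (\<And>a. a \<in> A \<Longrightarrow> f a \<in> polyring G) \<Longrightarrow> \<exists>m. \<forall>a\<in>A. f a \<in> polys G m"
proof (induction A rule: finite_induct)
  case (insert a A)
  then obtain m where m: "\<And>b. b \<in> A \<Longrightarrow> f b \<in> polys G m" by auto
  obtain D where D: "f a \<in> polys G D" using insert.prems[of a] unfolding polyring_def by auto
  have "f b \<in> polys G (max m D)" if "b \<in> insert a A" for b
  proof (cases "b = a")
    case True
    then show ?thesis using polys_mono[OF D, of "max m D"] by simp
  next
    case False
    then show ?thesis using polys_mono[OF m, of b "max m D"] that by simp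
  qed
  then show ?case by blast
qed simp

text \<open>The span modulo functions that vanish on \<open>S\<close>: the rule \<open>cong\<close>
  allows any change outside \<open>S\<close>. The size of a finite \<open>H\<close> thus bounds the
  dimension of a space of restrictions to \<open>S\<close>, and the members of \<open>H\<close> need
  not be polynomials.\<close>

inductive_set span_on :: "'s set \<Rightarrow> ('s \<Rightarrow> complex) set \<Rightarrow> ('s \<Rightarrow> complex) set" for S H where
  zero: "(\<lambda>x. 0) \<in> span_on S H"
| base: "h \<in> H \<Longrightarrow> h \<in> span_on S H"
| add: "f \<in> span_on S H \<Longrightarrow> g \<in> span_on S H \<Longrightarrow> (\<lambda>x. f x + g x) \<in> span_on S H"
| scale: "f \<in> span_on S H \<Longrightarrow> (\<lambda>x. c * f x) \<in> span_on S H"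
| cong: "f \<in> span_on S H \<Longrightarrow> (\<And>x. x \<in> S \<Longrightarrow> f x = g x) \<Longrightarrow> g \<in> span_on S H"

lemma span_on_mono:
  assumes "f \<in> span_on S H" "H \<subseteq> span_on S K"
  shows "f \<in> span_on S K"
  using assms(1)
proof (induction f rule: span_on.induct)
  case zero
  show ?case by (rule span_on.zero)
next
  case (base h)
  then show ?case by (rule subsetD[OF assms(2)])
next
  case (add f g)
  show ?case by (rule span_on.add[OF add.IH])
next
  case (scale f c)
  show ?case by (rule span_on.scale[OF scale.IH])
next
  case (cong f g)
  show ?case by (rule span_on.cong[OF cong.IH cong.hyps(2)])
qed

lemma span_on_anti:
  assumes "f \<in> span_on S H" "S' \<subseteq> S"
  shows "f \<in> span_on S' H"
  using assms(1)
proof (induction f rule: span_on.induct)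
  case zero
  show ?case by (rule span_on.zero)
next
  case (base h)
  then show ?case by (rule span_on.base)
next
  case (add f g)
  show ?case by (rule span_on.add[OF add.IH])
next
  case (scale f c)
  show ?case by (rule span_on.scale[OF scale.IH])
next
  case (cong f g)
  show ?case by (rule span_on.cong[OF cong.IH cong.hyps(2)[OF subsetD[OF assms(2)]]])
qed

lemma span_on_sum:
  "finite A \<Longrightarrow> (\<And>a. a \<in> A \<Longrightarrow> f a \<in> span_on S H) \<Longrightarrow> (\<lambda>x. \<Sum>a\<in>A. f a x) \<in> span_on S H"
  by (induction A rule: finite_induct) (simp_all add: span_on.zero span_on.add)

lemma span_on_mult_left:
  assumes "f \<in> span_on S H" "\<And>h. h \<in> H \<Longrightarrow> (\<lambda>x. a x * h x) \<in> span_on S K"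
  shows "(\<lambda>x. a x * f x) \<in> span_on S K"
  using assms(1)
proof (induction f rule: span_on.induct)
  case zero
  show ?case using span_on.zero by simp
next
  case (base h)
  then show ?case using assms(2) by simp
next
  case (add f g)
  then show ?case using span_on.add[of "\<lambda>x. a x * f x" S K "\<lambda>x. a x * g x"] by (simp add: distrib_left)
next
  case (scale f c)
  then show ?case using span_on.scale[of "\<lambda>x. a x * f x" S K c] by (simp add: mult.left_commute)
next
  case (cong f g)
  then show ?case by (intro span_on.cong[of "\<lambda>x. a x * f x" S K "\<lambda>x. a x * g x"]) auto
qed

lemma span_on_mult:
  assumes "f \<in> span_on S H" "g \<in> span_on S H'"
    "\<And>h h'. h \<in> H \<Longrightarrow> h' \<in> H' \<Longrightarrow> (\<lambda>x. h x * h' x) \<in> span_on S K"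
  shows "(\<lambda>x. f x * g x) \<in> span_on S K"
proof (rule span_on_mult_left[OF assms(2)])
  fix h' assume "h' \<in> H'"
  have "(\<lambda>x. h' x * f x) \<in> span_on S K"
    by (rule span_on_mult_left[OF assms(1)]) (subst mult.commute, rule assms(3)[OF _ \<open>h' \<in> H'\<close>])
  then show "(\<lambda>x. f x * h' x) \<in> span_on S K" by (subst mult.commute)
qed

lemma span_on_coeffs:
  assumes "f \<in> span_on S H" "finite H"
  shows "\<exists>c. \<forall>x\<in>S. f x = (\<Sum>h\<in>H. c h * h x)"
  using assms(1)
proof (induction f rule: span_on.induct)
  case zero
  show ?case by (rule exI[of _ "\<lambda>h. 0"]) simp
next
  case (base h)
  have "(\<Sum>k\<in>H. (if k = h then 1 else 0) * k x) = (\<Sum>k\<in>H. if k = h then k x else 0)" for x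
    by (rule sum.cong) auto
  then show ?case using base assms(2) by (intro exI[of _ "\<lambda>k. if k = h then 1 else 0"]) simp
next
  case (add f g)
  then obtain c d where "\<forall>x\<in>S. f x = (\<Sum>h\<in>H. c h * h x)" "\<forall>x\<in>S. g x = (\<Sum>h\<in>H. d h * h x)" by auto
  then show ?case
    by (intro exI[of _ "\<lambda>h. c h + d h"]) (simp add: distrib_right sum.distrib)
next
  case (scale f a)
  then obtain c where "\<forall>x\<in>S. f x = (\<Sum>h\<in>H. c h * h x)" by auto
  then show ?case
    by (intro exI[of _ "\<lambda>h. a * c h"]) (simp add: sum_distrib_left mult.assoc)
next
  case (cong f g)
  then show ?case by metis
qed

text \<open>Extension by zero turns identities on \<open>A\<close> into identities everywhere, so
  that spans over two disjoint sets can be added.\<close>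

lemma span_on_restrict:
  assumes "f \<in> span_on S H" "A \<subseteq> S"
  shows "(\<lambda>x. if x \<in> A then f x else 0) \<in> span_on UNIV ((\<lambda>h x. if x \<in> A then h x else 0) ` H)"
  using assms(1)
proof (induction f rule: span_on.induct)
  case zero
  show ?case using span_on.zero by simp
next
  case (base h)
  then show ?case by (intro span_on.base) auto
next
  case (add f g)
  from span_on.add[OF add.IH] show ?case by (rule span_on.cong) auto
next
  case (scale f c)
  from span_on.scale[OF scale.IH, of c] show ?case by (rule span_on.cong) auto
next
  case (cong f g)
  from cong.IH show ?case using cong.hyps(2) assms(2) by (elim span_on.cong) auto
qed

text \<open>A bound on the Hilbert function of \<open>S\<close> with respect to the generators \<open>G\<close>. Unlike the
  transcendence degree, this notion of dimension behaves well for arbitrary, possibly reducible or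
  non-closed, sets \<open>S\<close>.\<close>

definition growth :: "'s set \<Rightarrow> ('s \<Rightarrow> complex) set \<Rightarrow> nat \<Rightarrow> bool" where
  "growth S G d \<longleftrightarrow>
     (\<exists>C. \<forall>D. \<exists>H. finite H \<and> card H \<le> C * (D + 1) ^ d \<and> polys G D \<subseteq> span_on S H)"

lemma growthE:
  assumes "growth S G d"
  obtains H C where "\<And>D. finite (H D)" "\<And>D. card (H D) \<le> C * (D + 1) ^ d"
    "\<And>D f. f \<in> polys G D \<Longrightarrow> f \<in> span_on S (H D)"
proof -
  obtain C where "\<forall>D. \<exists>H. finite H \<and> card H \<le> C * (D + 1) ^ d \<and> polys G D \<subseteq> span_on S H"
    using assms unfolding growth_def by (elim exE) (rule that)
  then obtain H where H: "\<forall>D. finite (H D) \<and> card (H D) \<le> C * (D + 1) ^ d \<and> polys G D \<subseteq> span_on S (H D)"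
    by (elim choice[THEN exE]) (rule that)
  show ?thesis by (rule that[of H C]) (use H in auto)
qed

lemma growthI:
  assumes "\<And>D. finite (H D)" "\<And>D. card (H D) \<le> C * (D + 1) ^ d"
    "\<And>D f. f \<in> polys G D \<Longrightarrow> f \<in> span_on S (H D)"
  shows "growth S G d"
  unfolding growth_def
proof (intro exI allI conjI subsetI)
  fix D
  show "finite (H D)" "card (H D) \<le> C * (D + 1) ^ d" by (fact assms)+
  show "f \<in> span_on S (H D)" if "f \<in> polys G D" for f using that by (rule assms(3))
qed

lemma growth_subset:
  assumes "growth S G d" "S' \<subseteq> S" "G' \<subseteq> G"
  shows "growth S' G' d"
proof -
  obtain C H where H: "\<And>D. finite (H D)" "\<And>D. card (H D) \<le> C * (D + 1) ^ d"
    "\<And>D f. f \<in> polys G D \<Longrightarrow> f \<in> span_on S (H D)"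
    by (fact growthE[OF assms(1)])
  show ?thesis
    by (rule growthI[OF H(1,2)]) (rule span_on_anti[OF H(3)[OF polys_gen_mono[OF _ assms(3)]] assms(2)])
qed

lemma growth_Un:
  assumes "growth S G d" "growth T G d"
  shows "growth (S \<union> T) G d"
proof -
  obtain C H where H: "\<And>D. finite (H D)" "\<And>D. card (H D) \<le> C * (D + 1) ^ d"
    "\<And>D f. f \<in> polys G D \<Longrightarrow> f \<in> span_on S (H D)"
    by (fact growthE[OF assms(1)])
  obtain C' H' where H': "\<And>D. finite (H' D)" "\<And>D. card (H' D) \<le> C' * (D + 1) ^ d"
    "\<And>D f. f \<in> polys G D \<Longrightarrow> f \<in> span_on T (H' D)"
    by (fact growthE[OF assms(2)])
  define r where "r A h x = (if x \<in> A then h x else 0)" for A and h :: "'a \<Rightarrow> complex" and x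
  show ?thesis
  proof (rule growthI)
    fix D
    show "finite (r S ` H D \<union> r (T - S) ` H' D)" using H(1) H'(1) by auto
    have "card (r S ` H D \<union> r (T - S) ` H' D) \<le> card (r S ` H D) + card (r (T - S) ` H' D)"
      by (rule card_Un_le)
    also have "\<dots> \<le> card (H D) + card (H' D)" using H(1) H'(1) by (intro add_mono card_image_le)
    also have "\<dots> \<le> (C + C') * (D + 1) ^ d" using H(2)[of D] H'(2)[of D] by (simp only: distrib_right)
    finally show "card (r S ` H D \<union> r (T - S) ` H' D) \<le> (C + C') * (D + 1) ^ d" .
    fix f assume f: "f \<in> polys G D"
    have 1: "r S f \<in> span_on UNIV (r S ` H D)"
      using span_on_restrict[OF H(3)[OF f] order_refl] unfolding r_def .
    have 2: "r (T - S) f \<in> span_on UNIV (r (T - S) ` H' D)"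
      using span_on_restrict[OF H'(3)[OF f], of "T - S"] unfolding r_def by blast
    have "r S f \<in> span_on UNIV (r S ` H D \<union> r (T - S) ` H' D)"
      using 1 by (rule span_on_mono) (auto intro: span_on.base)
    moreover have "r (T - S) f \<in> span_on UNIV (r S ` H D \<union> r (T - S) ` H' D)"
      using 2 by (rule span_on_mono) (auto intro: span_on.base)
    ultimately have "(\<lambda>x. r S f x + r (T - S) f x) \<in> span_on UNIV (r S ` H D \<union> r (T - S) ` H' D)"
      by (rule span_on.add)
    then have "(\<lambda>x. r S f x + r (T - S) f x) \<in> span_on (S \<union> T) (r S ` H D \<union> r (T - S) ` H' D)"
      by (rule span_on_anti) simp
    then show "f \<in> span_on (S \<union> T) (r S ` H D \<union> r (T - S) ` H' D)"
      by (rule span_on.cong) (auto simp: r_def)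
  qed
qed

text \<open>Makes case distinctions available pointwise: in a union the constants add up, but the
  exponent \<open>d\<close> stays the same.\<close>

lemma growth_cover:
  assumes "growth {x \<in> S. P x} G d" "growth {x \<in> S. \<not> P x} G d"
  shows "growth S G d"
  by (rule growth_subset[OF growth_Un[OF assms]]) auto

lemma growth_no_generators: "growth S {} 0"
proof (rule growthI[where H = "\<lambda>D. {\<lambda>x. 1}" and C = 1])
  fix D f assume "f \<in> polys ({} :: ('a \<Rightarrow> complex) set) D"
  then have "\<exists>c. f = (\<lambda>x. c)" by (induction f D rule: polys_induct) auto
  then obtain c where "f = (\<lambda>x. c * 1)" by auto
  moreover have "(\<lambda>x. c * 1) \<in> span_on S {\<lambda>x. 1}" by (intro span_on.scale span_on.base) simp
  ultimately show "f \<in> span_on S {\<lambda>x. 1}" by simp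
qed auto

lemma growth_empty: "growth {} G d"
  by (rule growthI[where H = "\<lambda>D. {}" and C = 0]) (auto intro: span_on.cong[OF span_on.zero])

section \<open>Adjoining one generator: free, algebraic, rational\<close>

lemma polys_insert_span:
  "f \<in> polys (insert y G) D \<Longrightarrow> f \<in> span_on S {\<lambda>x. a x * y x ^ j | a j. a \<in> polys G D \<and> j \<le> D}"
proof (induction f D rule: polys_induct)
  case (const c D)
  show ?case
    by (intro span_on.base CollectI exI[of _ "\<lambda>x. c"] exI[of _ 0]) (simp add: polys_const)
next
  case (gen g D)
  have "g \<in> {\<lambda>x. a x * y x ^ j | a j. a \<in> polys G (Suc D) \<and> j \<le> Suc D}"
  proof (cases "g = y")
    case True
    then show ?thesis
      by (intro CollectI exI[of _ "\<lambda>x. 1"] exI[of _ 1]) (auto intro: polys_const)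
  next
    case False
    then show ?thesis using gen
      by (intro CollectI exI[of _ g] exI[of _ 0]) (auto intro: polys_gen)
  qed
  then show ?case by (rule span_on.base)
next
  case (add f D g)
  show ?case by (rule span_on.add[OF add.IH])
next
  case (mult f D g D')
  show ?case
  proof (rule span_on_mult[OF mult.IH])
    fix h h' assume "h \<in> {\<lambda>x. a x * y x ^ j | a j. a \<in> polys G D \<and> j \<le> D}"
      "h' \<in> {\<lambda>x. a x * y x ^ j | a j. a \<in> polys G D' \<and> j \<le> D'}"
    then obtain a j a' j' where *: "h = (\<lambda>x. a x * y x ^ j)" "a \<in> polys G D" "j \<le> D"
      "h' = (\<lambda>x. a' x * y x ^ j')" "a' \<in> polys G D'" "j' \<le> D'" by auto
    show "(\<lambda>x. h x * h' x) \<in> span_on S {\<lambda>x. a x * y x ^ j | a j. a \<in> polys G (D + D') \<and> j \<le> D + D'}"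
      using * polys_mult[OF *(2,5)]
      by (intro span_on.base CollectI exI[of _ "\<lambda>x. a x * a' x"] exI[of _ "j + j'"]) (auto simp: power_add ac_simps)
  qed
qed

text \<open>The exponent of \<open>y\<close> takes at most \<open>D + 1\<close> values, which costs
  one more factor \<open>D + 1\<close> in the size of the spanning set.\<close>

lemma growth_insert_free:
  assumes "growth S G d"
  shows "growth S (insert y G) (Suc d)"
proof -
  obtain C H where H: "\<And>D. finite (H D)" "\<And>D. card (H D) \<le> C * (D + 1) ^ d"
    "\<And>D f. f \<in> polys G D \<Longrightarrow> f \<in> span_on S (H D)"
    by (fact growthE[OF assms(1)])
  define H' where "H' D = (\<lambda>(h, j) x. h x * y x ^ j) ` (H D \<times> {..D})" for D
  show ?thesis
  proof (rule growthI)
    fix D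
    show "finite (H' D)" using H(1) unfolding H'_def by simp
    have "card (H' D) \<le> card (H D \<times> {..D})" unfolding H'_def using H(1) by (intro card_image_le) simp
    also have "\<dots> = card (H D) * (D + 1)" by (simp add: card_cartesian_product)
    also have "\<dots> \<le> C * (D + 1) ^ d * (D + 1)" by (rule mult_right_mono[OF H(2)]) simp
    finally show "card (H' D) \<le> C * (D + 1) ^ Suc d" by (simp add: ac_simps)
    fix f assume "f \<in> polys (insert y G) D"
    then have "f \<in> span_on S {\<lambda>x. a x * y x ^ j | a j. a \<in> polys G D \<and> j \<le> D}" by (rule polys_insert_span)
    then show "f \<in> span_on S (H' D)"
    proof (rule span_on_mono, safe)
      fix a j assume a: "a \<in> polys G D" and j: "j \<le> D"
      have "(\<lambda>x. y x ^ j * a x) \<in> span_on S (H' D)"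
        using H(3)[OF a] by (rule span_on_mult_left) (rule span_on.base, unfold H'_def, rule image_eqI[where x = "(_, j)"], use j in \<open>auto simp: mult.commute\<close>)
      then show "(\<lambda>x. a x * y x ^ j) \<in> span_on S (H' D)" by (simp add: mult.commute)
    qed
  qed
qed

text \<open>Where the leading coefficient is nonzero, \<open>\<alpha> e * y\<close> is integral over
  the old functions: its powers reduce to combinations of \<open>y ^ i\<close> with
  \<open>i < e\<close>, with coefficients whose degree grows only linearly. A function of degree
  \<open>D\<close> is multiplied by \<open>\<alpha> e ^ D\<close>, reduced, and divided again. The
  linear growth of degrees changes the constant but not the exponent \<open>d\<close>.\<close>

lemma growth_insert_algebraic_leading:
  assumes growth: "growth S G d"
    and \<alpha>: "\<And>i. i \<le> e \<Longrightarrow> \<alpha> i \<in> polyring G"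
    and rel: "\<And>x. x \<in> S \<Longrightarrow> (\<Sum>i\<le>e. \<alpha> i x * y x ^ i) = 0"
    and lead: "\<And>x. x \<in> S \<Longrightarrow> \<alpha> e x \<noteq> 0"
  shows "growth S (insert y G) d"
proof (cases "e = 0")
  \<comment> \<open>For \<open>e = 0\<close> the relation contradicts \<open>lead\<close>. Excluding
    this case leaves the power \<open>y ^ 0\<close> among those with \<open>i < e\<close>, which
    starts the induction in \<open>pow\<close>.\<close>
  case True
  then have "S = {}" using rel lead by fastforce
  then show ?thesis using growth_empty by simp
next
  case False
  obtain m where m: "\<And>i. i \<le> e \<Longrightarrow> \<alpha> i \<in> polys G m"
    using polyring_common_degree[of "{..e}" \<alpha> G] \<alpha> by auto
  obtain C H where H: "\<And>D. finite (H D)" "\<And>D. card (H D) \<le> C * (D + 1) ^ d"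
    "\<And>D f. f \<in> polys G D \<Longrightarrow> f \<in> span_on S (H D)"
    by (fact growthE[OF assms(1)])
  define M where "M k = {\<lambda>x. c x * y x ^ i | c i. c \<in> polys G k \<and> i < e}" for k
  have M: "(\<lambda>x. c x * y x ^ i) \<in> span_on S (M k)" if "c \<in> polys G k" "i < e" for c i k
    unfolding M_def using that by (intro span_on.base CollectI exI[of _ c] exI[of _ i]) simp
  have pow: "(\<lambda>x. (\<alpha> e x * y x) ^ j) \<in> span_on S (M (m * j))" for j
  proof (induction j)
    case 0
    show ?case using M[OF polys_const[of 1 G "m * 0"], of 0] False by simp
  next
    case (Suc j)
    have "(\<lambda>x. (\<alpha> e x * y x) * (\<alpha> e x * y x) ^ j) \<in> span_on S (M (m * Suc j))"
      using Suc.IH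
    proof (rule span_on_mult_left)
      fix h assume "h \<in> M (m * j)"
      then obtain c i where h: "h = (\<lambda>x. c x * y x ^ i)" and c: "c \<in> polys G (m * j)" and i: "i < e"
        unfolding M_def by auto
      have c\<alpha>: "(\<lambda>x. c x * \<alpha> i x) \<in> polys G (m * Suc j)" if "i \<le> e" for i
        using polys_mult[OF c m[OF that]] by (simp add: add.commute)
      show "(\<lambda>x. \<alpha> e x * y x * h x) \<in> span_on S (M (m * Suc j))"
      proof (cases "Suc i < e")
        case True
        from M[OF c\<alpha>[OF order_refl] True] show ?thesis
          by (rule span_on.cong) (simp add: h ac_simps)
      next
        case False
        then have e: "e = Suc i" using i by simp
        have "(\<lambda>x. \<Sum>k<e. (c x * \<alpha> k x) * y x ^ k) \<in> span_on S (M (m * Suc j))"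
          by (intro span_on_sum M c\<alpha>) auto
        from span_on.scale[OF this, of "-1"] show ?thesis
        proof (rule span_on.cong)
          fix x assume "x \<in> S"
          then have "(\<Sum>k<e. \<alpha> k x * y x ^ k) = - (\<alpha> e x * y x ^ e)"
            using rel[of x] by (simp add: lessThan_Suc_atMost[symmetric] add_eq_0_iff)
          then show "- 1 * (\<Sum>k<e. c x * \<alpha> k x * y x ^ k) = \<alpha> e x * y x * h x"
            by (simp add: mult.assoc sum_distrib_left[symmetric] h e)
        qed
      qed
    qed
    then show ?case by simp
  qed
  \<comment> \<open>\<open>D + m * D\<close> bounds the degree of the coefficients after
    multiplication by \<open>\<alpha> e ^ D\<close>; the inverse power undoes this multiplication on
    \<open>S\<close>.\<close>
  define H' where "H' D = (\<lambda>(h, i) x. inverse (\<alpha> e x) ^ D * (h x * y x ^ i)) ` (H (D + m * D) \<times> {..<e})" for D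
  show ?thesis
  proof (rule growthI)
    fix D
    show "finite (H' D)" using H(1) unfolding H'_def by simp
    have "card (H' D) \<le> card (H (D + m * D) \<times> {..<e})" unfolding H'_def using H(1) by (intro card_image_le) simp
    also have "\<dots> = card (H (D + m * D)) * e" by (simp add: card_cartesian_product)
    also have "\<dots> \<le> C * (D + m * D + 1) ^ d * e" by (rule mult_right_mono[OF H(2)]) simp
    also have "\<dots> \<le> C * ((m + 1) * (D + 1)) ^ d * e"
      by (intro mult_right_mono mult_left_mono power_mono) (auto simp: algebra_simps)
    also have "\<dots> = (C * (m + 1) ^ d * e) * (D + 1) ^ d" by (simp only: power_mult_distrib ac_simps)
    finally show "card (H' D) \<le> (C * (m + 1) ^ d * e) * (D + 1) ^ d" .
    fix f assume "f \<in> polys (insert y G) D"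
    then have "f \<in> span_on S {\<lambda>x. a x * y x ^ j | a j. a \<in> polys G D \<and> j \<le> D}" by (rule polys_insert_span)
    then have "(\<lambda>x. \<alpha> e x ^ D * f x) \<in> span_on S (M (D + m * D))"
    proof (rule span_on_mult_left, safe)
      fix a j assume a: "a \<in> polys G D" and j: "j \<le> D"
      have "(\<lambda>x. (a x * \<alpha> e x ^ (D - j)) * (\<alpha> e x * y x) ^ j) \<in> span_on S (M (D + m * D))"
        using pow[of j]
      proof (rule span_on_mult_left)
        fix h assume "h \<in> M (m * j)"
        then obtain c i where h: "h = (\<lambda>x. c x * y x ^ i)" and c: "c \<in> polys G (m * j)" and i: "i < e"
          unfolding M_def by auto
        have "(\<lambda>x. (a x * \<alpha> e x ^ (D - j)) * c x) \<in> polys G ((D + (D - j) * m) + m * j)"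
          by (intro polys_mult a c polys_power m order_refl)
        moreover have "(D + (D - j) * m) + m * j = D + m * D"
          using le_Suc_ex[OF j] by (auto simp: algebra_simps)
        ultimately have "(\<lambda>x. (a x * \<alpha> e x ^ (D - j)) * c x) \<in> polys G (D + m * D)" by simp
        from M[OF this i] show "(\<lambda>x. (a x * \<alpha> e x ^ (D - j)) * h x) \<in> span_on S (M (D + m * D))"
          by (simp add: h mult.assoc)
      qed
      then show "(\<lambda>x. \<alpha> e x ^ D * (a x * y x ^ j)) \<in> span_on S (M (D + m * D))"
      proof (rule span_on.cong)
        fix x
        show "a x * \<alpha> e x ^ (D - j) * (\<alpha> e x * y x) ^ j = \<alpha> e x ^ D * (a x * y x ^ j)"
          using j power_add[of "\<alpha> e x" "D - j" j] by (simp add: power_mult_distrib)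
      qed
    qed
    then have "(\<lambda>x. inverse (\<alpha> e x) ^ D * (\<alpha> e x ^ D * f x)) \<in> span_on S (H' D)"
    proof (rule span_on_mult_left)
      fix h assume "h \<in> M (D + m * D)"
      then obtain c i where h: "h = (\<lambda>x. c x * y x ^ i)" and c: "c \<in> polys G (D + m * D)" and i: "i < e"
        unfolding M_def by auto
      have "(\<lambda>x. (inverse (\<alpha> e x) ^ D * y x ^ i) * c x) \<in> span_on S (H' D)"
        using H(3)[OF c]
      proof (rule span_on_mult_left)
        fix k assume "k \<in> H (D + m * D)"
        then have "(\<lambda>x. inverse (\<alpha> e x) ^ D * (k x * y x ^ i)) \<in> span_on S (H' D)"
          unfolding H'_def using i by (intro span_on.base image_eqI[where x = "(k, i)"]) auto
        then show "(\<lambda>x. (inverse (\<alpha> e x) ^ D * y x ^ i) * k x) \<in> span_on S (H' D)"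
          by (simp add: ac_simps)
      qed
      then show "(\<lambda>x. inverse (\<alpha> e x) ^ D * h x) \<in> span_on S (H' D)"
        by (simp add: h ac_simps)
    qed
    then show "f \<in> span_on S (H' D)"
    proof (rule span_on.cong)
      fix x assume "x \<in> S"
      then show "inverse (\<alpha> e x) ^ D * (\<alpha> e x ^ D * f x) = f x"
        using lead[of x] by (simp add: power_inverse mult.assoc[symmetric])
    qed
  qed
qed

text \<open>The leading coefficient may vanish on part of \<open>S\<close>. There the relation has
  lower degree and induction applies; elsewhere the previous lemma does. Since some coefficient is
  nonzero at every point, the descent never reaches a trivial relation.\<close>

lemma growth_insert_algebraic:
  assumes "growth S G d"
    and "\<And>i. i \<le> e \<Longrightarrow> \<alpha> i \<in> polyring G"
    and "\<And>x. x \<in> S \<Longrightarrow> (\<Sum>i\<le>e. \<alpha> i x * y x ^ i) = 0"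
    and "\<And>x. x \<in> S \<Longrightarrow> \<exists>i\<le>e. \<alpha> i x \<noteq> 0"
  shows "growth S (insert y G) d"
  using assms
proof (induction e arbitrary: S)
  case 0
  then show ?case by (intro growth_insert_algebraic_leading[of S G d 0 \<alpha>]) auto
next
  case (Suc e)
  show ?case
  proof (rule growth_cover[where P = "\<lambda>x. \<alpha> (Suc e) x = 0"])
    show "growth {x \<in> S. \<alpha> (Suc e) x = 0} (insert y G) d"
    proof (rule Suc.IH)
      show "growth {x \<in> S. \<alpha> (Suc e) x = 0} G d" using Suc.prems(1) by (rule growth_subset) auto
      show "\<exists>i\<le>e. \<alpha> i x \<noteq> 0" if "x \<in> {x \<in> S. \<alpha> (Suc e) x = 0}" for x
        using Suc.prems(4)[of x] that by (auto simp: le_Suc_eq)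
      show "(\<Sum>i\<le>e. \<alpha> i x * y x ^ i) = 0" if "x \<in> {x \<in> S. \<alpha> (Suc e) x = 0}" for x
        using Suc.prems(3)[of x] that by simp
    qed (use Suc.prems(2) in auto)
    show "growth {x \<in> S. \<alpha> (Suc e) x \<noteq> 0} (insert y G) d"
    proof (rule growth_insert_algebraic_leading[of _ _ _ "Suc e" \<alpha>])
      show "growth {x \<in> S. \<alpha> (Suc e) x \<noteq> 0} G d" using Suc.prems(1) by (rule growth_subset) auto
    qed (use Suc.prems(2,3) in auto)
  qed
qed

lemma growth_insert_rational:
  assumes "growth S G d" "g \<in> polyring G" "r \<in> polyring G"
    and "\<And>x. x \<in> S \<Longrightarrow> g x * y x = r x" "\<And>x. x \<in> S \<Longrightarrow> g x \<noteq> 0"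
  shows "growth S (insert y G) d"
proof (rule growth_insert_algebraic[OF assms(1), where e = 1 and \<alpha> = "\<lambda>i. if i = 0 then \<lambda>x. - r x else g"])
  fix i :: nat
  show "(if i = 0 then \<lambda>x. - r x else g) \<in> polyring G"
    using assms(2,3) by (auto intro: polyring_intros)
qed (use assms(4,5) in \<open>auto intro: exI[of _ 1]\<close>)

lemma growth_insert_quadratic:
  assumes "growth S G d" "a0 \<in> polyring G" "a1 \<in> polyring G" "a2 \<in> polyring G"
    and "\<And>x. x \<in> S \<Longrightarrow> a0 x + a1 x * y x + a2 x * (y x)\<^sup>2 = 0"
    and "\<And>x. x \<in> S \<Longrightarrow> a0 x \<noteq> 0 \<or> a1 x \<noteq> 0 \<or> a2 x \<noteq> 0"
  shows "growth S (insert y G) d"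
proof (rule growth_insert_algebraic[OF assms(1), where e = 2
    and \<alpha> = "\<lambda>i. if i = 0 then a0 else if i = 1 then a1 else a2"])
  fix x assume x: "x \<in> S"
  show "(\<Sum>i\<le>2. (if i = 0 then a0 else if i = 1 then a1 else a2) x * y x ^ i) = 0"
    using assms(5)[OF x] by (simp add: numeral_2_eq_2)
  from assms(6)[OF x]
  show "\<exists>i\<le>2. (if i = (0 :: nat) then a0 else if i = 1 then a1 else a2) x \<noteq> 0"
  proof (elim disjE)
    assume "a0 x \<noteq> 0" then show ?thesis by (intro exI[of _ 0]) simp
  next
    assume "a1 x \<noteq> 0" then show ?thesis by (intro exI[of _ 1]) simp
  next
    assume "a2 x \<noteq> 0" then show ?thesis by (intro exI[of _ 2]) simp
  qed
qed (use assms(2-4) in auto)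

text \<open>There are \<open>N ^ k\<close> monomials with exponents below \<open>N\<close>, but
  their restrictions to \<open>T\<close> lie in a space whose dimension is of order
  \<open>N ^ d\<close> with \<open>d < k\<close>.\<close>

lemma growth_dependent_monomials:
  assumes "growth T G d" "\<And>i. i < k \<Longrightarrow> f i \<in> polyring G" "d < k"
  shows "\<exists>N l. (\<exists>a \<in> {..<k} \<rightarrow>\<^sub>E {..<N}. l a \<noteq> 0) \<and>
    (\<forall>x\<in>T. (\<Sum>a \<in> {..<k} \<rightarrow>\<^sub>E {..<N :: nat}. l a * (\<Prod>i<k. f i x ^ a i)) = 0)"
proof -
  obtain C H where H: "\<And>D. finite (H D)" "\<And>D. card (H D) \<le> C * (D + 1) ^ d"
    "\<And>D f. f \<in> polys G D \<Longrightarrow> f \<in> span_on T (H D)"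
    by (fact growthE[OF assms(1)])
  obtain m where m: "\<And>i. i < k \<Longrightarrow> f i \<in> polys G m"
    using polyring_common_degree[of "{..<k}" f G] assms(2) by auto
  \<comment> \<open>Chosen to exceed \<open>C * (k * m + 1) ^ d\<close>, so that
    \<open>C * ((k * m + 1) * N) ^ d < N * N ^ d\<close>.\<close>
  define N where "N = C * (k * m + 1) ^ d + 1"
  define D where "D = k * (N * m)"
  let ?A = "{..<k} \<rightarrow>\<^sub>E {..<N}"
  have finA: "finite ?A" by (intro finite_PiE) auto
  have mon: "(\<lambda>x. \<Prod>i<k. f i x ^ a i) \<in> span_on T (H D)" if "a \<in> ?A" for a
  proof (rule H(3))
    have "(\<lambda>x. \<Prod>i<k. f i x ^ a i) \<in> polys G (card {..<k} * (N * m))"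
    proof (rule polys_prod)
      fix i assume i: "i \<in> {..<k}"
      have "a i < N" using that i by auto
      then show "(\<lambda>x. f i x ^ a i) \<in> polys G (N * m)"
        using polys_power[OF m, of i "a i"] i by (auto elim!: polys_mono)
    qed simp
    then show "(\<lambda>x. \<Prod>i<k. f i x ^ a i) \<in> polys G D" by (simp add: D_def)
  qed
  have "card (H D) \<le> C * (k * m * N + 1) ^ d" using H(2)[of D] by (simp add: D_def ac_simps)
  also have "\<dots> \<le> C * ((k * m + 1) * N) ^ d"
    by (intro mult_left_mono power_mono) (auto simp: N_def)
  also have "\<dots> = (C * (k * m + 1) ^ d) * N ^ d" by (simp only: power_mult_distrib mult.assoc)
  also have "\<dots> < N * N ^ d" by (rule mult_strict_right_mono) (auto simp: N_def)
  also have "N * N ^ d \<le> N ^ k" using assms(3) power_increasing[of "Suc d" k N] by (simp add: N_def)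
  also have "N ^ k = card ?A" by (simp add: card_PiE)
  finally have card: "card (H D) < card ?A" .
  obtain c where c: "\<And>a x. a \<in> ?A \<Longrightarrow> x \<in> T \<Longrightarrow> (\<Prod>i<k. f i x ^ a i) = (\<Sum>h\<in>H D. c a h * h x)"
  proof -
    have "\<forall>a\<in>?A. \<exists>c. \<forall>x\<in>T. (\<Prod>i<k. f i x ^ a i) = (\<Sum>h\<in>H D. c h * h x)"
      using span_on_coeffs[OF mon H(1)] by simp
    from bchoice[OF this] show thesis using that by auto
  qed
  obtain l where l: "\<exists>a\<in>?A. l a \<noteq> 0" "\<forall>h\<in>H D. (\<Sum>a\<in>?A. c a h * l a) = 0"
    using underdetermined_system[OF H(1) finA card, of "\<lambda>h a. c a h"] by blast
  have "(\<Sum>a\<in>?A. l a * (\<Prod>i<k. f i x ^ a i)) = 0" if "x \<in> T" for x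
  proof -
    have "(\<Sum>a\<in>?A. l a * (\<Prod>i<k. f i x ^ a i)) = (\<Sum>a\<in>?A. \<Sum>h\<in>H D. l a * (c a h * h x))"
      using c that by (simp add: sum_distrib_left)
    also have "\<dots> = (\<Sum>h\<in>H D. \<Sum>a\<in>?A. l a * (c a h * h x))" by (rule sum.swap)
    also have "\<dots> = (\<Sum>h\<in>H D. (\<Sum>a\<in>?A. c a h * l a) * h x)"
      by (simp add: sum_distrib_left sum_distrib_right ac_simps)
    also have "\<dots> = 0" using l(2) by simp
    finally show ?thesis .
  qed
  then show ?thesis using l(1) by blast
qed

section \<open>Growth bounds the Krull dimension\<close>

lemma irreducible_in_zariski_zero_divisors:
  assumes "irreducible_in (zariski I) Z" "f \<in> poly_functions I" "g \<in> poly_functions I"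
    and "\<And>x. x \<in> Z \<Longrightarrow> f x * g x = 0"
  shows "(\<forall>x\<in>Z. f x = 0) \<or> (\<forall>x\<in>Z. g x = 0)"
proof -
  have "closedin (zariski I) (zero_locus I {h})" if "h \<in> poly_functions I" for h
    unfolding closedin_zariski using that by blast
  moreover have "Z \<subseteq> zero_locus I {f} \<union> zero_locus I {g}"
    using assms(1,4) unfolding irreducible_in_def topspace_zariski zero_locus_def by auto
  ultimately have "Z \<subseteq> zero_locus I {f} \<or> Z \<subseteq> zero_locus I {g}"
    using assms(1-3) unfolding irreducible_in_def by blast
  then show ?thesis unfolding zero_locus_def by auto
qed

text \<open>A relation on the largest set is sorted by powers of the last function. By
  irreducibility the lowest power can be cancelled, and on the next smaller set, where this function
  vanishes, only the lowest coefficient survives. That coefficient is a relation between the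
  remaining functions, so induction applies. A chain of length \<open>k\<close> thus carries
  \<open>k\<close> algebraically independent functions.\<close>

lemma chain_monomials_independent:
  fixes Z :: "nat \<Rightarrow> ('i \<Rightarrow> complex) set"
  assumes "\<And>i. i \<le> k \<Longrightarrow> irreducible_in (zariski I) (Z i)"
    and "\<And>i. i < k \<Longrightarrow> Z i \<subseteq> Z (Suc i)"
    and "\<And>i. i < k \<Longrightarrow> f i \<in> poly_functions I"
    and "\<And>i x. i < k \<Longrightarrow> x \<in> Z i \<Longrightarrow> f i x = 0"
    and "\<And>i. i < k \<Longrightarrow> \<exists>x\<in>Z (Suc i). f i x \<noteq> 0"
    and "\<And>x. x \<in> Z k \<Longrightarrow> (\<Sum>a \<in> {..<k} \<rightarrow>\<^sub>E {..<N :: nat}. c a * (\<Prod>i<k. f i x ^ a i)) = 0"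
    and "a \<in> {..<k} \<rightarrow>\<^sub>E {..<N}"
  shows "c a = 0"
  using assms
proof (induction k arbitrary: c a)
  case 0
  have "Z 0 \<noteq> {}" using "0.prems"(1)[of 0] by (simp add: irreducible_in_def)
  then show ?case using "0.prems"(6,7) by auto
next
  case (Suc k)
  let ?A = "{..<k} \<rightarrow>\<^sub>E {..<N}"
  let ?m = "\<lambda>b x. \<Prod>i<k. f i x ^ b i"
  define P where "P j x = (\<Sum>b\<in>?A. c (b(k := j)) * ?m b x)" for j x
  have Ppoly: "P j \<in> poly_functions I" for j
    unfolding P_def[abs_def] using Suc.prems(3)
    by (intro poly_functions_intros finite_PiE) auto
  have sum: "(\<Sum>a \<in> {..<Suc k} \<rightarrow>\<^sub>E {..<N}. c a * (\<Prod>i<Suc k. f i x ^ a i)) = (\<Sum>j<N. f k x ^ j * P j x)" for x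
  proof -
    have inj: "inj_on (\<lambda>(j, b). b(k := j)) ({..<N} \<times> ?A)"
    proof (rule inj_onI, clarify)
      fix j b j' b' assume *: "b \<in> ?A" "b' \<in> ?A" "b(k := j) = b'(k := j')"
      have "b i = b' i" for i
        using fun_cong[OF *(3), of i] PiE_arb[OF *(1), of i] PiE_arb[OF *(2), of i] by (cases "i = k") auto
      then show "j = j' \<and> b = b'" using fun_cong[OF *(3), of k] by auto
    qed
    have "{..<Suc k} \<rightarrow>\<^sub>E {..<N} = (\<lambda>(j, b). b(k := j)) ` ({..<N} \<times> ?A)"
      by (simp add: lessThan_Suc PiE_insert_eq)
    then have "(\<Sum>a \<in> {..<Suc k} \<rightarrow>\<^sub>E {..<N}. c a * (\<Prod>i<Suc k. f i x ^ a i))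
       = (\<Sum>(j, b)\<in>{..<N} \<times> ?A. c (b(k := j)) * (\<Prod>i<Suc k. f i x ^ (b(k := j)) i))"
      by (simp only: sum.reindex[OF inj]) (simp add: case_prod_unfold)
    also have "\<dots> = (\<Sum>(j, b)\<in>{..<N} \<times> ?A. f k x ^ j * (c (b(k := j)) * ?m b x))"
    proof (intro sum.cong refl, clarify)
      fix j and b :: "nat \<Rightarrow> nat"
      have "(\<Prod>i<k. f i x ^ (b(k := j)) i) = ?m b x" by (intro prod.cong) auto
      then show "c (b(k := j)) * (\<Prod>i<Suc k. f i x ^ (b(k := j)) i) = f k x ^ j * (c (b(k := j)) * ?m b x)"
        by simp
    qed
    also have "\<dots> = (\<Sum>j<N. f k x ^ j * P j x)"
      by (simp add: sum.cartesian_product[symmetric] P_def sum_distrib_left)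
    finally show ?thesis .
  qed
  have all0: "\<forall>b\<in>?A. c (b(k := j)) = 0" if "j < N" for j
    using that
  proof (induction j rule: less_induct)
    case (less j)
    have P0: "P i x = 0" if "i < j" for i x
    proof -
      have "\<forall>b\<in>?A. c (b(k := i)) = 0" using less.IH[OF that] less.prems that by (simp add: fun_upd_def)
      then show ?thesis unfolding P_def by simp
    qed
    \<comment> \<open>What remains of the relation after cancelling \<open>f k ^ j\<close>; the
      coefficients below \<open>j\<close> are zero by the inner induction.\<close>
    define R where "R x = P j x + f k x * (\<Sum>i\<in>{Suc j..<N}. f k x ^ (i - Suc j) * P i x)" for x
    have fk: "f k \<in> poly_functions I" using Suc.prems(3) by simp
    have R: "R \<in> poly_functions I"
      unfolding R_def[abs_def] by (intro poly_functions_intros fk Ppoly) auto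
    have "f k x ^ j * R x = 0" if "x \<in> Z (Suc k)" for x
    proof -
      have "{..<N} = {..<j} \<union> insert j {Suc j..<N}" using less.prems by auto
      then have "(\<Sum>i<N. f k x ^ i * P i x) = (\<Sum>i\<in>insert j {Suc j..<N}. f k x ^ i * P i x)"
        using P0 by (simp only:) (subst sum.union_disjoint, auto)
      also have "\<dots> = f k x ^ j * P j x + (\<Sum>i\<in>{Suc j..<N}. f k x ^ i * P i x)" by simp
      also have "(\<Sum>i\<in>{Suc j..<N}. f k x ^ i * P i x)
        = (\<Sum>i\<in>{Suc j..<N}. f k x ^ Suc j * (f k x ^ (i - Suc j) * P i x))"
        by (intro sum.cong refl) (simp add: power_add[symmetric] mult.assoc[symmetric] del: power_Suc)
      also have "\<dots> = f k x ^ j * (f k x * (\<Sum>i\<in>{Suc j..<N}. f k x ^ (i - Suc j) * P i x))"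
        unfolding sum_distrib_left by (intro sum.cong refl) (simp add: mult.assoc mult.left_commute)
      finally show ?thesis
        using Suc.prems(6)[OF that] unfolding sum R_def by (simp add: distrib_left)
    qed
    then have "(\<forall>x\<in>Z (Suc k). f k x ^ j = 0) \<or> (\<forall>x\<in>Z (Suc k). R x = 0)"
      by (intro irreducible_in_zariski_zero_divisors[OF _ poly_functions_power[OF fk] R] Suc.prems(1)) auto
    moreover obtain x0 where "x0 \<in> Z (Suc k)" "f k x0 \<noteq> 0" using Suc.prems(5)[of k] by auto
    ultimately have R0: "R x = 0" if "x \<in> Z (Suc k)" for x using that by fastforce
    have Pj: "P j x = 0" if "x \<in> Z k" for x
    proof -
      have "x \<in> Z (Suc k)" using Suc.prems(2)[of k] that by blast
      moreover have "f k x = 0" using Suc.prems(4)[OF _ that] by simp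
      moreover from calculation(1) have "R x = 0" by (rule R0)
      ultimately show ?thesis by (simp add: R_def)
    qed
    show ?case
    proof
      fix b assume b: "b \<in> ?A"
      show "c (b(k := j)) = 0"
      proof (rule Suc.IH[where c = "\<lambda>b. c (b(k := j))" and a = b])
        show "(\<Sum>b\<in>?A. c (b(k := j)) * ?m b x) = 0" if "x \<in> Z k" for x
          using Pj[OF that] by (simp only: P_def)
      qed (use Suc.prems(1-5) b in simp_all)
    qed
  qed
  have aN: "a i < N" if "i \<le> k" for i using PiE_mem[OF Suc.prems(7), of i] that by simp
  have "a k < N" by (rule aN) simp
  moreover have "restrict a {..<k} \<in> ?A"
  proof (rule PiE_I)
    show "restrict a {..<k} i \<in> {..<N}" if "i \<in> {..<k}" for i using that aN[of i] by simp
    show "restrict a {..<k} i = undefined" if "i \<notin> {..<k}" for i using that by simp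
  qed
  moreover have "(restrict a {..<k})(k := a k) = a"
  proof
    fix i
    show "((restrict a {..<k})(k := a k)) i = a i"
      using PiE_arb[OF Suc.prems(7), of i] by (cases "i < k"; cases "i = k") simp_all
  qed
  ultimately show "c a = 0" using bspec[OF all0, of "a k" "restrict a {..<k}"] by simp
qed

lemma poly_functions_polyring:
  assumes "f \<in> poly_functions I"
  shows "f \<in> polyring ((\<lambda>i x. x i) ` I)"
  using assms by (induction f rule: poly_functions.induct)
    (auto intro: polyring_const polyring_gen polyring_add polyring_mult)

lemma closure_of_zariski_vanishing:
  assumes "T \<subseteq> extensional I" "f \<in> poly_functions I" "\<And>x. x \<in> T \<Longrightarrow> f x = 0"
    and "x \<in> zariski I closure_of T"
  shows "f x = 0"
proof -
  have "zariski I closure_of T \<subseteq> zero_locus I {f}"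
  proof (rule closure_of_minimal)
    show "T \<subseteq> zero_locus I {f}" using assms(1,3) by (auto simp: zero_locus_def)
    show "closedin (zariski I) (zero_locus I {f})" unfolding closedin_zariski using assms(2) by blast
  qed
  then show ?thesis using assms(4) by (auto simp: zero_locus_def)
qed

lemma irreducible_in_subtopology_closed:
  assumes "closedin T X"
  shows "irreducible_in (subtopology T X) S \<longleftrightarrow> irreducible_in T S \<and> S \<subseteq> X"
proof
  assume irr: "irreducible_in (subtopology T X) S"
  then have S: "S \<noteq> {}" "S \<subseteq> topspace T" "S \<subseteq> X" unfolding irreducible_in_def by auto
  have "S \<subseteq> A \<or> S \<subseteq> B" if "closedin T A" "closedin T B" "S \<subseteq> A \<union> B" for A B
  proof -
    have "closedin (subtopology T X) (A \<inter> X)" "closedin (subtopology T X) (B \<inter> X)"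
      using that assms by (auto simp: closedin_subtopology)
    moreover have "S \<subseteq> A \<inter> X \<union> B \<inter> X" using that(3) S(3) by auto
    ultimately have "S \<subseteq> A \<inter> X \<or> S \<subseteq> B \<inter> X" using irr unfolding irreducible_in_def by blast
    then show ?thesis by auto
  qed
  then show "irreducible_in T S \<and> S \<subseteq> X" using S unfolding irreducible_in_def by auto
next
  assume "irreducible_in T S \<and> S \<subseteq> X"
  then show "irreducible_in (subtopology T X) S"
    using assms unfolding irreducible_in_def
    by (auto simp: closedin_closed_subtopology)
qed

text \<open>Each strict inclusion of a chain is witnessed by a polynomial, and these polynomials are
  independent on the largest member. If the chain is longer than \<open>d\<close>, growth provides a
  relation on \<open>T\<close>; it is itself a polynomial, so it persists on the closure and hence
  on the chain.\<close>

lemma krull_dim_closure_le: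
  assumes T: "T \<subseteq> extensional I" and growth: "growth T ((\<lambda>i x. x i) ` I) d"
  shows "krull_dim (subtopology (zariski I) (zariski I closure_of T)) \<le> enat d"
  unfolding krull_dim_def
proof (rule Sup_least)
  let ?X = "zariski I closure_of T"
  fix e assume "e \<in> {enat k | k. \<exists>Z. (\<forall>i\<le>k. closedin (subtopology (zariski I) ?X) (Z i) \<and>
      irreducible_in (subtopology (zariski I) ?X) (Z i)) \<and> (\<forall>i<k. Z i \<subset> Z (Suc i))}"
  then obtain k Z where e: "e = enat k"
    and Z: "\<And>i. i \<le> k \<Longrightarrow> closedin (subtopology (zariski I) ?X) (Z i)"
      "\<And>i. i \<le> k \<Longrightarrow> irreducible_in (subtopology (zariski I) ?X) (Z i)"
    and strict: "\<And>i. i < k \<Longrightarrow> Z i \<subset> Z (Suc i)" by auto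
  have X: "closedin (zariski I) ?X" by simp
  have cl: "closedin (zariski I) (Z i)" if "i \<le> k" for i
    using Z(1)[OF that] by (simp add: closedin_closed_subtopology[OF X])
  have irr: "irreducible_in (zariski I) (Z i)" "Z i \<subseteq> ?X" if "i \<le> k" for i
    using Z(2)[OF that] by (simp_all add: irreducible_in_subtopology_closed[OF X])
  have "\<exists>f. f \<in> poly_functions I \<and> (\<forall>x\<in>Z i. f x = 0) \<and> (\<exists>x\<in>Z (Suc i). f x \<noteq> 0)" if i: "i < k" for i
  proof -
    obtain F where F: "F \<subseteq> poly_functions I" "Z i = zero_locus I F"
      using cl[of i] i unfolding closedin_zariski by auto
    obtain x where x: "x \<in> Z (Suc i)" "x \<notin> Z i" using strict[OF i] by auto
    have "x \<in> extensional I"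
      using x(1) irr(1)[of "Suc i"] i unfolding irreducible_in_def topspace_zariski by auto
    with x(2) obtain f where "f \<in> F" "f x \<noteq> 0" unfolding F(2) zero_locus_def by auto
    then show ?thesis using F x(1) unfolding zero_locus_def by auto
  qed
  then obtain f where f: "\<And>i. i < k \<Longrightarrow> f i \<in> poly_functions I"
    "\<And>i x. i < k \<Longrightarrow> x \<in> Z i \<Longrightarrow> f i x = 0" "\<And>i. i < k \<Longrightarrow> \<exists>x\<in>Z (Suc i). f i x \<noteq> 0"
    by metis
  show "e \<le> enat d"
  proof (rule ccontr)
    assume "\<not> e \<le> enat d"
    then have "d < k" by (simp add: e)
    then obtain N l a where a: "a \<in> {..<k} \<rightarrow>\<^sub>E {..<N}" "l a \<noteq> 0"
      and dep: "\<forall>x\<in>T. (\<Sum>a \<in> {..<k} \<rightarrow>\<^sub>E {..<N}. l a * (\<Prod>i<k. f i x ^ a i)) = 0"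
      using growth_dependent_monomials[OF growth, of k f] poly_functions_polyring[OF f(1)] by auto
    let ?g = "\<lambda>x. \<Sum>a \<in> {..<k} \<rightarrow>\<^sub>E {..<N}. l a * (\<Prod>i<k. f i x ^ a i)"
    have g: "?g \<in> poly_functions I"
      using f(1) by (intro poly_functions_intros finite_PiE) auto
    have g0: "?g x = 0" if "x \<in> Z k" for x
      by (rule closure_of_zariski_vanishing[OF T g]) (use dep that irr(2)[of k] in auto)
    have "l a = 0"
    proof (rule chain_monomials_independent[where k = k and Z = Z and f = f and I = I and N = N
          and c = l and a = a])
      show "Z i \<subseteq> Z (Suc i)" if "i < k" for i using strict[OF that] by auto
      show "irreducible_in (zariski I) (Z i)" if "i \<le> k" for i using that by (rule irr(1))
      show "f i \<in> poly_functions I" if "i < k" for i using that by (rule f(1))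
      show "f i x = 0" if "i < k" "x \<in> Z i" for i x using that by (rule f(2))
      show "\<exists>x\<in>Z (Suc i). f i x \<noteq> 0" if "i < k" for i using that by (rule f(3))
      show "?g x = 0" if "x \<in> Z k" for x using that by (rule g0)
      show "a \<in> {..<k} \<rightarrow>\<^sub>E {..<N}" by (rule a(1))
    qed
    with a(2) show False by simp
  qed
qed

section \<open>Lines meeting one, two or three lines\<close>

text \<open>In the following lemmas \<open>y\<close> and \<open>v\<close>, \<open>z\<close> are the parameters of a line and of its
  neighbours relative to a further neighbour, so that the latter becomes the line with parameters 0.\<close>

lemma growth_meeting_one_line:
  assumes "growth S G d" and q: "\<And>x. x \<in> S \<Longrightarrow> y1 x * y4 x = y2 x * y3 x"
  shows "growth S ({y1, y2, y3, y4} \<union> G) (d + 3)"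
proof (rule growth_cover[where P = "\<lambda>x. y4 x = 0"])
  let ?S = "{x \<in> S. y4 x = 0}"
  have 1: "growth ?S G d" using assms(1) by (rule growth_subset) auto
  have "growth ?S (insert y4 G) d"
    by (rule growth_insert_rational[OF 1 polyring_const[of 1] polyring_const[of 0]]) auto
  from growth_insert_free[OF growth_insert_free[OF growth_insert_free[OF this]], of y1 y2 y3]
  have "growth ?S (insert y1 (insert y2 (insert y3 (insert y4 G)))) (d + 3)"
    by (simp add: eval_nat_numeral)
  then show "growth ?S ({y1, y2, y3, y4} \<union> G) (d + 3)" by (rule growth_subset) auto
next
  let ?S = "{x \<in> S. y4 x \<noteq> 0}"
  have "growth ?S G d" using assms(1) by (rule growth_subset) auto
  from growth_insert_free[OF growth_insert_free[OF growth_insert_free[OF this]], of y2 y3 y4]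
  have "growth ?S (insert y2 (insert y3 (insert y4 G))) (d + 3)" by (simp add: eval_nat_numeral)
  then have "growth ?S (insert y1 (insert y2 (insert y3 (insert y4 G)))) (d + 3)"
  proof (rule growth_insert_rational[where g = y4 and r = "\<lambda>x. y2 x * y3 x"])
    show "(\<lambda>x. y2 x * y3 x) \<in> polyring (insert y2 (insert y3 (insert y4 G)))"
      by (intro polyring_mult polyring_gen) auto
  qed (use q in \<open>auto intro!: polyring_gen simp: mult.commute\<close>)
  then show "growth ?S ({y1, y2, y3, y4} \<union> G) (d + 3)" by (rule growth_subset) auto
qed

section \<open>The chart in which the first relative parameter \<open>v1\<close> of a neighbour is
  nonzero\<close>

context
  fixes S :: "'s set" and G and y1 y2 y3 y4 v1 v2 v3 v4 :: "'s \<Rightarrow> complex"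
  assumes vG: "v1 \<in> G" "v2 \<in> G" "v3 \<in> G" "v4 \<in> G"
    and q: "\<And>x. x \<in> S \<Longrightarrow> y1 x * y4 x = y2 x * y3 x"
    and lin: "\<And>x. x \<in> S \<Longrightarrow> v1 x * y4 x + v4 x * y1 x - v2 x * y3 x - v3 x * y2 x = v1 x * v4 x - v2 x * v3 x"
    and v1: "\<And>x. x \<in> S \<Longrightarrow> v1 x \<noteq> 0"
begin

text \<open>\<open>lin\<close> expresses \<open>v1 * y4\<close> by the other coordinates; inserted
  into \<open>v1\<close> times the equation \<open>q\<close>, it leaves an equation linear in
  \<open>y2\<close>. Whether the coefficient \<open>v3 * y1 - v1 * y3\<close> vanishes governs the
  case distinctions below.\<close>

lemma y2_formula:
  assumes "x \<in> S"
  shows "(v3 x * y1 x - v1 x * y3 x) * y2 x =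
    - y1 x * (v1 x * v4 x - v2 x * v3 x - v4 x * y1 x + v2 x * y3 x)"
  using q[OF assms] lin[OF assms] by algebra

lemma y4_formula:
  assumes "x \<in> S"
  shows "(v3 x * y1 x - v1 x * y3 x) * y4 x =
    - y3 x * (v1 x * v4 x - v2 x * v3 x - v4 x * y1 x + v2 x * y3 x)"
proof -
  have "v1 x * ((v3 x * y1 x - v1 x * y3 x) * y4 x) =
    v1 x * (- y3 x * (v1 x * v4 x - v2 x * v3 x - v4 x * y1 x + v2 x * y3 x))"
    using y2_formula[OF assms] lin[OF assms] by algebra
  then show ?thesis using v1[OF assms] unfolding mult_cancel_left by blast
qed

lemma growth_insert_y4:
  assumes "growth T G' e" "T \<subseteq> S" "{y1, y2, y3} \<union> G \<subseteq> G'"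
  shows "growth T ({y1, y2, y3, y4} \<union> G) e"
proof -
  have "growth T (insert y4 G') e"
  proof (rule growth_insert_rational[OF assms(1), where g = v1 and
        r = "\<lambda>x. v1 x * v4 x - v2 x * v3 x - v4 x * y1 x + v2 x * y3 x + v3 x * y2 x"])
    show "v1 \<in> polyring G'" using vG assms(3) by (auto intro: polyring_gen)
    show "(\<lambda>x. v1 x * v4 x - v2 x * v3 x - v4 x * y1 x + v2 x * y3 x + v3 x * y2 x) \<in> polyring G'"
      by (intro polyring_intros; rule polyring_gen; use vG assms(3) in auto)
    show "v1 x * y4 x = v1 x * v4 x - v2 x * v3 x - v4 x * y1 x + v2 x * y3 x + v3 x * y2 x" if "x \<in> T" for x
      using lin[of x] assms(2) that by (auto simp: algebra_simps)
    show "v1 x \<noteq> 0" if "x \<in> T" for x using v1 assms(2) that by auto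
  qed
  then show ?thesis by (rule growth_subset) (use assms(3) in auto)
qed

lemma growth_insert_y3_y4:
  assumes "growth T G' e" "T \<subseteq> S" "{y1, y2} \<union> G \<subseteq> G'" "\<And>x. x \<in> T \<Longrightarrow> v3 x * y1 x - v1 x * y3 x = 0"
  shows "growth T ({y1, y2, y3, y4} \<union> G) e"
proof -
  have "growth T (insert y3 G') e"
  proof (rule growth_insert_rational[OF assms(1), where g = v1 and r = "\<lambda>x. v3 x * y1 x"])
    show "v1 \<in> polyring G'" using vG assms(3) by (auto intro: polyring_gen)
    show "(\<lambda>x. v3 x * y1 x) \<in> polyring G'"
      by (intro polyring_intros; rule polyring_gen; use vG assms(3) in auto)
    show "v1 x * y3 x = v3 x * y1 x" if "x \<in> T" for x
      using assms(4)[OF that] by simp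
    show "v1 x \<noteq> 0" if "x \<in> T" for x using v1 assms(2) that by auto
  qed
  then show ?thesis using assms(2,3) by (intro growth_insert_y4) auto
qed

lemma growth_insert_y2_y4:
  assumes "growth T G' e" "T \<subseteq> S" "{y1, y3} \<union> G \<subseteq> G'" "\<And>x. x \<in> T \<Longrightarrow> v3 x * y1 x - v1 x * y3 x \<noteq> 0"
  shows "growth T ({y1, y2, y3, y4} \<union> G) e"
proof -
  have "growth T (insert y2 G') e"
  proof (rule growth_insert_rational[OF assms(1), where g = "\<lambda>x. v3 x * y1 x - v1 x * y3 x" and
        r = "\<lambda>x. - y1 x * (v1 x * v4 x - v2 x * v3 x - v4 x * y1 x + v2 x * y3 x)"])
    show "(\<lambda>x. v3 x * y1 x - v1 x * y3 x) \<in> polyring G'"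
      by (intro polyring_intros; rule polyring_gen; use vG assms(3) in auto)
    show "(\<lambda>x. - y1 x * (v1 x * v4 x - v2 x * v3 x - v4 x * y1 x + v2 x * y3 x)) \<in> polyring G'"
      by (intro polyring_intros; rule polyring_gen; use vG assms(3) in auto)
  qed (use y2_formula assms(2,4) in auto)
  then show ?thesis using assms(2,3) by (intro growth_insert_y4) auto
qed

text \<open>If the coefficient of \<open>y2\<close> vanishes, \<open>y3\<close> is determined by
  \<open>y1\<close>, and \<open>y1\<close>, \<open>y2\<close> are free; otherwise \<open>y2\<close>
  is rational in \<open>y1\<close>, \<open>y3\<close>. In both cases \<open>y4\<close> follows from
  \<open>lin\<close>.\<close>

lemma growth_meeting_two_lines_aux:
  assumes growth: "growth S G d"
  shows "growth S ({y1, y2, y3, y4} \<union> G) (d + 2)"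
proof (rule growth_cover[where P = "\<lambda>x. v3 x * y1 x - v1 x * y3 x = 0"])
  let ?S = "{x \<in> S. v3 x * y1 x - v1 x * y3 x = 0}"
  have "growth ?S G d" using growth by (rule growth_subset) auto
  from growth_insert_free[OF growth_insert_free[OF this], of y2 y1]
  have "growth ?S (insert y2 (insert y1 G)) (d + 2)" by simp
  then show "growth ?S ({y1, y2, y3, y4} \<union> G) (d + 2)" by (rule growth_insert_y3_y4) auto
next
  let ?S = "{x \<in> S. v3 x * y1 x - v1 x * y3 x \<noteq> 0}"
  have "growth ?S G d" using growth by (rule growth_subset) auto
  from growth_insert_free[OF growth_insert_free[OF this], of y3 y1]
  have "growth ?S (insert y3 (insert y1 G)) (d + 2)" by simp
  then show "growth ?S ({y1, y2, y3, y4} \<union> G) (d + 2)" by (rule growth_insert_y2_y4) auto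
qed

text \<open>Inserting the rational expressions for \<open>y2\<close> and \<open>y4\<close> into
  \<open>lin'\<close> gives a conic in \<open>(y1, y3)\<close>. Read as a quadratic equation for
  \<open>y3\<close>, it leaves only \<open>y1\<close> free. Where its coefficients vanish, they are
  equations for \<open>y1\<close>, which becomes algebraic while \<open>y3\<close> is free. Both
  readings are void only if \<open>z\<close> is 0 or \<open>v\<close>, which distinctness
  excludes.\<close>

lemma growth_meeting_three_lines_aux:
  assumes growth: "growth S G d"
    and zG: "z1 \<in> G" "z2 \<in> G" "z3 \<in> G" "z4 \<in> G"
    and lin': "\<And>x. x \<in> S \<Longrightarrow> z1 x * y4 x + z4 x * y1 x - z2 x * y3 x - z3 x * y2 x = z1 x * z4 x - z2 x * z3 x"
    and z0: "\<And>x. x \<in> S \<Longrightarrow> \<not> (z1 x = 0 \<and> z2 x = 0 \<and> z3 x = 0 \<and> z4 x = 0)"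
    and zv: "\<And>x. x \<in> S \<Longrightarrow> \<not> (z1 x = v1 x \<and> z2 x = v2 x \<and> z3 x = v3 x \<and> z4 x = v4 x)"
    and qv: "\<And>x. x \<in> S \<Longrightarrow> v1 x * v4 x - v2 x * v3 x \<noteq> 0"
  shows "growth S ({y1, y2, y3, y4} \<union> G) (d + 1)"
proof (rule growth_cover[where P = "\<lambda>x. v3 x * y1 x - v1 x * y3 x = 0"])
  let ?S = "{x \<in> S. v3 x * y1 x - v1 x * y3 x = 0}"
  have 1: "growth ?S G d" using growth by (rule growth_subset) auto
  have "growth ?S (insert y1 G) d"
  proof (rule growth_insert_quadratic[OF 1, where ?a0.0 = "\<lambda>x. 0" and ?a1.0 = v1 and ?a2.0 = "\<lambda>x. -1"])
    fix x assume x: "x \<in> ?S"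
    \<comment> \<open>Here \<open>v1 * y3 = v3 * y1\<close>, so \<open>v1\<close> times the
      right-hand side of \<open>y2_formula\<close> factors; \<open>y1\<close> is restricted to the
      values 0 and \<open>v1\<close>, and \<open>y2\<close> is the only free parameter.\<close>
    have "y1 x * (v1 x * v4 x - v2 x * v3 x) * (v1 x - y1 x) = 0"
      using y2_formula[of x] x by (simp, algebra)
    then show "0 + v1 x * y1 x + - 1 * (y1 x)\<^sup>2 = 0"
      using qv[of x] x by (auto simp: power2_eq_square)
  qed (use vG in \<open>auto intro: polyring_const polyring_gen\<close>)
  from growth_insert_free[OF this, of y2]
  have "growth ?S (insert y2 (insert y1 G)) (d + 1)" by simp
  then show "growth ?S ({y1, y2, y3, y4} \<union> G) (d + 1)" by (rule growth_insert_y3_y4) auto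
next
  let ?S = "{x \<in> S. v3 x * y1 x - v1 x * y3 x \<noteq> 0}"
  \<comment> \<open>The coefficients of the conic derived in \<open>rel\<close>:
    \<open>\<beta>\<close> belongs to \<open>y1 * y3\<close>, \<open>\<gamma>\<close> to
    \<open>y3\<close>, \<open>\<delta>\<close> to \<open>y1 ^ 2\<close>, \<open>\<epsilon>\<close>
    to \<open>y1\<close>, and \<open>A2\<close> to \<open>y3 ^ 2\<close>. There is no constant
    term.\<close>
  define \<beta> where "\<beta> x = z3 x * v2 x + z1 x * v4 x - z4 x * v1 x - z2 x * v3 x" for x
  define \<gamma> where "\<gamma> x = (z1 x * z4 x - z2 x * z3 x) * v1 x - z1 x * (v1 x * v4 x - v2 x * v3 x)" for x
  define \<delta> where "\<delta> x = z4 x * v3 x - z3 x * v4 x" for x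
  define \<epsilon> where "\<epsilon> x = z3 x * (v1 x * v4 x - v2 x * v3 x) - (z1 x * z4 x - z2 x * z3 x) * v3 x" for x
  define A2 where "A2 x = z2 x * v1 x - z1 x * v2 x" for x
  define A1 where "A1 x = \<gamma> x + \<beta> x * y1 x" for x
  define A0 where "A0 x = \<epsilon> x * y1 x + \<delta> x * (y1 x)\<^sup>2" for x
  have poly: "\<beta> \<in> polyring G'" "\<gamma> \<in> polyring G'" "\<delta> \<in> polyring G'" "\<epsilon> \<in> polyring G'" "A2 \<in> polyring G'"
    if "G \<subseteq> G'" for G'
    unfolding \<beta>_def[abs_def] \<gamma>_def[abs_def] \<delta>_def[abs_def] \<epsilon>_def[abs_def] A2_def[abs_def]
    by (intro polyring_intros; rule polyring_gen; use vG zG that in auto)+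
  have polyA: "A1 \<in> polyring (insert y1 G)" "A0 \<in> polyring (insert y1 G)"
    unfolding A1_def[abs_def] A0_def[abs_def]
    by (intro polyring_intros poly; (rule polyring_gen)?; auto)+
  have rel: "A0 x + A1 x * y3 x + A2 x * (y3 x)\<^sup>2 = 0" if "x \<in> S" for x
  proof -
    have "(z3 x * y1 x - z1 x * y3 x) * (v1 x * v4 x - v2 x * v3 x - v4 x * y1 x + v2 x * y3 x)
      + (z4 x * y1 x - z2 x * y3 x - (z1 x * z4 x - z2 x * z3 x)) * (v3 x * y1 x - v1 x * y3 x) = 0"
      using y2_formula[OF that] y4_formula[OF that] lin'[OF that] by algebra
    then show ?thesis unfolding A0_def A1_def A2_def \<beta>_def \<gamma>_def \<delta>_def \<epsilon>_def by algebra
  qed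
  have nondegenerate: "\<not> (\<beta> x = 0 \<and> \<gamma> x = 0 \<and> \<delta> x = 0 \<and> \<epsilon> x = 0 \<and> A2 x = 0)" if x: "x \<in> S" for x
  proof
    assume deg: "\<beta> x = 0 \<and> \<gamma> x = 0 \<and> \<delta> x = 0 \<and> \<epsilon> x = 0 \<and> A2 x = 0"
    \<comment> \<open>The factor by which \<open>z\<close> turns out to be a multiple of
      \<open>v\<close>. The quadratic form scales by its square, so \<open>c ^ 2 = c\<close>, and
      \<open>z\<close> would be one of the other two neighbours.\<close>
    define c where "c = (z1 x * z4 x - z2 x * z3 x) / (v1 x * v4 x - v2 x * v3 x)"
    have qz: "z1 x * z4 x - z2 x * z3 x = c * (v1 x * v4 x - v2 x * v3 x)"
      using qv[OF x] by (simp add: c_def)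
    have "(v1 x * v4 x - v2 x * v3 x) * z1 x = (v1 x * v4 x - v2 x * v3 x) * (c * v1 x)"
      using deg qz unfolding \<gamma>_def by algebra
    then have z1: "z1 x = c * v1 x" using qv[OF x] by simp
    have "(v1 x * v4 x - v2 x * v3 x) * z3 x = (v1 x * v4 x - v2 x * v3 x) * (c * v3 x)"
      using deg qz unfolding \<epsilon>_def by algebra
    then have z3: "z3 x = c * v3 x" using qv[OF x] by simp
    have "v1 x * z2 x = v1 x * (c * v2 x)"
      using deg z1 unfolding A2_def by algebra
    then have z2: "z2 x = c * v2 x" using v1[OF x] by simp
    have "v1 x * z4 x = v1 x * (c * v4 x)"
      using deg z1 z2 z3 unfolding \<beta>_def by algebra
    then have z4: "z4 x = c * v4 x" using v1[OF x] by simp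
    have "(v1 x * v4 x - v2 x * v3 x) * (c * (c - 1)) = 0"
      using qz unfolding z1 z2 z3 z4 by algebra
    then have "c = 0 \<or> c = 1" using qv[OF x] by simp
    then show False using z0[OF x] zv[OF x] z1 z2 z3 z4 by auto
  qed
  show "growth ?S ({y1, y2, y3, y4} \<union> G) (d + 1)"
  proof (rule growth_cover[where P = "\<lambda>x. A0 x \<noteq> 0 \<or> A1 x \<noteq> 0 \<or> A2 x \<noteq> 0"])
    let ?T = "{x \<in> ?S. A0 x \<noteq> 0 \<or> A1 x \<noteq> 0 \<or> A2 x \<noteq> 0}"
    have "growth ?T G d" using growth by (rule growth_subset) auto
    from growth_insert_free[OF this] have "growth ?T (insert y1 G) (d + 1)" by simp
    then have "growth ?T (insert y3 (insert y1 G)) (d + 1)"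
      by (rule growth_insert_quadratic[OF _ polyA(2,1) poly(5)]) (use rel in auto)
    then show "growth ?T ({y1, y2, y3, y4} \<union> G) (d + 1)" by (rule growth_insert_y2_y4) auto
  next
    let ?T = "{x \<in> ?S. \<not> (A0 x \<noteq> 0 \<or> A1 x \<noteq> 0 \<or> A2 x \<noteq> 0)}"
    have "growth ?T (insert y1 G) d"
    proof (rule growth_cover[where P = "\<lambda>x. \<gamma> x \<noteq> 0 \<or> \<beta> x \<noteq> 0"])
      let ?U = "{x \<in> ?T. \<gamma> x \<noteq> 0 \<or> \<beta> x \<noteq> 0}"
      have "growth ?U G d" using growth by (rule growth_subset) auto
      then show "growth ?U (insert y1 G) d"
        by (rule growth_insert_quadratic[OF _ poly(2,1) polyring_const[of 0]]) (auto simp: A1_def)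
    next
      let ?U = "{x \<in> ?T. \<not> (\<gamma> x \<noteq> 0 \<or> \<beta> x \<noteq> 0)}"
      have "growth ?U G d" using growth by (rule growth_subset) auto
      then show "growth ?U (insert y1 G) d"
        by (rule growth_insert_quadratic[OF _ polyring_const[of 0] poly(4,3)])
          (use nondegenerate in \<open>auto simp: A0_def\<close>)
    qed
    from growth_insert_free[OF this, of y3]
    have "growth ?T (insert y3 (insert y1 G)) (d + 1)" by simp
    then show "growth ?T ({y1, y2, y3, y4} \<union> G) (d + 1)" by (rule growth_insert_y2_y4) auto
  qed
qed

end

text \<open>Some coordinate of \<open>v\<close> is nonzero. The double transpositions of the four
  indices preserve the quadratic form up to sign and act transitively, so every chart reduces to
  that of \<open>v1\<close>.\<close>

lemma growth_meeting_two_lines: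
  assumes growth: "growth S G d" and vG: "v1 \<in> G" "v2 \<in> G" "v3 \<in> G" "v4 \<in> G"
    and q: "\<And>x. x \<in> S \<Longrightarrow> y1 x * y4 x = y2 x * y3 x"
    and lin: "\<And>x. x \<in> S \<Longrightarrow> v1 x * y4 x + v4 x * y1 x - v2 x * y3 x - v3 x * y2 x = v1 x * v4 x - v2 x * v3 x"
    and v: "\<And>x. x \<in> S \<Longrightarrow> \<not> (v1 x = 0 \<and> v2 x = 0 \<and> v3 x = 0 \<and> v4 x = 0)"
  shows "growth S ({y1, y2, y3, y4} \<union> G) (d + 2)"
proof -
  have sub: "growth T G d" if "T \<subseteq> S" for T using growth by (rule growth_subset) (use that in auto)
  have "growth {x \<in> S. v1 x \<noteq> 0} ({y1, y2, y3, y4} \<union> G) (d + 2)"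
    by (rule growth_meeting_two_lines_aux[OF vG _ _ _ sub]) (use q lin in auto)
  moreover have "growth {x \<in> S. v2 x \<noteq> 0} ({y2, y1, y4, y3} \<union> G) (d + 2)"
    by (rule growth_meeting_two_lines_aux[OF vG(2,1,4,3) _ _ _ sub]) (use q lin in \<open>auto simp: algebra_simps\<close>)
  moreover have "growth {x \<in> S. v3 x \<noteq> 0} ({y3, y4, y1, y2} \<union> G) (d + 2)"
    by (rule growth_meeting_two_lines_aux[OF vG(3,4,1,2) _ _ _ sub]) (use q lin in \<open>auto simp: algebra_simps\<close>)
  moreover have "growth {x \<in> S. v4 x \<noteq> 0} ({y4, y3, y2, y1} \<union> G) (d + 2)"
    by (rule growth_meeting_two_lines_aux[OF vG(4,3,2,1) _ _ _ sub]) (use q lin in \<open>auto simp: algebra_simps\<close>)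
  ultimately have "growth ({x \<in> S. v1 x \<noteq> 0} \<union> {x \<in> S. v2 x \<noteq> 0} \<union> {x \<in> S. v3 x \<noteq> 0} \<union> {x \<in> S. v4 x \<noteq> 0})
      ({y1, y2, y3, y4} \<union> G) (d + 2)"
    by (intro growth_Un) (simp_all add: insert_commute)
  then show ?thesis by (rule growth_subset) (use v in auto)
qed

lemma growth_meeting_three_lines:
  assumes growth: "growth S G d" and vG: "v1 \<in> G" "v2 \<in> G" "v3 \<in> G" "v4 \<in> G"
    and q: "\<And>x. x \<in> S \<Longrightarrow> y1 x * y4 x = y2 x * y3 x"
    and lin: "\<And>x. x \<in> S \<Longrightarrow> v1 x * y4 x + v4 x * y1 x - v2 x * y3 x - v3 x * y2 x = v1 x * v4 x - v2 x * v3 x"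
    and zG: "z1 \<in> G" "z2 \<in> G" "z3 \<in> G" "z4 \<in> G"
    and lin': "\<And>x. x \<in> S \<Longrightarrow> z1 x * y4 x + z4 x * y1 x - z2 x * y3 x - z3 x * y2 x = z1 x * z4 x - z2 x * z3 x"
    and z0: "\<And>x. x \<in> S \<Longrightarrow> \<not> (z1 x = 0 \<and> z2 x = 0 \<and> z3 x = 0 \<and> z4 x = 0)"
    and zv: "\<And>x. x \<in> S \<Longrightarrow> \<not> (z1 x = v1 x \<and> z2 x = v2 x \<and> z3 x = v3 x \<and> z4 x = v4 x)"
    and qv: "\<And>x. x \<in> S \<Longrightarrow> v1 x * v4 x - v2 x * v3 x \<noteq> 0"
  shows "growth S ({y1, y2, y3, y4} \<union> G) (d + 1)"
proof -
  have sub: "growth T G d" if "T \<subseteq> S" for T using growth by (rule growth_subset) (use that in auto)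
  have qv': "v2 x * v3 x - v1 x * v4 x \<noteq> 0" if "x \<in> S" for x using qv[OF that] by auto
  have "growth {x \<in> S. v1 x \<noteq> 0} ({y1, y2, y3, y4} \<union> G) (d + 1)"
    by (rule growth_meeting_three_lines_aux[OF vG _ _ _ sub zG]) (use q lin lin' z0 zv qv in auto)
  moreover have "growth {x \<in> S. v2 x \<noteq> 0} ({y2, y1, y4, y3} \<union> G) (d + 1)"
    by (rule growth_meeting_three_lines_aux[OF vG(2,1,4,3) _ _ _ sub zG(2,1,4,3)])
      (use q lin lin' z0 zv qv' in \<open>auto simp: algebra_simps\<close>)
  ultimately have growth': "growth ({x \<in> S. v1 x \<noteq> 0} \<union> {x \<in> S. v2 x \<noteq> 0}) ({y1, y2, y3, y4} \<union> G) (d + 1)"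
    by (intro growth_Un) (simp_all add: insert_commute)
  \<comment> \<open>Two charts suffice here, because the quadratic form vanishes where both
    \<open>v1\<close> and \<open>v2\<close> do.\<close>
  have "v1 x \<noteq> 0 \<or> v2 x \<noteq> 0" if "x \<in> S" for x using qv[OF that] by auto
  then show ?thesis by (intro growth_subset[OF growth']) auto
qed

section \<open>Laman-sparse graphs\<close>

text \<open>Laman's counts without the prescribed total. Counting induced edges covers all
  subgraphs, and moving 3 to the left avoids truncated subtraction.\<close>

definition laman_sparse :: "'v set \<Rightarrow> 'v set set \<Rightarrow> bool" where
  "laman_sparse V F \<longleftrightarrow> simple_graph V F \<and>
     (\<forall>W\<subseteq>V. card W \<ge> 2 \<longrightarrow> card {e \<in> F. e \<subseteq> W} + 3 \<le> 2 * card W)"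

lemma simple_graph_edge:
  assumes "simple_graph V F" "e \<in> F"
  shows "e \<subseteq> V" "card e = 2"
proof -
  obtain u v where "e = {u, v}" "u \<in> V" "v \<in> V" "u \<noteq> v"
    using assms unfolding simple_graph_def by blast
  then show "e \<subseteq> V" "card e = 2" by simp_all
qed

lemma simple_graph_finite:
  assumes "simple_graph V F"
  shows "finite V" "finite F"
proof -
  show "finite V" using assms by (simp add: simple_graph_def)
  moreover have "F \<subseteq> Pow V" using simple_graph_edge(1)[OF assms] by auto
  ultimately show "finite F" using finite_subset[of F "Pow V"] by simp
qed

lemma simple_graph_subset:
  assumes "simple_graph V F" "W \<subseteq> V" "F' \<subseteq> F" "\<And>e. e \<in> F' \<Longrightarrow> e \<subseteq> W"
  shows "simple_graph W F'"
  unfolding simple_graph_def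
proof (intro conjI subsetI)
  show "finite W" by (rule finite_subset[OF assms(2) simple_graph_finite(1)[OF assms(1)]])
  fix e assume e: "e \<in> F'"
  then have "card e = 2" using simple_graph_edge(2)[OF assms(1)] assms(3) by blast
  with assms(4)[OF e] show "e \<in> {{u, v} |u v. u \<in> W \<and> v \<in> W \<and> u \<noteq> v}"
    unfolding card_2_iff by blast
qed

lemma laman_sparseD:
  assumes "laman_sparse V F"
  shows "simple_graph V F" "W \<subseteq> V \<Longrightarrow> 2 \<le> card W \<Longrightarrow> card {e \<in> F. e \<subseteq> W} + 3 \<le> 2 * card W"
  using assms by (simp_all add: laman_sparse_def)

lemma laman_sparse_subgraph:
  assumes "laman_sparse V F" "W \<subseteq> V" "F' \<subseteq> F" "\<And>e. e \<in> F' \<Longrightarrow> e \<subseteq> W"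
  shows "laman_sparse W F'"
  unfolding laman_sparse_def
proof (intro conjI allI impI)
  show "simple_graph W F'" by (rule simple_graph_subset[OF laman_sparseD(1)[OF assms(1)] assms(2-4)])
  fix U assume U: "U \<subseteq> W" "2 \<le> card U"
  have "card {e \<in> F'. e \<subseteq> U} \<le> card {e \<in> F. e \<subseteq> U}"
  proof (rule card_mono)
    show "finite {e \<in> F. e \<subseteq> U}"
      using simple_graph_finite(2)[OF laman_sparseD(1)[OF assms(1)]] by simp
    show "{e \<in> F'. e \<subseteq> U} \<subseteq> {e \<in> F. e \<subseteq> U}" using assms(3) by blast
  qed
  moreover have "card {e \<in> F. e \<subseteq> U} + 3 \<le> 2 * card U"
    using laman_sparseD(2)[OF assms(1) order_trans[OF U(1) assms(2)] U(2)] .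
  ultimately show "card {e \<in> F'. e \<subseteq> U} + 3 \<le> 2 * card U" by simp
qed

lemma laman_imp_sparse:
  assumes "laman V F"
  shows "laman_sparse V F"
  unfolding laman_sparse_def
proof (intro conjI allI impI)
  show sg: "simple_graph V F" using assms by (simp add: laman_def)
  fix W assume W: "W \<subseteq> V" "2 \<le> card W"
  have "simple_graph W {e \<in> F. e \<subseteq> W}" by (rule simple_graph_subset[OF sg W(1)]) auto
  moreover have "\<forall>V' E'. simple_graph V' E' \<and> V' \<subseteq> V \<and> E' \<subseteq> F \<and> 2 \<le> card V' \<longrightarrow>
      int (card E') \<le> 2 * int (card V') - 3"
    using assms by (simp add: laman_def)
  ultimately have "int (card {e \<in> F. e \<subseteq> W}) \<le> 2 * int (card W) - 3"
    using W by blast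
  then show "card {e \<in> F. e \<subseteq> W} + 3 \<le> 2 * card W" by linarith
qed

lemma laman_sparse_imp_laman:
  assumes sp: "laman_sparse V F" and card: "int (card F) = 2 * int (card V) - 3"
  shows "laman V F"
  unfolding laman_def
proof (intro conjI allI impI)
  show sg: "simple_graph V F" using sp by (simp add: laman_sparse_def)
  show "int (card F) = 2 * int (card V) - 3" by (rule card)
  fix V' E' assume *: "simple_graph V' E' \<and> V' \<subseteq> V \<and> E' \<subseteq> F \<and> 2 \<le> card V'"
  have "E' \<subseteq> {e \<in> F. e \<subseteq> V'}" using * simple_graph_edge(1)[of V' E'] by blast
  then have "card E' \<le> card {e \<in> F. e \<subseteq> V'}"
    using simple_graph_finite(2)[OF sg] by (intro card_mono) auto
  moreover have "card {e \<in> F. e \<subseteq> V'} + 3 \<le> 2 * card V'" using sp * by (simp add: laman_sparse_def)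
  ultimately show "int (card E') \<le> 2 * int (card V') - 3" by linarith
qed

text \<open>The weaker bound also covers vertex sets with at most one element, where
  \<open>F\<close> is empty; it ensures that \<open>4 * card V - card F\<close> never
  truncates.\<close>

lemma laman_sparse_card:
  assumes "laman_sparse V F"
  shows "card F \<le> 2 * card V" "2 \<le> card V \<Longrightarrow> card F + 3 \<le> 2 * card V"
proof -
  have sg: "simple_graph V F" by (rule laman_sparseD(1)[OF assms])
  have eq: "{e \<in> F. e \<subseteq> V} = F" using simple_graph_edge(1)[OF sg] by auto
  show 2: "card F + 3 \<le> 2 * card V" if "2 \<le> card V"
  proof -
    have "card {e \<in> F. e \<subseteq> V} + 3 \<le> 2 * card V" by (rule laman_sparseD(2)[OF assms order_refl that])
    then show ?thesis by (simp only: eq)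
  qed
  show "card F \<le> 2 * card V"
  proof (cases "2 \<le> card V")
    case True
    then show ?thesis using 2 by simp
  next
    case False
    have "F = {}"
    proof (rule ccontr)
      assume "F \<noteq> {}"
      then obtain e where "e \<in> F" by auto
      then have "card e = 2" "e \<subseteq> V" using simple_graph_edge[OF sg] by auto
      then show False using False card_mono[OF simple_graph_finite(1)[OF sg], of e] by simp
    qed
    then show ?thesis by simp
  qed
qed

definition neighbours :: "'v set set \<Rightarrow> 'v \<Rightarrow> 'v set" where
  "neighbours F w = {u. {w, u} \<in> F}"

lemma neighbours_simple_graph:
  assumes "simple_graph V F"
  shows "neighbours F w \<subseteq> V - {w}"
    and "{e \<in> F. w \<in> e} = (\<lambda>u. {w, u}) ` neighbours F w"
    and "card {e \<in> F. w \<in> e} = card (neighbours F w)"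
    and "card F = card {e \<in> F. w \<notin> e} + card (neighbours F w)"
proof -
  show 1: "neighbours F w \<subseteq> V - {w}"
  proof
    fix u assume "u \<in> neighbours F w"
    then have e: "{w, u} \<in> F" by (simp add: neighbours_def)
    then show "u \<in> V - {w}" using simple_graph_edge[OF assms e] by (cases "u = w") auto
  qed
  show 2: "{e \<in> F. w \<in> e} = (\<lambda>u. {w, u}) ` neighbours F w"
  proof
    show "{e \<in> F. w \<in> e} \<subseteq> (\<lambda>u. {w, u}) ` neighbours F w"
    proof
      fix e assume e: "e \<in> {e \<in> F. w \<in> e}"
      then have "card e = 2" using simple_graph_edge(2)[OF assms] by auto
      with e obtain u where "e = {w, u}" unfolding card_2_iff by auto
      then show "e \<in> (\<lambda>u. {w, u}) ` neighbours F w" using e by (auto simp: neighbours_def)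
    qed
  qed (auto simp: neighbours_def)
  have "inj_on (\<lambda>u. {w, u}) (neighbours F w)"
    using 1 by (intro inj_onI) (auto simp: doubleton_eq_iff)
  then show 3: "card {e \<in> F. w \<in> e} = card (neighbours F w)" unfolding 2 by (rule card_image)
  have "F = {e \<in> F. w \<notin> e} \<union> {e \<in> F. w \<in> e}" by auto
  then have "card F = card ({e \<in> F. w \<notin> e} \<union> {e \<in> F. w \<in> e})" by simp
  also have "\<dots> = card {e \<in> F. w \<notin> e} + card {e \<in> F. w \<in> e}"
    using simple_graph_finite(2)[OF assms] by (intro card_Un_disjoint) auto
  finally show "card F = card {e \<in> F. w \<notin> e} + card (neighbours F w)" by (simp only: 3)
qed

text \<open>Double counting of vertices on edges: minimum degree 4 would force at least
  \<open>2 * card V\<close> edges.\<close>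

lemma laman_sparse_low_degree:
  assumes "laman_sparse V F" "V \<noteq> {}"
  shows "\<exists>w\<in>V. card (neighbours F w) \<le> 3"
proof (rule ccontr)
  assume neg: "\<not> (\<exists>w\<in>V. card (neighbours F w) \<le> 3)"
  have deg: "4 \<le> card (neighbours F w)" if w: "w \<in> V" for w
  proof -
    have "\<not> card (neighbours F w) \<le> 3" using neg w by blast
    then show ?thesis by linarith
  qed
  have sg: "simple_graph V F" using assms by (simp add: laman_sparse_def)
  note fin = simple_graph_finite[OF sg]
  have "4 * card V = (\<Sum>w\<in>V. 4)" by simp
  also have "\<dots> \<le> (\<Sum>w\<in>V. card {e \<in> F. w \<in> e})"
    using deg by (intro sum_mono) (simp add: neighbours_simple_graph(3)[OF sg])
  also have "\<dots> = (\<Sum>e\<in>F. card {w \<in> V. w \<in> e})"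
  proof -
    have "card {e \<in> F. w \<in> e} = (\<Sum>e\<in>F. if w \<in> e then 1 else 0)" for w
      unfolding card_eq_sum by (rule sum.inter_filter[OF fin(2)])
    moreover have "card {w \<in> V. w \<in> e} = (\<Sum>w\<in>V. if w \<in> e then 1 else 0)" for e
      unfolding card_eq_sum by (rule sum.inter_filter[OF fin(1)])
    ultimately show ?thesis by (simp only:) (rule sum.swap)
  qed
  also have "\<dots> = (\<Sum>e\<in>F. 2)"
  proof (rule sum.cong)
    fix e assume e: "e \<in> F"
    have "{w \<in> V. w \<in> e} = e" using simple_graph_edge(1)[OF sg e] by auto
    then show "card {w \<in> V. w \<in> e} = 2" using simple_graph_edge(2)[OF sg e] by simp
  qed simp
  finally have 4: "2 * card V \<le> card F" by simp
  have "card V \<noteq> 0" using assms(2) fin(1) by simp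
  show False
  proof (cases "2 \<le> card V")
    case True
    then show ?thesis using 4 laman_sparse_card(2)[OF assms(1)] by simp
  next
    case False
    obtain w where w: "w \<in> V" using assms(2) by auto
    have "card (neighbours F w) \<le> card V"
      using neighbours_simple_graph(1)[OF sg, of w] fin(1) by (intro card_mono) auto
    then show ?thesis using deg[OF w] False by simp
  qed
qed

text \<open>The combinatorial core of the second Henneberg move: if every pair of neighbours of a vertex
  of degree 3 lay in a set of vertices spanning a maximal number of edges, then by supermodularity
  some such set would contain all three neighbours, leaving no room for the edges at \<open>w\<close>.\<close>

lemma laman_sparse_remove_degree_three:
  assumes sp: "laman_sparse V F" and w: "w \<in> V" and N: "neighbours F w = {p, q, r}"
    and distinct: "p \<noteq> q" "p \<noteq> r" "q \<noteq> r"
  shows "\<exists>a b. (a, b) \<in> {(p, q), (q, r), (p, r)} \<and> {a, b} \<notin> {e \<in> F. w \<notin> e} \<and>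
    laman_sparse (V - {w}) (insert {a, b} {e \<in> F. w \<notin> e})"
proof -
  define F0 where "F0 = {e \<in> F. w \<notin> e}"
  define E where "E W = {e \<in> F0. e \<subseteq> W}" for W
  \<comment> \<open>For at least two vertices sparsity turns the inequality into an equality.
    Smaller sets satisfy it too, but they cannot contain two neighbours of \<open>w\<close>.\<close>
  define tight where "tight W \<longleftrightarrow> W \<subseteq> V - {w} \<and> 2 * card W \<le> card (E W) + 3" for W
  have sg: "simple_graph V F" using sp by (simp add: laman_sparse_def)
  have finV: "finite V" and finF: "finite F0"
    using simple_graph_finite[OF sg] by (auto simp: F0_def)
  have finE: "finite (E W)" for W using finF by (simp add: E_def)
  have sp0: "laman_sparse (V - {w}) F0"
  proof (rule laman_sparse_subgraph[OF sp])
    show "e \<subseteq> V - {w}" if "e \<in> F0" for e using that simple_graph_edge(1)[OF sg, of e] unfolding F0_def by blast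
  qed (auto simp: F0_def)
  have bound: "card (E W) + 3 \<le> 2 * card W" if "W \<subseteq> V - {w}" "2 \<le> card W" for W
    unfolding E_def by (rule laman_sparseD(2)[OF sp0 that])
  have NV: "{p, q, r} \<subseteq> V - {w}" using neighbours_simple_graph(1)[OF sg, of w] N by simp
  \<comment> \<open>A pair contained in no tight set may be added as an edge: every vertex set
    containing it has an edge to spare. An existing edge is a tight pair, so the added edge is
    new.\<close>
  have free: "{a, b} \<notin> F0 \<and> laman_sparse (V - {w}) (insert {a, b} F0)"
    if ab: "a \<in> V - {w}" "b \<in> V - {w}" "a \<noteq> b" and no: "\<And>W. a \<in> W \<Longrightarrow> b \<in> W \<Longrightarrow> \<not> tight W" for a b
  proof
    show notin: "{a, b} \<notin> F0"
    proof
      assume "{a, b} \<in> F0"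
      then have "{{a, b}} \<subseteq> E {a, b}" by (auto simp: E_def)
      from card_mono[OF finE this] have "1 \<le> card (E {a, b})" by simp
      then have "tight {a, b}" using ab by (simp add: tight_def)
      then show False using no[of "{a, b}"] by simp
    qed
    show "laman_sparse (V - {w}) (insert {a, b} F0)"
      unfolding laman_sparse_def
    proof (intro conjI allI impI)
      show "simple_graph (V - {w}) (insert {a, b} F0)"
      proof -
        have "{a, b} \<in> {{u, v} |u v. u \<in> V - {w} \<and> v \<in> V - {w} \<and> u \<noteq> v}" using ab by blast
        then show ?thesis using laman_sparseD(1)[OF sp0] unfolding simple_graph_def by simp
      qed
      fix W assume W: "W \<subseteq> V - {w}" "2 \<le> card W"
      show "card {e \<in> insert {a, b} F0. e \<subseteq> W} + 3 \<le> 2 * card W"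
      proof (cases "a \<in> W \<and> b \<in> W")
        case True
        then have "{e \<in> insert {a, b} F0. e \<subseteq> W} = insert {a, b} (E W)" by (auto simp: E_def)
        then have "card {e \<in> insert {a, b} F0. e \<subseteq> W} \<le> Suc (card (E W))"
          using finE[of W] by (simp add: card_insert_if)
        moreover have "\<not> tight W" using no True by simp
        ultimately show ?thesis using W(1) by (simp add: tight_def)
      next
        case False
        then have "{e \<in> insert {a, b} F0. e \<subseteq> W} = E W" by (auto simp: E_def)
        then show ?thesis using bound[OF W] by simp
      qed
    qed
  qed
  \<comment> \<open>Adjoining \<open>w\<close> to such a set would raise the permitted number of
    edges by 2 but bring three edges.\<close>
  have not_all: "\<not> (p \<in> W \<and> q \<in> W \<and> r \<in> W)" if t: "tight W" for W
  proof
    assume in_W: "p \<in> W \<and> q \<in> W \<and> r \<in> W"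
    have W: "W \<subseteq> V - {w}" using t by (simp add: tight_def)
    then have finW: "finite W" using finV by (auto elim: finite_subset)
    let ?S = "(\<lambda>u. {w, u}) ` {p, q, r}"
    have "?S \<subseteq> F" using neighbours_simple_graph(2)[OF sg, of w] N by auto
    then have sub: "E W \<union> ?S \<subseteq> {e \<in> F. e \<subseteq> insert w W}"
      using in_W by (auto simp: E_def F0_def)
    have inj: "inj_on (\<lambda>u. {w, u}) {p, q, r}" using NV by (intro inj_onI) (auto simp: doubleton_eq_iff)
    have "card (E W) + 3 = card (E W) + card ?S"
      using card_image[OF inj] distinct by simp
    also have "\<dots> = card (E W \<union> ?S)"
      using finE by (intro card_Un_disjoint[symmetric]) (auto simp: E_def F0_def)
    also have "\<dots> \<le> card {e \<in> F. e \<subseteq> insert w W}"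
      using simple_graph_finite(2)[OF sg] by (intro card_mono sub) auto
    finally have "card (E W) + 3 + 3 \<le> card {e \<in> F. e \<subseteq> insert w W} + 3" by simp
    also have "\<dots> \<le> 2 * card (insert w W)"
    proof -
      have "card {p, q} \<le> card W" using finW in_W by (intro card_mono) auto
      then have "2 \<le> card (insert w W)" using distinct(1) finW by (simp add: card_insert_if)
      moreover have "insert w W \<subseteq> V" using W w by auto
      ultimately show ?thesis by (intro laman_sparseD(2)[OF sp])
    qed
    also have "card (insert w W) = Suc (card W)" using W finW by (subst card_insert_disjoint) auto
    finally show False using t by (simp add: tight_def)
  qed
  \<comment> \<open>Supermodularity of the number of induced edges; the intersection needs two
    vertices for its own bound.\<close>
  have union: "tight (A \<union> B)" if t: "tight A" "tight B" and "2 \<le> card (A \<inter> B)" for A B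
  proof -
    have AB: "A \<subseteq> V - {w}" "B \<subseteq> V - {w}" using t by (simp_all add: tight_def)
    then have fin: "finite A" "finite B" using finV by (auto elim: finite_subset)
    have "card (E A) + card (E B) = card (E A \<union> E B) + card (E A \<inter> E B)"
      by (rule card_Un_Int[OF finE finE])
    also have "E A \<inter> E B = E (A \<inter> B)" by (auto simp: E_def)
    also have "card (E A \<union> E B) \<le> card (E (A \<union> B))"
      by (intro card_mono finE) (auto simp: E_def)
    finally have "card (E A) + card (E B) \<le> card (E (A \<union> B)) + card (E (A \<inter> B))" by simp
    moreover have "card (E (A \<inter> B)) + 3 \<le> 2 * card (A \<inter> B)" using AB that(3) by (intro bound) auto
    moreover have "card A + card B = card (A \<union> B) + card (A \<inter> B)" by (rule card_Un_Int[OF fin])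
    ultimately show ?thesis using t AB unfolding tight_def by auto
  qed
  show ?thesis
  proof (rule ccontr)
    assume neg: "\<not> ?thesis"
    have tight_pair: "\<exists>W. tight W \<and> a \<in> W \<and> b \<in> W" if "(a, b) \<in> {(p, q), (q, r), (p, r)}" for a b
    proof (rule ccontr)
      assume "\<not> ?thesis"
      then have "{a, b} \<notin> F0 \<and> laman_sparse (V - {w}) (insert {a, b} F0)"
        using that NV distinct by (intro free) auto
      then show False using neg that unfolding F0_def by blast
    qed
    obtain A where A: "tight A" "p \<in> A" "q \<in> A" using tight_pair[of p q] by auto
    obtain B where B: "tight B" "q \<in> B" "r \<in> B" using tight_pair[of q r] by auto
    obtain C where C: "tight C" "p \<in> C" "r \<in> C" using tight_pair[of p r] by auto
    have sub: "A \<subseteq> V - {w}" "B \<subseteq> V - {w}" "C \<subseteq> V - {w}" using A B C by (simp_all add: tight_def)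
    then have fin: "finite A" "finite B" "finite C" using finV by (auto elim: finite_subset)
    \<comment> \<open>Any two of the three tight sets cover all neighbours, so their union is not
      tight and they share fewer than two vertices.\<close>
    have single: "X \<inter> Y = {u}"
      if XY: "tight X" "tight Y" "u \<in> X" "u \<in> Y" "finite X" "p \<in> X \<union> Y" "q \<in> X \<union> Y" "r \<in> X \<union> Y" for X Y u
    proof -
      have "card (X \<inter> Y) < 2"
        using union[OF XY(1,2)] not_all[of "X \<union> Y"] XY(6-8) by (meson not_le)
      moreover have "card (X \<inter> Y) \<noteq> 0" using XY by auto
      ultimately have "card (X \<inter> Y) = 1" by linarith
      then obtain t where t: "X \<inter> Y = {t}" using card_1_singletonE by blast
      have "u \<in> X \<inter> Y" using XY(3,4) by simp
      then show ?thesis unfolding t by simp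
    qed
    have AB: "A \<inter> B = {q}" by (rule single) (use A B fin in simp_all)
    have BC: "B \<inter> C = {r}" by (rule single) (use B C fin in simp_all)
    have AC: "A \<inter> C = {p}" by (rule single) (use A B C fin in simp_all)
    have disj: "E X \<inter> E Y = {}" if "X \<inter> Y = {u}" for X Y u
    proof (rule equals0I)
      fix e assume "e \<in> E X \<inter> E Y"
      then have "e \<subseteq> {u}" "e \<in> F" using that by (auto simp: E_def F0_def)
      then show False using simple_graph_edge(2)[OF sg, of e] card_mono[of "{u}" e] by simp
    qed
    have "card (E A) + card (E B) + card (E C) = card (E A \<union> E B) + card (E C)"
      using card_Un_disjoint[OF finE finE disj[OF AB]] by (simp only:)
    also have "\<dots> = card (E A \<union> E B \<union> E C)"
    proof (rule card_Un_disjoint[symmetric])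
      show "(E A \<union> E B) \<inter> E C = {}" using disj[OF BC] disj[OF AC] by blast
    qed (simp_all add: finE)
    also have "\<dots> \<le> card (E (A \<union> B \<union> C))" by (intro card_mono finE) (auto simp: E_def)
    finally have "card (E A) + card (E B) + card (E C) \<le> card (E (A \<union> B \<union> C))" .
    moreover have "card A + card B = card (A \<union> B) + 1" using card_Un_Int[OF fin(1,2)] AB by simp
    moreover have "card (A \<union> B) + card C = card (A \<union> B \<union> C) + 2"
    proof -
      have "(A \<union> B) \<inter> C = {p, r}" using BC AC by auto
      then show ?thesis using card_Un_Int[of "A \<union> B" C] fin distinct by simp
    qed
    \<comment> \<open>The vertex counts add up to that of the union plus 3, and the edge sets are
      disjoint. The deficits 3 + 3 + 3 therefore shrink by 2 * 3 to the deficit 3 of a tight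
      set.\<close>
    ultimately have "tight (A \<union> B \<union> C)"
      using A(1) B(1) C(1) sub unfolding tight_def by auto
    then show False using not_all[of "A \<union> B \<union> C"] A B by blast
  qed
qed

section \<open>The upper bound\<close>

definition incidence_form :: "(nat \<times> nat \<Rightarrow> complex) \<Rightarrow> nat \<Rightarrow> nat \<Rightarrow> complex" where
  "incidence_form x i j = (x (i, 1) - x (j, 1)) * (x (i, 4) - x (j, 4)) - (x (i, 2) - x (j, 2)) * (x (i, 3) - x (j, 3))"

definition lines_distinct :: "nat set \<Rightarrow> (nat \<times> nat \<Rightarrow> complex) \<Rightarrow> bool" where
  "lines_distinct V x \<longleftrightarrow> (\<forall>i\<in>V. \<forall>j\<in>V. i \<noteq> j \<longrightarrow>
     \<not> (x (i, 1) = x (j, 1) \<and> x (i, 2) = x (j, 2) \<and> x (i, 3) = x (j, 3) \<and> x (i, 4) = x (j, 4)))"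

text \<open>Coordinates outside \<open>V\<close> are unconstrained. Deleting vertices or edges thus
  yields a superset in the same ambient space, and the induction over subgraphs needs no
  projections.\<close>

definition configurations :: "nat set \<Rightarrow> nat set set \<Rightarrow> (nat \<times> nat \<Rightarrow> complex) set" where
  "configurations V F = {x. (\<forall>i j. {i, j} \<in> F \<longrightarrow> incidence_form x i j = 0) \<and> lines_distinct V x}"

definition coordinate_functions :: "nat set \<Rightarrow> ((nat \<times> nat \<Rightarrow> complex) \<Rightarrow> complex) set" where
  "coordinate_functions V = (\<lambda>p x. x p) ` (V \<times> {1..4})"

lemma atLeastAtMost_1_4: "{1..4} = {1, 2, 3, 4 :: nat}"
  by auto

lemma coordinate_functions_insert:
  "coordinate_functions (insert w V) =
    {\<lambda>x. x (w, 1), \<lambda>x. x (w, 2), \<lambda>x. x (w, 3), \<lambda>x. x (w, 4)} \<union> coordinate_functions V"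
  unfolding coordinate_functions_def atLeastAtMost_1_4 by auto

lemma coordinate_in_coordinate_functions:
  assumes "i \<in> V"
  shows "(\<lambda>x. x (i, 1)) \<in> coordinate_functions V" "(\<lambda>x. x (i, 2)) \<in> coordinate_functions V"
    "(\<lambda>x. x (i, 3)) \<in> coordinate_functions V" "(\<lambda>x. x (i, 4)) \<in> coordinate_functions V"
  using assms unfolding coordinate_functions_def by (auto intro!: image_eqI)

section \<open>Adding one line to a configuration, in coordinates relative to a neighbour\<close>

lemma growth_insert_polys:
  assumes "finite H" "\<And>h. h \<in> H \<Longrightarrow> h \<in> polyring G" "growth S G d"
  shows "growth S (H \<union> G) d"
  using assms
proof (induction H rule: finite_induct)
  case (insert h H)
  have "growth S (H \<union> G) d" using insert by simp
  moreover have "h \<in> polyring (H \<union> G)" using insert.prems(1)[of h] by (rule polyring_mono) auto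
  ultimately have "growth S (insert h (H \<union> G)) d"
    by (intro growth_insert_rational[where g = "\<lambda>x. 1" and r = h]) (simp_all add: polyring_const)
  then show ?case by simp
qed simp

definition relative_coordinates ::
  "nat \<Rightarrow> nat \<Rightarrow> ((nat \<times> nat \<Rightarrow> complex) \<Rightarrow> complex) set" where
  "relative_coordinates w u = {\<lambda>x. x (w, 1) - x (u, 1), \<lambda>x. x (w, 2) - x (u, 2),
     \<lambda>x. x (w, 3) - x (u, 3), \<lambda>x. x (w, 4) - x (u, 4)}"

lemma growth_add_relative_coordinates:
  assumes "growth S (coordinate_functions V) d" "u \<in> V" "v \<in> V"
  shows "growth S (relative_coordinates v u \<union> coordinate_functions V) d"
proof (rule growth_insert_polys[OF _ _ assms(1)])
  fix h assume "h \<in> relative_coordinates v u"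
  then show "h \<in> polyring (coordinate_functions V)"
    unfolding relative_coordinates_def
    by (elim insertE emptyE; simp only:; intro polyring_diff polyring_gen coordinate_in_coordinate_functions assms)
qed (simp add: relative_coordinates_def)

lemma growth_recover_coordinates:
  assumes "growth S (relative_coordinates w u \<union> G) d" "coordinate_functions V \<subseteq> G" "u \<in> V"
  shows "growth S (coordinate_functions (insert w V)) d"
proof -
  let ?H = "{\<lambda>x. x (w, 1), \<lambda>x. x (w, 2), \<lambda>x. x (w, 3), \<lambda>x. x (w, 4)} :: ((nat \<times> nat \<Rightarrow> complex) \<Rightarrow> complex) set"
  have "growth S (?H \<union> (relative_coordinates w u \<union> G)) d"
  proof (rule growth_insert_polys[OF _ _ assms(1)])
    fix h assume h: "h \<in> ?H"
    have *: "(\<lambda>x. x (w, k)) \<in> polyring (relative_coordinates w u \<union> G)"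
      if "(\<lambda>x. x (w, k) - x (u, k)) \<in> relative_coordinates w u"
        "(\<lambda>x. x (u, k)) \<in> coordinate_functions V" for k
    proof -
      have "(\<lambda>x. (x (w, k) - x (u, k)) + x (u, k)) \<in> polyring (relative_coordinates w u \<union> G)"
        using that assms(2) by (intro polyring_add polyring_gen) auto
      then show ?thesis by simp
    qed
    from h show "h \<in> polyring (relative_coordinates w u \<union> G)"
      by (elim insertE emptyE; simp only:; intro * coordinate_in_coordinate_functions[OF assms(3)])
        (simp_all add: relative_coordinates_def)
  qed simp
  then show ?thesis
    by (rule growth_subset[OF _ order_refl]) (use assms(2) in \<open>auto simp: coordinate_functions_insert\<close>)
qed

lemma growth_add_line_free:
  assumes "growth S (coordinate_functions V) d"
  shows "growth S (coordinate_functions (insert w V)) (d + 4)"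
  using growth_insert_free[OF growth_insert_free[OF growth_insert_free[OF growth_insert_free[OF assms]]],
      of "\<lambda>x. x (w, 1)" "\<lambda>x. x (w, 2)" "\<lambda>x. x (w, 3)" "\<lambda>x. x (w, 4)"]
  by (simp add: coordinate_functions_insert eval_nat_numeral)

lemma growth_add_line_one:
  assumes "growth S (coordinate_functions V) d" "u \<in> V"
    and "\<And>x. x \<in> S \<Longrightarrow> incidence_form x w u = 0"
  shows "growth S (coordinate_functions (insert w V)) (d + 3)"
proof (rule growth_recover_coordinates[OF _ order_refl assms(2)])
  show "growth S (relative_coordinates w u \<union> coordinate_functions V) (d + 3)"
    unfolding relative_coordinates_def
    by (rule growth_meeting_one_line[OF assms(1)]) (use assms(3) in \<open>auto simp: incidence_form_def\<close>)
qed

text \<open>The parts quadratic in the line \<open>w\<close> agree in both equations, so the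
  difference is linear in \<open>w\<close>: the polarised quadratic form. This supplies the
  hypotheses \<open>lin\<close> and \<open>lin'\<close> of the preceding section.\<close>

lemma incidence_form_linear:
  assumes "incidence_form x w u = 0" "incidence_form x w v = 0"
  shows "(x (v, 1) - x (u, 1)) * (x (w, 4) - x (u, 4)) + (x (v, 4) - x (u, 4)) * (x (w, 1) - x (u, 1))
    - (x (v, 2) - x (u, 2)) * (x (w, 3) - x (u, 3)) - (x (v, 3) - x (u, 3)) * (x (w, 2) - x (u, 2))
    = (x (v, 1) - x (u, 1)) * (x (v, 4) - x (u, 4)) - (x (v, 2) - x (u, 2)) * (x (v, 3) - x (u, 3))"
  using assms unfolding incidence_form_def by algebra

lemma growth_add_line_two:
  assumes "growth S (coordinate_functions V) d" "u \<in> V" "v \<in> V" "u \<noteq> v"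
    and "\<And>x. x \<in> S \<Longrightarrow> incidence_form x w u = 0" "\<And>x. x \<in> S \<Longrightarrow> incidence_form x w v = 0"
    and "\<And>x. x \<in> S \<Longrightarrow> lines_distinct V x"
  shows "growth S (coordinate_functions (insert w V)) (d + 2)"
proof (rule growth_recover_coordinates[where G = "relative_coordinates v u \<union> coordinate_functions V", OF _ _ assms(2)])
  have "growth S ({\<lambda>x. x (w, 1) - x (u, 1), \<lambda>x. x (w, 2) - x (u, 2), \<lambda>x. x (w, 3) - x (u, 3), \<lambda>x. x (w, 4) - x (u, 4)}
     \<union> (relative_coordinates v u \<union> coordinate_functions V)) (d + 2)"
  proof (rule growth_meeting_two_lines[OF growth_add_relative_coordinates[OF assms(1-3)],
        where ?v1.0 = "\<lambda>x. x (v, 1) - x (u, 1)" and ?v2.0 = "\<lambda>x. x (v, 2) - x (u, 2)"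
        and ?v3.0 = "\<lambda>x. x (v, 3) - x (u, 3)" and ?v4.0 = "\<lambda>x. x (v, 4) - x (u, 4)"])
    fix x assume x: "x \<in> S"
    note inc = assms(5)[OF x] assms(6)[OF x]
    show "(x (w, 1) - x (u, 1)) * (x (w, 4) - x (u, 4)) = (x (w, 2) - x (u, 2)) * (x (w, 3) - x (u, 3))"
      using inc(1) by (simp add: incidence_form_def)
    show "(x (v, 1) - x (u, 1)) * (x (w, 4) - x (u, 4)) + (x (v, 4) - x (u, 4)) * (x (w, 1) - x (u, 1))
      - (x (v, 2) - x (u, 2)) * (x (w, 3) - x (u, 3)) - (x (v, 3) - x (u, 3)) * (x (w, 2) - x (u, 2))
      = (x (v, 1) - x (u, 1)) * (x (v, 4) - x (u, 4)) - (x (v, 2) - x (u, 2)) * (x (v, 3) - x (u, 3))"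
      by (rule incidence_form_linear[OF inc])
    show "\<not> (x (v, 1) - x (u, 1) = 0 \<and> x (v, 2) - x (u, 2) = 0 \<and> x (v, 3) - x (u, 3) = 0 \<and> x (v, 4) - x (u, 4) = 0)"
      using assms(7)[OF x] assms(2-4) unfolding lines_distinct_def by auto
  qed (simp_all add: relative_coordinates_def)
  then show "growth S (relative_coordinates w u \<union> (relative_coordinates v u \<union> coordinate_functions V)) (d + 2)"
    by (simp only: relative_coordinates_def[of w u])
qed simp

lemma growth_add_line_three:
  assumes "growth S (coordinate_functions V) d" "u \<in> V" "v \<in> V" "z \<in> V" "u \<noteq> z" "v \<noteq> z"
    and "\<And>x. x \<in> S \<Longrightarrow> incidence_form x w u = 0" "\<And>x. x \<in> S \<Longrightarrow> incidence_form x w v = 0"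
      "\<And>x. x \<in> S \<Longrightarrow> incidence_form x w z = 0"
    and "\<And>x. x \<in> S \<Longrightarrow> lines_distinct V x" "\<And>x. x \<in> S \<Longrightarrow> incidence_form x v u \<noteq> 0"
  shows "growth S (coordinate_functions (insert w V)) (d + 1)"
proof (rule growth_recover_coordinates[where G = "relative_coordinates z u \<union> (relative_coordinates v u \<union> coordinate_functions V)",
      OF _ _ assms(2)])
  have 1: "growth S (relative_coordinates z u \<union> (relative_coordinates v u \<union> coordinate_functions V)) d"
  proof (rule growth_insert_polys[OF _ _ growth_add_relative_coordinates[OF assms(1-3)]])
    fix h assume "h \<in> relative_coordinates z u"
    then show "h \<in> polyring (relative_coordinates v u \<union> coordinate_functions V)"
      unfolding relative_coordinates_def[of z u]
      by (elim insertE emptyE; simp only:; intro polyring_diff polyring_gen UnI2 coordinate_in_coordinate_functions assms)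
  qed (simp add: relative_coordinates_def)
  have "growth S ({\<lambda>x. x (w, 1) - x (u, 1), \<lambda>x. x (w, 2) - x (u, 2), \<lambda>x. x (w, 3) - x (u, 3), \<lambda>x. x (w, 4) - x (u, 4)}
     \<union> (relative_coordinates z u \<union> (relative_coordinates v u \<union> coordinate_functions V))) (d + 1)"
  proof (rule growth_meeting_three_lines[OF 1,
        where ?v1.0 = "\<lambda>x. x (v, 1) - x (u, 1)" and ?v2.0 = "\<lambda>x. x (v, 2) - x (u, 2)"
        and ?v3.0 = "\<lambda>x. x (v, 3) - x (u, 3)" and ?v4.0 = "\<lambda>x. x (v, 4) - x (u, 4)"
        and ?z1.0 = "\<lambda>x. x (z, 1) - x (u, 1)" and ?z2.0 = "\<lambda>x. x (z, 2) - x (u, 2)"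
        and ?z3.0 = "\<lambda>x. x (z, 3) - x (u, 3)" and ?z4.0 = "\<lambda>x. x (z, 4) - x (u, 4)"])
    fix x assume x: "x \<in> S"
    note inc = assms(7)[OF x] assms(8)[OF x] assms(9)[OF x]
    show "(x (w, 1) - x (u, 1)) * (x (w, 4) - x (u, 4)) = (x (w, 2) - x (u, 2)) * (x (w, 3) - x (u, 3))"
      using inc(1) by (simp add: incidence_form_def)
    show "(x (v, 1) - x (u, 1)) * (x (w, 4) - x (u, 4)) + (x (v, 4) - x (u, 4)) * (x (w, 1) - x (u, 1))
      - (x (v, 2) - x (u, 2)) * (x (w, 3) - x (u, 3)) - (x (v, 3) - x (u, 3)) * (x (w, 2) - x (u, 2))
      = (x (v, 1) - x (u, 1)) * (x (v, 4) - x (u, 4)) - (x (v, 2) - x (u, 2)) * (x (v, 3) - x (u, 3))"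
      by (rule incidence_form_linear[OF inc(1,2)])
    show "(x (z, 1) - x (u, 1)) * (x (w, 4) - x (u, 4)) + (x (z, 4) - x (u, 4)) * (x (w, 1) - x (u, 1))
      - (x (z, 2) - x (u, 2)) * (x (w, 3) - x (u, 3)) - (x (z, 3) - x (u, 3)) * (x (w, 2) - x (u, 2))
      = (x (z, 1) - x (u, 1)) * (x (z, 4) - x (u, 4)) - (x (z, 2) - x (u, 2)) * (x (z, 3) - x (u, 3))"
      by (rule incidence_form_linear[OF inc(1,3)])
    show "\<not> (x (z, 1) - x (u, 1) = 0 \<and> x (z, 2) - x (u, 2) = 0 \<and> x (z, 3) - x (u, 3) = 0 \<and> x (z, 4) - x (u, 4) = 0)"
      using assms(10)[OF x] assms(2,4,5) unfolding lines_distinct_def by auto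
    show "\<not> (x (z, 1) - x (u, 1) = x (v, 1) - x (u, 1) \<and> x (z, 2) - x (u, 2) = x (v, 2) - x (u, 2) \<and>
        x (z, 3) - x (u, 3) = x (v, 3) - x (u, 3) \<and> x (z, 4) - x (u, 4) = x (v, 4) - x (u, 4))"
      using assms(10)[OF x] assms(3,4,6) unfolding lines_distinct_def by auto
    show "(x (v, 1) - x (u, 1)) * (x (v, 4) - x (u, 4)) - (x (v, 2) - x (u, 2)) * (x (v, 3) - x (u, 3)) \<noteq> 0"
      using assms(11)[OF x] by (simp add: incidence_form_def)
  qed (simp_all add: relative_coordinates_def)
  then show "growth S (relative_coordinates w u \<union>
      (relative_coordinates z u \<union> (relative_coordinates v u \<union> coordinate_functions V))) (d + 1)"
    by (simp only: relative_coordinates_def[of w u])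
qed auto

lemma incidence_form_commute: "incidence_form x i j = incidence_form x j i"
  unfolding incidence_form_def by (simp add: algebra_simps)

lemma lines_distinct_subset: "lines_distinct V x \<Longrightarrow> W \<subseteq> V \<Longrightarrow> lines_distinct W x"
  unfolding lines_distinct_def by blast

lemma configurations_subset:
  assumes "W \<subseteq> V" "F' \<subseteq> F"
  shows "configurations V F \<subseteq> configurations W F'"
  using assms lines_distinct_subset unfolding configurations_def by blast

lemma growth_configurations:
  assumes "laman_sparse V F" "d + card F = 4 * card V"
  shows "growth (configurations V F) (coordinate_functions V) d"
  using assms
proof (induction "card V" arbitrary: V F d)
  case 0
  have sg: "simple_graph V F" using "0.prems"(1) by (rule laman_sparseD(1))
  have V: "V = {}" using 0(1) simple_graph_finite(1)[OF sg] by simp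
  have "d = 0" using "0.prems"(2) V by simp
  moreover have "coordinate_functions V = {}" by (simp add: V coordinate_functions_def)
  ultimately show ?case using growth_no_generators by simp
next
  case (Suc k)
  have sg: "simple_graph V F" using Suc.prems(1) by (rule laman_sparseD(1))
  note fin = simple_graph_finite[OF sg]
  have "V \<noteq> {}" using Suc.hyps(2) by auto
  then obtain w where w: "w \<in> V" and deg: "card (neighbours F w) \<le> 3"
    using laman_sparse_low_degree[OF Suc.prems(1)] by blast
  define V0 where "V0 = V - {w}"
  define F0 where "F0 = {e \<in> F. w \<notin> e}"
  define N where "N = neighbours F w"
  let ?S = "configurations V F"
  have V: "V = insert w V0" using w by (auto simp: V0_def)
  have cardV0: "card V0 = k" using Suc.hyps(2) w fin(1) by (simp add: V0_def)
  have NV: "N \<subseteq> V0" using neighbours_simple_graph(1)[OF sg] by (simp add: N_def V0_def)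
  have cardF: "card F = card F0 + card N"
    unfolding F0_def N_def by (rule neighbours_simple_graph(4)[OF sg])
  have sp0: "laman_sparse V0 F0"
  proof (rule laman_sparse_subgraph[OF Suc.prems(1)])
    show "e \<subseteq> V0" if "e \<in> F0" for e
      using that simple_graph_edge(1)[OF sg, of e] unfolding F0_def V0_def by blast
  qed (auto simp: F0_def V0_def)
  define d0 where "d0 = 4 * card V0 - card F0"
  have d0: "d0 + card F0 = 4 * card V0"
    using laman_sparse_card(1)[OF sp0] by (simp add: d0_def)
  have d: "d + card N = d0 + 4"
    using d0 Suc.prems(2) Suc.hyps(2) cardF cardV0 by simp
  have g0: "growth T (coordinate_functions V0) d0" if "T \<subseteq> ?S" for T
  proof (rule growth_subset[OF Suc.hyps(1)[OF cardV0[symmetric] sp0 d0] _ order_refl])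
    have "?S \<subseteq> configurations V0 F0" by (rule configurations_subset) (auto simp: V0_def F0_def)
    with that show "T \<subseteq> configurations V0 F0" by blast
  qed
  have inc: "incidence_form x w u = 0" if "x \<in> ?S" "u \<in> N" for x u
    using that by (simp add: configurations_def N_def neighbours_def)
  have dist: "lines_distinct V0 x" if "x \<in> ?S" for x
    using that lines_distinct_subset[of V x V0] by (auto simp: configurations_def V0_def)
  have "card N \<le> 3" using deg by (simp add: N_def)
  then consider "card N = 0" | "card N = 1" | "card N = 2" | "card N = 3" by linarith
  then show ?case
  proof cases
    case 1
    then have "d = d0 + 4" using d by simp
    then show ?thesis unfolding V using growth_add_line_free[OF g0[OF order_refl]] by (simp add: V)
  next
    case 2
    then obtain u where u: "N = {u}" using card_1_singletonE by blast
    have "d = d0 + 3" using d 2 by simp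
    moreover have "growth ?S (coordinate_functions (insert w V0)) (d0 + 3)"
      by (rule growth_add_line_one[OF g0[OF order_refl], of u]) (use NV u inc in auto)
    ultimately show ?thesis by (simp add: V)
  next
    case 3
    then obtain u v where uv: "N = {u, v}" "u \<noteq> v" unfolding card_2_iff by blast
    have "d = d0 + 2" using d 3 by simp
    moreover have "growth ?S (coordinate_functions (insert w V0)) (d0 + 2)"
      by (rule growth_add_line_two[OF g0[OF order_refl], of u v]) (use NV uv inc dist in auto)
    ultimately show ?thesis by (simp add: V)
  next
    case 4
    then obtain p q r where N3: "N = {p, q, r}" and distinct: "p \<noteq> q" "p \<noteq> r" "q \<noteq> r"
      unfolding card_3_iff by blast
    have deq: "d = d0 + 1" using d 4 by simp
    have three: "growth {x \<in> ?S. incidence_form x b a \<noteq> 0} (coordinate_functions V) d"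
      if "N = {a, b, c}" "a \<noteq> c" "b \<noteq> c" for a b c
    proof -
      have "growth {x \<in> ?S. incidence_form x b a \<noteq> 0} (coordinate_functions (insert w V0)) (d0 + 1)"
        by (rule growth_add_line_three[OF g0, of _ a b c]) (use NV that inc dist in auto)
      then show ?thesis by (simp add: V deq)
    qed
    have pq: "growth {x \<in> ?S. incidence_form x q p \<noteq> 0} (coordinate_functions V) d"
      by (rule three[of p q r]) (use N3 distinct in auto)
    have qr: "growth {x \<in> ?S. incidence_form x r q \<noteq> 0} (coordinate_functions V) d"
      by (rule three[of q r p]) (use N3 distinct in auto)
    have pr: "growth {x \<in> ?S. incidence_form x r p \<noteq> 0} (coordinate_functions V) d"
      by (rule three[of p r q]) (use N3 distinct in auto)
    \<comment> \<open>The exceptional stratum: if the three neighbours are concurrent, all lines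
      through their common point meet them, a family of dimension 2. All three incidences hold, so
      whichever pair the Henneberg move selects is realised as an edge.\<close>
    define T where "T = {x \<in> ?S. incidence_form x q p = 0 \<and> incidence_form x r q = 0 \<and> incidence_form x r p = 0}"
    obtain a b where ab: "(a, b) \<in> {(p, q), (q, r), (p, r)}" "{a, b} \<notin> F0" "laman_sparse V0 (insert {a, b} F0)"
      using laman_sparse_remove_degree_three[OF Suc.prems(1) w, of p q r] N3 distinct
      unfolding N_def F0_def V0_def by blast
    have all: "growth T (coordinate_functions V) d"
    proof -
      define d1 where "d1 = 4 * card V0 - card (insert {a, b} F0)"
      have finF0: "finite F0" using fin(2) by (simp add: F0_def)
      have d1: "d1 + card (insert {a, b} F0) = 4 * card V0"
        using laman_sparse_card(1)[OF ab(3)] by (simp add: d1_def)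
      have "d0 = d1 + 1" using d0 d1 ab(2) finF0 by simp
      have "T \<subseteq> configurations V0 (insert {a, b} F0)"
      proof
        fix x assume x: "x \<in> T"
        have "incidence_form x i j = 0" if "{i, j} = {a, b}" for i j
          using that x ab(1) incidence_form_commute[of x] by (auto simp: T_def doubleton_eq_iff)
        moreover have "incidence_form x i j = 0" if "{i, j} \<in> F0" for i j
          using that x by (auto simp: T_def F0_def configurations_def)
        moreover have "lines_distinct V0 x" using dist x by (simp add: T_def)
        ultimately show "x \<in> configurations V0 (insert {a, b} F0)" by (simp add: configurations_def)
      qed
      from growth_subset[OF Suc.hyps(1)[OF cardV0[symmetric] ab(3) d1] this order_refl]
      have "growth T (coordinate_functions V0) d1" .
      \<comment> \<open>The line \<open>w\<close> contributes 2 instead of 1, and the added edge has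
        lowered the bound for the other lines by 1: \<open>d1 + 2 = d0 + 1\<close>.\<close>
      then have "growth T (coordinate_functions (insert w V0)) (d1 + 2)"
        by (rule growth_add_line_two[of _ _ _ p q]) (use NV N3 distinct inc dist in \<open>auto simp: T_def\<close>)
      then show ?thesis using \<open>d0 = d1 + 1\<close> by (simp add: V deq)
    qed
    show ?thesis
      by (rule growth_subset[OF growth_Un[OF growth_Un[OF pq qr] growth_Un[OF pr all]] _ order_refl]) (auto simp: T_def)
  qed
qed

section \<open>The lower bound\<close>

lemma incident_iff_incidence_form:
  "incident (nth_line x i) (nth_line x j) \<longleftrightarrow> incidence_form x i j = 0"
  by (simp add: nth_line_def incident_iff incidence_form_def)

lemma lines_distinct_iff: "lines_distinct V x \<longleftrightarrow> inj_on (\<lambda>i. line (nth_line x i)) V"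
  unfolding lines_distinct_def inj_on_def line_eq_iff nth_line_def by auto

lemma X_hat_iff:
  assumes "simple_graph {1..n} E"
  shows "x \<in> X_hat n E \<longleftrightarrow> x \<in> extensional (coords n) \<and> x \<in> configurations {1..n} E"
proof -
  have "E \<subseteq> intersection_graph n x \<longleftrightarrow> (\<forall>i j. {i, j} \<in> E \<longrightarrow> incidence_form x i j = 0)"
  proof
    assume sub: "E \<subseteq> intersection_graph n x"
    show "\<forall>i j. {i, j} \<in> E \<longrightarrow> incidence_form x i j = 0"
    proof (intro allI impI)
      fix i j assume "{i, j} \<in> E"
      then have "{i, j} \<in> intersection_graph n x" using sub by (rule rev_subsetD)
      then obtain i' j' where "{i, j} = {i', j'}" "incidence_form x i' j' = 0"
        unfolding intersection_graph_def incident_iff_incidence_form by blast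
      then show "incidence_form x i j = 0"
        using incidence_form_commute[of x] by (auto simp: doubleton_eq_iff)
    qed
  next
    assume inc: "\<forall>i j. {i, j} \<in> E \<longrightarrow> incidence_form x i j = 0"
    show "E \<subseteq> intersection_graph n x"
    proof
      fix e assume e: "e \<in> E"
      then obtain i j where "e = {i, j}" "i \<in> {1..n}" "j \<in> {1..n}" "i \<noteq> j"
        using assms unfolding simple_graph_def by blast
      then show "e \<in> intersection_graph n x"
        using e inc unfolding intersection_graph_def incident_iff_incidence_form by blast
    qed
  qed
  then show ?thesis unfolding X_hat_def configurations_def lines_distinct_iff by simp
qed

lemma krull_dim_X_var_le:
  assumes sg: "simple_graph {1..n} E" and F: "F \<subseteq> E" "laman_sparse {1..n} F" "d + card F = 4 * n"
  shows "krull_dim (subtopology (zariski (coords n)) (X_var n E)) \<le> enat d"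
  unfolding X_var_def
proof (rule krull_dim_closure_le)
  show "X_hat n E \<subseteq> extensional (coords n)" using X_hat_iff[OF sg] by blast
  have "growth (configurations {1..n} F) (coordinate_functions {1..n}) d"
    by (rule growth_configurations[OF F(2)]) (use F(3) in simp)
  moreover have "X_hat n E \<subseteq> configurations {1..n} F"
    using X_hat_iff[OF sg] configurations_subset[OF order_refl F(1)] by blast
  ultimately show "growth (X_hat n E) ((\<lambda>i x. x i) ` coords n) d"
    unfolding coordinate_functions_def coords_def by (rule growth_subset) simp
qed

text \<open>Polynomials cutting out \<open>A\<close> and \<open>B\<close> pull back to polynomial
  functions on the parameter space. If neither set contained the image, two nonzero pullbacks would
  be nonzero at a common point, whose image would lie outside both sets.\<close>

lemma irreducible_closure_range:
  assumes ext: "\<And>y. \<theta> y \<in> extensional I" and poly: "\<And>i. i \<in> I \<Longrightarrow> (\<lambda>y. \<theta> y i) \<in> poly_functions J"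
  shows "irreducible_in (zariski I) (zariski I closure_of range \<theta>)"
  unfolding irreducible_in_def
proof (intro conjI allI impI)
  have sub: "range \<theta> \<subseteq> zariski I closure_of range \<theta>"
    by (rule closure_of_subset) (use ext in \<open>auto simp: topspace_zariski\<close>)
  then show "zariski I closure_of range \<theta> \<noteq> {}" by auto
  show "zariski I closure_of range \<theta> \<subseteq> topspace (zariski I)" by (rule closure_of_subset_topspace)
  fix A B assume AB: "closedin (zariski I) A \<and> closedin (zariski I) B \<and> zariski I closure_of range \<theta> \<subseteq> A \<union> B"
  obtain F G where F: "F \<subseteq> poly_functions I" "A = zero_locus I F" and G: "G \<subseteq> poly_functions I" "B = zero_locus I G"
    using AB unfolding closedin_zariski by blast
  have "range \<theta> \<subseteq> A \<or> range \<theta> \<subseteq> B"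
  proof (rule ccontr)
    assume "\<not> ?thesis"
    then obtain y z where "\<theta> y \<notin> A" "\<theta> z \<notin> B" by blast
    then obtain f g where f: "f \<in> F" "f (\<theta> y) \<noteq> 0" and g: "g \<in> G" "g (\<theta> z) \<noteq> 0"
      using ext[of y] ext[of z] unfolding F(2) G(2) zero_locus_def by blast
    have f\<theta>: "(\<lambda>y. f (\<theta> y)) \<in> poly_functions J"
      by (rule poly_functions_comp[OF subsetD[OF F(1) f(1)] poly])
    have g\<theta>: "(\<lambda>y. g (\<theta> y)) \<in> poly_functions J"
      by (rule poly_functions_comp[OF subsetD[OF G(1) g(1)] poly])
    from poly_functions_no_zero_divisors[OF f\<theta> g\<theta>, of y z] f(2) g(2)
    obtain t where t: "f (\<theta> t) \<noteq> 0" "g (\<theta> t) \<noteq> 0" by auto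
    have "\<theta> t \<in> A \<union> B" using AB sub by blast
    then show False using t f(1) g(1) unfolding F(2) G(2) zero_locus_def by blast
  qed
  then show "zariski I closure_of range \<theta> \<subseteq> A \<or> zariski I closure_of range \<theta> \<subseteq> B"
    using AB closure_of_minimal[of "range \<theta>" A "zariski I"] closure_of_minimal[of "range \<theta>" B "zariski I"]
    by blast
qed

text \<open>For fixed directions \<open>(c, d)\<close> incidence is linear in the base points \<open>(a, b)\<close>; the following are
  the coefficients of the equation of the edge \<open>e\<close>.\<close>

fun incidence_row :: "nat set \<Rightarrow> nat \<times> nat \<Rightarrow> (nat \<times> nat \<Rightarrow> complex) \<Rightarrow> complex" where
  "incidence_row e (i, m) x = (if i \<in> e then
     (if m = 1 then (\<Sum>l\<in>e. x (i, 4) - x (l, 4)) else (\<Sum>l\<in>e. x (l, 3) - x (i, 3))) else 0)"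

lemma incidence_row_poly:
  assumes "finite V" "e \<subseteq> V" "k \<in> V \<times> {1, 2}"
  shows "incidence_row e k \<in> poly_functions (V \<times> {3, 4})"
proof -
  obtain i m where k: "k = (i, m)" by (cases k)
  have "finite e" using finite_subset[OF assms(2,1)] .
  have i: "i \<in> V" using assms(3) k by auto
  have 1: "(\<lambda>x. \<Sum>l\<in>e. x (i, 4) - x (l, 4)) \<in> poly_functions (V \<times> {3, 4 :: nat})"
    using assms(2) i by (intro poly_functions_sum[OF \<open>finite e\<close>] poly_functions_diff poly_functions.coord) auto
  have 2: "(\<lambda>x. \<Sum>l\<in>e. x (l, 3) - x (i, 3)) \<in> poly_functions (V \<times> {3, 4 :: nat})"
    using assms(2) i by (intro poly_functions_sum[OF \<open>finite e\<close>] poly_functions_diff poly_functions.coord) auto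
  have "incidence_row e k = (if i \<in> e then if m = 1 then (\<lambda>x. \<Sum>l\<in>e. x (i, 4) - x (l, 4))
      else (\<lambda>x. \<Sum>l\<in>e. x (l, 3) - x (i, 3)) else (\<lambda>x. 0))"
    by (rule ext) (simp add: k)
  then show ?thesis using 1 2 poly_functions.const[of 0 "V \<times> {3, 4 :: nat}"] by simp
qed

lemma incidence_row_sum:
  assumes "finite V" "i \<in> V" "j \<in> V" "i \<noteq> j"
  shows "(\<Sum>k\<in>V \<times> {1, 2}. incidence_row {i, j} k x * y k) =
    (y (i, 1) - y (j, 1)) * (x (i, 4) - x (j, 4)) - (y (i, 2) - y (j, 2)) * (x (i, 3) - x (j, 3))"
proof -
  have "(\<Sum>k\<in>V \<times> {1, 2}. incidence_row {i, j} k x * y k) =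
      (\<Sum>k\<in>{i, j} \<times> {1, 2}. incidence_row {i, j} k x * y k)"
    using assms by (intro sum.mono_neutral_right) (auto split: if_splits)
  also have "{i, j} \<times> {1, 2} = {(i, 1), (i, 2), (j, 1), (j, 2 :: nat)}" by auto
  \<comment> \<open>In \<open>incidence_row\<close> the summand for the vertex itself is zero, so
    each entry is a single difference with the other endpoint.\<close>
  also have "(\<Sum>k\<in>{(i, 1), (i, 2), (j, 1), (j, 2)}. incidence_row {i, j} k x * y k) =
    (y (i, 1) - y (j, 1)) * (x (i, 4) - x (j, 4)) - (y (i, 2) - y (j, 2)) * (x (i, 3) - x (j, 3))"
    using assms(4) by (simp add: algebra_simps)
  finally show ?thesis .
qed

text \<open>The rows of the edges within \<open>V\<close> are orthogonal to the two translations and to the dilation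
  of the point configuration \<open>(c, d)\<close>, so independent rows satisfy Laman's counts.\<close>

lemma independent_rows_bound:
  assumes sg: "simple_graph V F" and V: "2 \<le> card V" "u \<in> V" "v \<in> V" "x (u, 3) \<noteq> x (v, 3)"
    and ind: "\<And>l. (\<And>k. k \<in> V \<times> {1, 2} \<Longrightarrow> (\<Sum>e\<in>F. l e * incidence_row e k x) = 0) \<Longrightarrow> \<forall>e\<in>F. l e = 0"
  shows "card F + 3 \<le> 2 * card V"
proof (rule ccontr)
  assume neg: "\<not> card F + 3 \<le> 2 * card V"
  note fin = simple_graph_finite[OF sg]
  have uv: "u \<noteq> v" using V(4) by auto
  \<comment> \<open>One column is dropped for each of the three orthogonal vectors. If there are
    more than \<open>2 * card V - 3\<close> rows, some nontrivial combination \<open>c\<close> of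
    them is supported on \<open>?T\<close>, and orthogonality makes it vanish there as well.\<close>
  let ?T = "{(u, 1), (v, 1), (u, 2)} :: (nat \<times> nat) set"
  define K' where "K' = V \<times> {1, 2 :: nat} - ?T"
  have T: "?T \<subseteq> V \<times> {1, 2}" using V(2,3) by auto
  have "card K' = card (V \<times> {1, 2 :: nat}) - card ?T"
    unfolding K'_def using T by (intro card_Diff_subset) auto
  also have "\<dots> = 2 * card V - 3" using uv by (simp add: card_cartesian_product)
  finally have "card K' < card F" using neg V(1) by simp
  moreover have "finite K'" using fin(1) by (simp add: K'_def)
  ultimately obtain l where l: "\<exists>e\<in>F. l e \<noteq> 0" "\<forall>k\<in>K'. (\<Sum>e\<in>F. incidence_row e k x * l e) = 0"
    using underdetermined_system[of K' F "\<lambda>k e. incidence_row e k x"] fin(2) by blast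
  define c where "c k = (\<Sum>e\<in>F. l e * incidence_row e k x)" for k
  have c0: "c k = 0" if "k \<in> K'" for k using l(2) that by (simp add: c_def mult.commute)
  have orth: "c (u, 1) * y (u, 1) + c (v, 1) * y (v, 1) + c (u, 2) * y (u, 2) = 0"
    if y: "\<And>i j. (y (i, 1) - y (j, 1)) * (x (i, 4) - x (j, 4)) - (y (i, 2) - y (j, 2)) * (x (i, 3) - x (j, 3)) = 0"
    for y :: "nat \<times> nat \<Rightarrow> complex"
  proof -
    have "(\<Sum>k\<in>V \<times> {1, 2}. c k * y k) = (\<Sum>k\<in>V \<times> {1, 2}. \<Sum>e\<in>F. l e * (incidence_row e k x * y k))"
      by (simp add: c_def sum_distrib_right mult.assoc)
    also have "\<dots> = (\<Sum>e\<in>F. \<Sum>k\<in>V \<times> {1, 2}. l e * (incidence_row e k x * y k))" by (rule sum.swap)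
    also have "\<dots> = (\<Sum>e\<in>F. l e * (\<Sum>k\<in>V \<times> {1, 2}. incidence_row e k x * y k))"
      by (simp add: sum_distrib_left)
    also have "\<dots> = 0"
    proof (rule sum.neutral, rule ballI)
      fix e assume "e \<in> F"
      then obtain i j where "e = {i, j}" "i \<in> V" "j \<in> V" "i \<noteq> j"
        using sg unfolding simple_graph_def by blast
      then show "l e * (\<Sum>k\<in>V \<times> {1, 2}. incidence_row e k x * y k) = 0"
        using incidence_row_sum[OF fin(1), of i j x y] y[of i j] by simp
    qed
    finally have "0 = (\<Sum>k\<in>V \<times> {1, 2}. c k * y k)" by simp
    also have "\<dots> = (\<Sum>k\<in>?T. c k * y k)"
      using fin(1) T c0 by (intro sum.mono_neutral_right) (auto simp: K'_def)
    also have "\<dots> = c (u, 1) * y (u, 1) + c (v, 1) * y (v, 1) + c (u, 2) * y (u, 2)"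
      using uv by simp
    finally show ?thesis by simp
  qed
  \<comment> \<open>The test vectors are the translation of \<open>b\<close>, the translation of
    \<open>a\<close>, and the point configuration \<open>(c, d)\<close> inserted for
    \<open>(a, b)\<close>. Restricted to \<open>?T\<close> they are independent because
    \<open>x (u, 3)\<close> and \<open>x (v, 3)\<close> differ.\<close>
  have 1: "c (u, 2) = 0" using orth[of "\<lambda>(i, m). if m = 1 then 0 else 1"] by simp
  have 2: "c (u, 1) + c (v, 1) = 0" using orth[of "\<lambda>(i, m). if m = 1 then 1 else 0"] by simp
  have 3: "c (u, 1) * x (u, 3) + c (v, 1) * x (v, 3) = 0"
    using orth[of "\<lambda>(i, m). if m = 1 then x (i, 3) else x (i, 4)"] 1 by simp
  have "c (u, 1) * (x (u, 3) - x (v, 3)) = 0" using 2 3 by algebra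
  then have 4: "c (u, 1) = 0" "c (v, 1) = 0" using V(4) 2 by simp_all
  have "c k = 0" if "k \<in> V \<times> {1, 2}" for k
    using c0[of k] 1 4 that unfolding K'_def by blast
  then have "\<forall>e\<in>F. l e = 0" unfolding c_def by (intro ind)
  then show False using l(1) by blast
qed

lemma krull_dim_X_var_ge:
  assumes sg: "simple_graph {1..n} E"
  shows "\<exists>F\<subseteq>E. laman_sparse {1..n} F \<and>
    enat (4 * n - card F) \<le> krull_dim (subtopology (zariski (coords n)) (X_var n E))"
proof -
  let ?V = "{1..n}"
  define P where "P = ?V \<times> {3, 4 :: nat}"
  define K where "K = ?V \<times> {1, 2 :: nat}"
  have fin: "finite P" "finite K" by (simp_all add: P_def K_def)
  have PK: "P \<inter> K = {}" "coords n = P \<union> K" by (auto simp: P_def K_def coords_def)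
  have rows: "\<forall>e\<in>E. \<forall>k\<in>K. incidence_row e k \<in> poly_functions P"
    using simple_graph_edge(1)[OF sg] unfolding P_def K_def by (intro ballI incidence_row_poly) auto
  from fraction_free_elimination[OF simple_graph_finite(2)[OF sg] fin(2) rows]
  obtain F B D w y0 where F: "F \<subseteq> E" and B: "B \<subseteq> K" and card: "card B + card F = card K"
    and D: "D \<in> poly_functions P" "D y0 \<noteq> 0"
    and w: "\<forall>b\<in>B. \<forall>k\<in>K. w b k \<in> poly_functions P"
    and wB: "\<forall>b\<in>B. \<forall>c\<in>B. \<forall>x. w b c x = (if b = c then D x else 0)"
    and ker: "\<forall>e\<in>E. \<forall>b\<in>B. \<forall>x. (\<Sum>k\<in>K. incidence_row e k x * w b k x) = 0"
    and ind: "\<forall>x. D x \<noteq> 0 \<longrightarrow> (\<forall>l. (\<forall>k\<in>K. (\<Sum>e\<in>F. l e * incidence_row e k x) = 0) \<longrightarrow> (\<forall>e\<in>F. l e = 0))"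
    by (elim exE conjE) (rule that; assumption)
  have finB: "finite B" using finite_subset[OF B fin(2)] .
  have sgF: "simple_graph ?V F"
    by (rule simple_graph_subset[OF sg order_refl F]) (use F simple_graph_edge(1)[OF sg] in blast)
  have finF: "finite F" by (rule simple_graph_finite(2)[OF sgF])
  have sparse: "laman_sparse ?V F"
    unfolding laman_sparse_def
  proof (intro conjI allI impI)
    fix W assume W: "W \<subseteq> ?V" "2 \<le> card W"
    have "finite W" using finite_subset[OF W(1)] by simp
    then obtain u v where uv: "u \<in> W" "v \<in> W" "u \<noteq> v"
      using W(2) card_le_Suc0_iff_eq[of W] by fastforce
    have "(\<lambda>x. x (u, 3) - x (v, 3)) \<in> poly_functions P"
      using uv W(1) by (intro poly_functions_diff poly_functions.coord) (auto simp: P_def)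
    \<comment> \<open>A generic choice of directions: the rows of \<open>F\<close> are independent
      and the points of \<open>u\<close> and \<open>v\<close> are separated.\<close>
    from poly_functions_no_zero_divisors[OF D(1) this D(2), of "\<lambda>p. if p = (u, 3) then 1 else 0"]
    obtain x where x: "D x \<noteq> 0" "x (u, 3) \<noteq> x (v, 3)" using uv(3) by auto
    let ?F = "{e \<in> F. e \<subseteq> W}"
    show "card ?F + 3 \<le> 2 * card W"
    proof (rule independent_rows_bound[where x = x and u = u and v = v])
      show "simple_graph W ?F" by (rule simple_graph_subset[OF sgF W(1)]) auto
      fix l assume l: "\<And>k. k \<in> W \<times> {1, 2} \<Longrightarrow> (\<Sum>e\<in>?F. l e * incidence_row e k x) = 0"
      have sum0: "(\<Sum>e\<in>F. (if e \<subseteq> W then l e else 0) * incidence_row e k x) = 0" if "k \<in> K" for k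
      proof -
        have "(\<Sum>e\<in>F. (if e \<subseteq> W then l e else 0) * incidence_row e k x) = (\<Sum>e\<in>?F. l e * incidence_row e k x)"
          unfolding sum.inter_filter[OF finF] by (rule sum.cong) auto
        also have "\<dots> = 0"
        proof (cases "fst k \<in> W")
          case True
          then have "k \<in> W \<times> {1, 2}" using that by (auto simp: K_def)
          then show ?thesis by (rule l)
        next
          case False
          \<comment> \<open>An edge inside \<open>W\<close> has no entries in the columns of
            vertices outside \<open>W\<close>. Hence a relation over \<open>W\<close> is a relation
            over all columns.\<close>
          then show ?thesis by (intro sum.neutral) (cases k, auto)
        qed
        finally show ?thesis .
      qed
      have l0: "(if e \<subseteq> W then l e else 0) = 0" if "e \<in> F" for e
        by (rule ind[rule_format, OF x(1), where l = "\<lambda>e. if e \<subseteq> W then l e else 0", OF sum0 that])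
      show "\<forall>e\<in>?F. l e = 0"
      proof
        fix e assume "e \<in> ?F"
        then show "l e = 0" using l0[of e] by simp
      qed
    qed (use W uv x in auto)
  qed (rule sgF)

  \<comment> \<open>The parametrisation: directions are kept, and the base points are combinations
    of the kernel vectors with the free coordinates in \<open>B\<close> as coefficients.\<close>
  define \<phi> where "\<phi> y p = (if p \<in> P then y p else if p \<in> K then \<Sum>b\<in>B. y b * w b p y else undefined)" for y p
  define J where "J = P \<union> B"
  have finJ: "finite J" using fin(1) finB by (simp add: J_def)
  have PB: "P \<inter> B = {}" using PK(1) B by blast
  have \<phi>_ext: "\<phi> y \<in> extensional (coords n)" for y
    unfolding extensional_def PK(2) \<phi>_def by simp
  have \<phi>_poly: "(\<lambda>y. \<phi> y p) \<in> poly_functions J" if "p \<in> coords n" for p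
  proof (cases "p \<in> P")
    case True
    then have "(\<lambda>y. \<phi> y p) = (\<lambda>y. y p)" by (simp add: \<phi>_def)
    then show ?thesis using poly_functions.coord[of p J] True by (simp add: J_def)
  next
    case False
    then have p: "p \<in> K" using that PK(2) by simp
    have "(\<lambda>y. \<phi> y p) = (\<lambda>y. \<Sum>b\<in>B. y b * w b p y)" using False p by (simp add: \<phi>_def)
    moreover have "(\<lambda>y. \<Sum>b\<in>B. y b * w b p y) \<in> poly_functions J"
    proof (rule poly_functions_sum[OF finB], rule poly_functions.mult)
      fix b assume b: "b \<in> B"
      show "(\<lambda>y. y b) \<in> poly_functions J" using b by (intro poly_functions.coord) (simp add: J_def)
      have "w b p \<in> poly_functions P" using w b p by blast
      then show "w b p \<in> poly_functions J" by (rule poly_functions_mono) (simp add: J_def)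
    qed
    ultimately show ?thesis by simp
  qed
  \<comment> \<open>The kernel vectors solve the equations of all edges in \<open>E\<close>, not
    only of those in \<open>F\<close>; distinct third coordinates make the lines distinct.\<close>
  have \<phi>_hat: "\<phi> y \<in> X_hat n E" if y: "\<And>i j. i \<in> ?V \<Longrightarrow> j \<in> ?V \<Longrightarrow> i \<noteq> j \<Longrightarrow> y (i, 3) \<noteq> y (j, 3)" for y
  proof -
    have P3: "\<phi> y (i, 3) = y (i, 3)" "\<phi> y (i, 4) = y (i, 4)" if "i \<in> ?V" for i
      using that by (simp_all add: \<phi>_def P_def)
    have "incidence_form (\<phi> y) i j = 0" if ij: "{i, j} \<in> E" for i j
    proof -
      have V: "i \<in> ?V" "j \<in> ?V" "i \<noteq> j" using simple_graph_edge[OF sg ij] by (cases "i = j"; simp)+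
      have "incidence_form (\<phi> y) i j = (\<Sum>k\<in>K. incidence_row {i, j} k y * \<phi> y k)"
        unfolding K_def incidence_row_sum[OF finite_atLeastAtMost V] incidence_form_def
        by (simp only: P3 V)
      also have "\<dots> = (\<Sum>k\<in>K. \<Sum>b\<in>B. y b * (incidence_row {i, j} k y * w b k y))"
      proof (rule sum.cong)
        fix k assume k: "k \<in> K"
        then have "\<phi> y k = (\<Sum>b\<in>B. y b * w b k y)" using PK(1) by (auto simp: \<phi>_def)
        then show "incidence_row {i, j} k y * \<phi> y k = (\<Sum>b\<in>B. y b * (incidence_row {i, j} k y * w b k y))"
          by (simp add: sum_distrib_left mult.left_commute)
      qed simp
      also have "\<dots> = (\<Sum>b\<in>B. \<Sum>k\<in>K. y b * (incidence_row {i, j} k y * w b k y))" by (rule sum.swap)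
      also have "\<dots> = (\<Sum>b\<in>B. y b * (\<Sum>k\<in>K. incidence_row {i, j} k y * w b k y))"
        by (simp add: sum_distrib_left)
      also have "\<dots> = 0" using ker ij by (intro sum.neutral) simp
      finally show ?thesis .
    qed
    moreover have "lines_distinct ?V (\<phi> y)"
      unfolding lines_distinct_def using P3(1) y by (metis (no_types, lifting))
    ultimately show ?thesis using X_hat_iff[OF sg] \<phi>_ext by (simp add: configurations_def)
  qed
  let ?Z = "zariski (coords n)"
  \<comment> \<open>Density: a polynomial that is nonzero at \<open>\<phi> y\<close> is also nonzero
    at some \<open>\<phi> z\<close> with distinct third coordinates, and this point lies in
    \<open>X_hat n E\<close>.\<close>
  have \<phi>_X: "\<phi> y \<in> X_var n E" for y
  proof -
    have "closedin ?Z (X_var n E)" by (simp add: X_var_def)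
    then obtain G where G: "G \<subseteq> poly_functions (coords n)" "X_var n E = zero_locus (coords n) G"
      unfolding closedin_zariski by blast
    have sub: "X_hat n E \<subseteq> X_var n E"
      unfolding X_var_def by (rule closure_of_subset) (auto simp: topspace_zariski X_hat_def)
    have "g (\<phi> y) = 0" if g: "g \<in> G" for g
    proof (rule ccontr)
      assume nz: "g (\<phi> y) \<noteq> 0"
      let ?pairs = "{(i, j). i \<in> ?V \<and> j \<in> ?V \<and> i \<noteq> j}"
      let ?\<Delta> = "\<lambda>z :: nat \<times> nat \<Rightarrow> complex. \<Prod>(i, j)\<in>?pairs. z (i, 3) - z (j, 3)"
      have fp: "finite ?pairs" by (rule finite_subset[of _ "?V \<times> ?V"]) auto
      have 1: "(\<lambda>z. g (\<phi> z)) \<in> poly_functions J"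
        by (rule poly_functions_comp[OF subsetD[OF G(1) g] \<phi>_poly])
      have 2: "?\<Delta> \<in> poly_functions J"
      proof (rule poly_functions_prod[OF fp])
        fix a assume a: "a \<in> ?pairs"
        obtain i j where ij: "a = (i, j)" by (cases a)
        have "(\<lambda>z. z (i, 3) - z (j, 3)) \<in> poly_functions J"
          using a ij by (intro poly_functions_diff poly_functions.coord) (auto simp: J_def P_def)
        then show "(\<lambda>z. case a of (i, j) \<Rightarrow> z (i, 3) - z (j, 3)) \<in> poly_functions J" by (simp add: ij)
      qed
      have 3: "?\<Delta> (\<lambda>(i, m). of_nat i) \<noteq> 0" unfolding prod_zero_iff[OF fp] by auto
      have "\<exists>z. g (\<phi> z) \<noteq> 0 \<and> ?\<Delta> z \<noteq> 0"
        by (rule poly_functions_no_zero_divisors[OF 1 2, where x = y and y = "\<lambda>(i, m). of_nat i"])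
          (fact nz, fact 3)
      then obtain z where z: "g (\<phi> z) \<noteq> 0" "?\<Delta> z \<noteq> 0" by (elim exE conjE)
      have ne: "\<forall>a\<in>?pairs. (case a of (i, j) \<Rightarrow> z (i, 3) - z (j, 3)) \<noteq> 0"
        using z(2) unfolding prod_zero_iff[OF fp] by blast
      have zz: "z (i, 3) \<noteq> z (j, 3)" if "i \<in> ?V" "j \<in> ?V" "i \<noteq> j" for i j
        using bspec[OF ne, of "(i, j)"] that by simp
      have "\<phi> z \<in> X_var n E" by (rule subsetD[OF sub \<phi>_hat[of z, OF zz]])
      then show False using z(1) g unfolding G(2) zero_locus_def by blast
    qed
    then show ?thesis unfolding G(2) zero_locus_def using \<phi>_ext by simp
  qed
  have \<phi>_B: "\<phi> y b = y b * D y" if b: "b \<in> B" for y b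
  proof -
    have "\<phi> y b = (\<Sum>c\<in>B. y c * w c b y)" using b B PB by (auto simp: \<phi>_def)
    also have "\<dots> = (\<Sum>c\<in>B. if c = b then y c * D y else 0)"
      using wB b by (intro sum.cong) auto
    finally show ?thesis using b finB by simp
  qed

  \<comment> \<open>The base point of the chain. The value 0 on \<open>B\<close> matters: an
    unreleased free coordinate of \<open>\<phi>\<close> is 0 times \<open>D\<close>, hence constant
    although \<open>D\<close> varies with the released directions.\<close>
  define o' where "o' p = (if p \<in> P then y0 p else 0)" for p
  define m where "m = card J"
  obtain h where h: "bij_betw h {0..<m} J" unfolding m_def using ex_bij_betw_nat_finite[OF finJ] by blast
  \<comment> \<open>Releases the first \<open>k\<close> parameters in the order \<open>h\<close> and
    freezes the others at the base point.\<close>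
  define \<psi> where "\<psi> k y p = (if p \<in> h ` {0..<k} then y p else o' p)" for k and y :: "nat \<times> nat \<Rightarrow> complex" and p
  define Z where "Z k = ?Z closure_of range (\<lambda>y. \<phi> (\<psi> k y))" for k
  have cl: "closedin ?Z (Z k)" for k by (simp add: Z_def)
  have X: "closedin ?Z (X_var n E)" by (simp add: X_var_def)
  have ZX: "Z k \<subseteq> X_var n E" for k
    unfolding Z_def by (rule closure_of_minimal[OF _ X]) (use \<phi>_X in auto)
  have irr: "irreducible_in ?Z (Z k)" for k
    unfolding Z_def
  proof (rule irreducible_closure_range[where \<theta> = "\<lambda>y. \<phi> (\<psi> k y)" and J = J])
    show "\<phi> (\<psi> k y) \<in> extensional (coords n)" for y by (rule \<phi>_ext)
    fix p assume p: "p \<in> coords n"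
    have "(\<lambda>y. \<psi> k y q) \<in> poly_functions J" if "q \<in> J" for q
      unfolding \<psi>_def using that by (cases "q \<in> h ` {0..<k}") (simp_all add: poly_functions.coord poly_functions.const)
    then show "(\<lambda>y. \<phi> (\<psi> k y) p) \<in> poly_functions J"
      by (intro poly_functions_comp[where f = "\<lambda>y. \<phi> y p" and \<phi> = "\<psi> k", OF \<phi>_poly[OF p]])
  qed
  have strict: "Z k \<subset> Z (Suc k)" if k: "k < m" for k
  proof
    have "\<phi> (\<psi> k y) \<in> range (\<lambda>y. \<phi> (\<psi> (Suc k) y))" for y
    proof -
      have "\<psi> (Suc k) (\<psi> k y) = \<psi> k y" by (auto simp: \<psi>_def fun_eq_iff)
      then show ?thesis by (metis rangeI)
    qed
    then show "Z k \<subseteq> Z (Suc k)" unfolding Z_def by (intro closure_of_mono) auto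
    let ?j = "h k"
    have j: "?j \<in> J" using h k by (auto dest: bij_betwE)
    have jk: "?j \<notin> h ` {0..<k}"
    proof
      assume "?j \<in> h ` {0..<k}"
      then obtain i where i: "h k = h i" "i < k" by auto
      have "k = i" using inj_onD[OF bij_betw_imp_inj_on[OF h] i(1)] i(2) k by simp
      with i(2) show False by simp
    qed
    have jc: "?j \<in> coords n" using j B PK(2) by (auto simp: J_def)
    have van: "x ?j - o' ?j = 0" if "x \<in> Z k" for x
    proof (rule closure_of_zariski_vanishing[where f = "\<lambda>x. x ?j - o' ?j"])
      show "x \<in> ?Z closure_of range (\<lambda>y. \<phi> (\<psi> k y))" using that by (simp add: Z_def)
      show "range (\<lambda>y. \<phi> (\<psi> k y)) \<subseteq> extensional (coords n)" using \<phi>_ext by blast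
      show "(\<lambda>x. x ?j - o' ?j) \<in> poly_functions (coords n)"
        using jc by (intro poly_functions_diff poly_functions.coord poly_functions.const)
      fix x assume "x \<in> range (\<lambda>y. \<phi> (\<psi> k y))"
      then obtain y where x: "x = \<phi> (\<psi> k y)" by blast
      have \<psi>j: "\<psi> k y ?j = o' ?j" using jk by (simp add: \<psi>_def)
      show "x ?j - o' ?j = 0"
      proof (cases "?j \<in> P")
        case True
        then show ?thesis using \<psi>j by (simp add: x \<phi>_def)
      next
        case False
        then have "?j \<in> B" using j by (simp add: J_def)
        then show ?thesis using \<psi>j False by (simp add: x \<phi>_B o'_def)
      qed
    qed
    \<comment> \<open>Moving only the newly released parameter leaves the smaller set. For a
      parameter in \<open>B\<close> the change is multiplied by \<open>D\<close>, which depends only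
      on \<open>P\<close> and so keeps its nonzero value at \<open>y0\<close>.\<close>
    define y1 where "y1 = o'(?j := o' ?j + 1)"
    have y1: "\<psi> (Suc k) y1 = y1" by (auto simp: \<psi>_def y1_def fun_eq_iff)
    have "\<phi> y1 ?j - o' ?j \<noteq> 0"
    proof (cases "?j \<in> P")
      case True
      then show ?thesis by (simp add: \<phi>_def y1_def)
    next
      case False
      then have "?j \<in> B" using j by (simp add: J_def)
      moreover have "D y1 = D y0"
        by (rule poly_functions_cong[OF D(1)]) (use False in \<open>auto simp: y1_def o'_def\<close>)
      ultimately show ?thesis using False D(2) by (simp add: \<phi>_B o'_def y1_def)
    qed
    then have "\<phi> y1 \<notin> Z k" using van by blast
    moreover have "\<phi> y1 \<in> Z (Suc k)"
    proof -
      have "\<phi> y1 \<in> range (\<lambda>y. \<phi> (\<psi> (Suc k) y))" using y1 by (metis rangeI)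
      moreover have "range (\<lambda>y. \<phi> (\<psi> (Suc k) y)) \<subseteq> Z (Suc k)"
        unfolding Z_def by (rule closure_of_subset) (use \<phi>_ext in \<open>auto simp: topspace_zariski\<close>)
      ultimately show ?thesis by blast
    qed
    ultimately show "Z k \<noteq> Z (Suc k)" by blast
  qed
  have "enat m \<le> krull_dim (subtopology ?Z (X_var n E))"
    unfolding krull_dim_def
  proof (rule Sup_upper, intro CollectI exI conjI allI impI)
    show "enat m = enat m" ..
    show "closedin (subtopology ?Z (X_var n E)) (Z i)" for i
      using cl ZX by (simp add: closedin_closed_subtopology[OF X])
    show "irreducible_in (subtopology ?Z (X_var n E)) (Z i)" for i
      using irr ZX by (simp add: irreducible_in_subtopology_closed[OF X])
    show "Z i \<subset> Z (Suc i)" if "i < m" for i by (rule strict[OF that])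
  qed
  moreover have "m = 4 * n - card F"
  proof -
    have "m = card P + card B" unfolding m_def J_def by (rule card_Un_disjoint[OF fin(1) finB PB])
    moreover have "card P = 2 * n" "card K = 2 * n" by (simp_all add: P_def K_def card_cartesian_product)
    ultimately show ?thesis using card by simp
  qed
  ultimately show ?thesis using F sparse by blast
qed

theorem theorem7p1:
  fixes n :: nat and E :: "nat set set"
  assumes "simple_graph {1..n} E"
  shows "krull_dim (subtopology (zariski (coords n)) (X_var n E)) = enat (2 * n + 3)
    \<longleftrightarrow> (\<exists>E'\<subseteq>E. laman {1..n} E')"
proof
  let ?dim = "krull_dim (subtopology (zariski (coords n)) (X_var n E))"
  obtain F where F: "F \<subseteq> E" "laman_sparse {1..n} F" "enat (4 * n - card F) \<le> ?dim"
    using krull_dim_X_var_ge[OF assms] by blast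
  have cardF: "card F + 3 \<le> 2 * n" if "2 \<le> n" using laman_sparse_card(2)[OF F(2)] that by simp
  {
    assume dim: "?dim = enat (2 * n + 3)"
    have "laman_sparse {1..n} {}"
      by (rule laman_sparse_subgraph[OF F(2)]) auto
    \<comment> \<open>The empty edge set gives the trivial bound \<open>4 * n\<close>, which rules
      out \<open>n < 2\<close>; only then does sparsity bound \<open>F\<close> by
      \<open>2 * n - 3\<close>.\<close>
    from krull_dim_X_var_le[OF assms _ this, of "4 * n"] have "2 * n + 3 \<le> 4 * n" by (simp add: dim)
    then have n: "2 \<le> n" by simp
    have "4 * n - card F \<le> 2 * n + 3" using F(3) by (simp add: dim)
    then have "laman {1..n} F" using cardF[OF n] by (intro laman_sparse_imp_laman[OF F(2)]) simp
    then show "\<exists>E'\<subseteq>E. laman {1..n} E'" using F(1) by blast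
  next
    assume "\<exists>E'\<subseteq>E. laman {1..n} E'"
    then obtain E' where E': "E' \<subseteq> E" "laman {1..n} E'" by blast
    then have card: "int (card E') = 2 * int n - 3" by (simp add: laman_def)
    \<comment> \<open>A number of edges is not negative, so \<open>2 * n - 3\<close> is not
      either.\<close>
    then have n: "2 \<le> n" by linarith
    have "?dim \<le> enat (2 * n + 3)"
      by (rule krull_dim_X_var_le[OF assms E'(1) laman_imp_sparse[OF E'(2)]]) (use card in linarith)
    moreover have "enat (2 * n + 3) \<le> ?dim"
      using cardF[OF n] by (intro order_trans[OF _ F(3)]) simp
    ultimately show "?dim = enat (2 * n + 3)" by (rule antisym)
  }
qed

end
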